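(* Let $\delta\ge2$, for $x\ge0$ let $X^{(x)}$ be a squared Bessel process of dimension $\delta$ started from $x$, and let $h\in\mathcal{H}_\infty$. (i) If $\displaystyle\int^{+\infty}\left(\frac{h(t)}{t}\right)^{\frac{\delta-2}{2}}\exp\left\{-\frac{h(t)}{2t}\right\}\frac{dt}{t}<\infty$, then for all $\epsilon>0$ and all $x\ge0$ $$\mathbb{P}\big(X^{(x)}_t>(1+\epsilon)h(t),\ \text{i.o., as }t\to+\infty\big)=0.$$ (ii) If $\displaystyle\int^{+\infty}\left(\frac{h(t)}{t}\right)^{\frac{\delta-2}{2}}\exp\left\{-\frac{h(t)}{2t}\right\}\frac{dt}{t}=\infty$, then for all $\epsilon>0$ and all $x\ge0$ $$\mathbb{P}\big(X^{(x)}_t>(1-\epsilon)h(t),\ \text{i.o., as }t\to+\infty\big)=1.$$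
   Context: A squared Bessel process of dimension $\delta$ started from $x\ge0$ is the nonnegative solution of $X_t=x+2\int_0^t\sqrt{X_s}\,d\beta_s+\delta t$, with $\beta$ a standard Brownian motion. $\mathcal{H}_\infty$ is the set of positive increasing functions $h$ on $(0,\infty)$ such that $\lim_{t\to\infty}h(t)=\infty$ and there exists $\beta'>1$ with $\sup_{t>\beta'} t/h(t)<\infty$. $\int^{+\infty}$ denotes an integral over $(\lambda,\infty)$ for large $\lambda$. "i.o., as $t\to+\infty$" means: for every $s>0$ the event holds for some $t>s$. *)

theory Defs
  imports "HOL-Probability.Probability"
begin

text \<open>
  All processes have index type \<open>real\<close>, and only their values at times \<open>t \<ge> 0\<close> are constrained.
  The filtration is indexed by \<open>real\<close> as well; its members at negative times are never used.
  Path properties (continuity, nonnegativity, initial value of the Brownian motion) are required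
  for every \<open>\<omega>\<close>, identities between processes only almost surely.
\<close>

definition filtered_prob_space :: "'a measure \<Rightarrow> (real \<Rightarrow> 'a measure) \<Rightarrow> bool" where
  "filtered_prob_space M F \<longleftrightarrow>
     prob_space M \<and> filtration (space M) F \<and> (\<forall>t. subalgebra M (F t))"

definition continuous_paths :: "'a measure \<Rightarrow> (real \<Rightarrow> 'a \<Rightarrow> real) \<Rightarrow> bool" where
  "continuous_paths M X \<longleftrightarrow> (\<forall>\<omega>\<in>space M. continuous_on {0..} (\<lambda>t. X t \<omega>))"

definition adapted :: "(real \<Rightarrow> 'a measure) \<Rightarrow> (real \<Rightarrow> 'a \<Rightarrow> real) \<Rightarrow> bool" where
  "adapted F X \<longleftrightarrow> (\<forall>t\<ge>0. X t \<in> borel_measurable (F t))"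

definition brownian_motion ::
  "'a measure \<Rightarrow> (real \<Rightarrow> 'a measure) \<Rightarrow> (real \<Rightarrow> 'a \<Rightarrow> real) \<Rightarrow> bool" where
  "brownian_motion M F B \<longleftrightarrow>
     adapted F B \<and> continuous_paths M B \<and> (\<forall>\<omega>\<in>space M. B 0 \<omega> = 0) \<and>
     (\<forall>s t. 0 \<le> s \<and> s < t \<longrightarrow>
        distributed M lborel (\<lambda>\<omega>. B t \<omega> - B s \<omega>) (normal_density 0 (sqrt (t - s))) \<and>
        prob_space.indep_set M (sets (F s))
          (sets (vimage_algebra (space M) (\<lambda>\<omega>. B t \<omega> - B s \<omega>) borel)))"

text \<open>
  A list of triples \<open>(a, b, \<xi>)\<close> stands for the elementary process
  \<open>t \<mapsto> \<Sum> \<xi> 1\<^bsub>(a, b]\<^esub>(t)\<close>; the intervals may overlap.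
\<close>

type_synonym 'a elementary = "(real \<times> real \<times> ('a \<Rightarrow> real)) list"

definition elementary_process :: "'a measure \<Rightarrow> (real \<Rightarrow> 'a measure) \<Rightarrow> 'a elementary \<Rightarrow> bool" where
  "elementary_process M F E \<longleftrightarrow>
     (\<forall>(a, b, \<xi>)\<in>set E. 0 \<le> a \<and> a \<le> b \<and> \<xi> \<in> borel_measurable (F a) \<and>
        (\<exists>C. \<forall>\<omega>\<in>space M. \<bar>\<xi> \<omega>\<bar> \<le> C))"

definition elementary_val :: "'a elementary \<Rightarrow> real \<Rightarrow> 'a \<Rightarrow> real" where
  "elementary_val E t \<omega> = (\<Sum>(a, b, \<xi>)\<leftarrow>E. \<xi> \<omega> * indicator {a<..b} t)"

definition elementary_integral ::
  "'a elementary \<Rightarrow> (real \<Rightarrow> 'a \<Rightarrow> real) \<Rightarrow> real \<Rightarrow> 'a \<Rightarrow> real" where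
  "elementary_integral E B t \<omega> = (\<Sum>(a, b, \<xi>)\<leftarrow>E. \<xi> \<omega> * (B (min b t) \<omega> - B (min a t) \<omega>))"

definition vanishes_in_probability :: "'a measure \<Rightarrow> (nat \<Rightarrow> 'a \<Rightarrow> ennreal) \<Rightarrow> bool" where
  "vanishes_in_probability M Z \<longleftrightarrow>
     (\<forall>e>0. (\<lambda>n. measure M {\<omega>\<in>space M. ennreal e < Z n \<omega>}) \<longlonglongrightarrow> 0)"

definition approximates ::
  "'a measure \<Rightarrow> (real \<Rightarrow> 'a measure) \<Rightarrow> (nat \<Rightarrow> 'a elementary) \<Rightarrow> (real \<Rightarrow> 'a \<Rightarrow> real) \<Rightarrow> bool" where
  "approximates M F E H \<longleftrightarrow>
     (\<forall>n. elementary_process M F (E n)) \<and>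
     (\<forall>T\<ge>0. vanishes_in_probability M
        (\<lambda>n \<omega>. \<integral>\<^sup>+ s\<in>{0..T}. ennreal ((elementary_val (E n) s \<omega> - H s \<omega>)\<^sup>2) \<partial>lborel))"

definition progressive :: "(real \<Rightarrow> 'a measure) \<Rightarrow> (real \<Rightarrow> 'a \<Rightarrow> real) \<Rightarrow> bool" where
  "progressive F H \<longleftrightarrow>
     (\<forall>T\<ge>0. (\<lambda>(s, \<omega>). H s \<omega>) \<in> borel_measurable (restrict_space borel {0..T} \<Otimes>\<^sub>M F T))"

text \<open>
  \<open>I\<close> is (a continuous version of) the process \<open>t \<mapsto> \<integral>\<^sub>0\<^sup>t H\<^sub>s dB\<^sub>s\<close>: the continuous extension of
  the elementary integral to progressive, locally square integrable integrands, with respect to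
  convergence in probability, uniformly on compact time intervals.  The filtration need not be
  complete, so \<open>I\<close> itself is only required to be measurable at each time.
\<close>

definition ito_integral ::
  "'a measure \<Rightarrow> (real \<Rightarrow> 'a measure) \<Rightarrow> (real \<Rightarrow> 'a \<Rightarrow> real) \<Rightarrow> (real \<Rightarrow> 'a \<Rightarrow> real) \<Rightarrow>
     (real \<Rightarrow> 'a \<Rightarrow> real) \<Rightarrow> bool" where
  "ito_integral M F B H I \<longleftrightarrow>
     progressive F H \<and>
     (\<forall>T\<ge>0. AE \<omega> in M. (\<integral>\<^sup>+ s\<in>{0..T}. ennreal ((H s \<omega>)\<^sup>2) \<partial>lborel) < \<infinity>) \<and>
     (\<forall>t\<ge>0. I t \<in> borel_measurable M) \<and> continuous_paths M I \<and>
     (\<exists>E. approximates M F E H) \<and>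
     (\<forall>E. approximates M F E H \<longrightarrow>
        (\<forall>T\<ge>0. vanishes_in_probability M
           (\<lambda>n \<omega>. \<Squnion>t\<in>{0..T}. ennreal \<bar>elementary_integral (E n) B t \<omega> - I t \<omega>\<bar>)))"

definition squared_bessel ::
  "'a measure \<Rightarrow> real \<Rightarrow> real \<Rightarrow> (real \<Rightarrow> 'a \<Rightarrow> real) \<Rightarrow> bool" where
  "squared_bessel M \<delta> x X \<longleftrightarrow>
     (\<exists>F B I. filtered_prob_space M F \<and> brownian_motion M F B \<and>
        adapted F X \<and> continuous_paths M X \<and> (\<forall>\<omega>\<in>space M. \<forall>t\<ge>0. 0 \<le> X t \<omega>) \<and>
        ito_integral M F B (\<lambda>s \<omega>. sqrt (X s \<omega>)) I \<and>
        (AE \<omega> in M. \<forall>t\<ge>0. X t \<omega> = x + 2 * I t \<omega> + \<delta> * t))"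

text \<open>``Increasing'' is read as nondecreasing; values of \<open>h\<close> outside \<open>(0, \<infinity>)\<close> are irrelevant.\<close>

definition H_infinity :: "(real \<Rightarrow> real) set" where
  "H_infinity = {h. (\<forall>t>0. 0 < h t) \<and> mono_on {0<..} h \<and> filterlim h at_top at_top \<and>
     (\<exists>\<beta>>1. bdd_above ((\<lambda>t. t / h t) ` {\<beta><..}))}"

definition test_integral :: "real \<Rightarrow> (real \<Rightarrow> real) \<Rightarrow> real \<Rightarrow> ennreal" where
  "test_integral \<delta> h l =
     (\<integral>\<^sup>+ t\<in>{l<..}. ennreal ((h t / t) powr ((\<delta> - 2) / 2) * exp (- (h t / (2 * t))) / t) \<partial>lborel)"

text \<open>
  The exceedance events are measurable even though \<open>h\<close> need not be continuous, so that their
  \<open>measure\<close> is the genuine probability.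
\<close>

lemma exceed_infinitely_often_measurable:
  assumes X: "squared_bessel M \<delta> x X" and h: "h \<in> H_infinity"
  shows "{\<omega>\<in>space M. \<forall>s>0. \<exists>t>s. c * h t < X t \<omega>} \<in> sets M"
proof (cases "c < 0")
  case True
  have "\<exists>t>s. c * h t < X t \<omega>" if "\<omega> \<in> space M" "s > 0" for s \<omega>
  proof (intro exI conjI)
    have "c * h (s + 1) < 0"
      using True h that by (auto simp: H_infinity_def mult_neg_pos)
    also have "0 \<le> X (s + 1) \<omega>"
      using X that by (auto simp: squared_bessel_def)
    finally show "c * h (s + 1) < X (s + 1) \<omega>" .
  qed simp
  then have "{\<omega>\<in>space M. \<forall>s>0. \<exists>t>s. c * h t < X t \<omega>} = space M"
    by auto
  then show ?thesis by simp
next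
  case False
  obtain F where F: "\<And>t. subalgebra M (F t)" and ad: "adapted F X" and ct: "continuous_paths M X"
    using X by (auto simp: squared_bessel_def filtered_prob_space_def)
  have meas: "X t \<in> borel_measurable M" if "t \<ge> 0" for t
    using ad that measurable_from_subalg[OF F] by (auto simp: adapted_def)
  have rational: "\<exists>q\<in>\<rat>. q > s \<and> c * h q < X q \<omega>"
    if \<omega>: "\<omega> \<in> space M" and s: "s > 0" and t: "t > s" "c * h t < X t \<omega>" for \<omega> s t
  proof -
    have "isCont (\<lambda>t. X t \<omega>) t"
      using ct \<omega> s t unfolding continuous_paths_def
      by (intro continuous_on_interior[of "{0..}"]) auto
    then have "(\<lambda>t. X t \<omega>) \<midarrow>t\<rightarrow> X t \<omega>" by (simp add: isCont_def)
    then have "\<forall>\<^sub>F r in at t. c * h t < X r \<omega>"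
      using order_tendstoD(1) t(2) by blast
    then obtain d where d: "d > 0" "\<And>r. r \<noteq> t \<Longrightarrow> dist r t < d \<Longrightarrow> c * h t < X r \<omega>"
      unfolding eventually_at by auto
    obtain q where q: "q \<in> \<rat>" "max s (t - d) < q" "q < t"
      using Rats_dense_in_real[of "max s (t - d)" t] d t by auto
    have "h q \<le> h t"
      using h q s by (auto simp: H_infinity_def intro!: mono_onD[of "{0<..}" h])
    then have "c * h q \<le> c * h t"
      using False by (simp add: mult_left_mono)
    also have "\<dots> < X q \<omega>"
      using d(2)[of q] q by (auto simp: dist_real_def)
    finally show ?thesis using q by auto
  qed
  have "{\<omega>\<in>space M. \<forall>s>0. \<exists>t>s. c * h t < X t \<omega>} =
    (\<Inter>n. \<Union>q\<in>{q\<in>\<rat>. q > real (Suc n)}. {\<omega>\<in>space M. c * h q < X q \<omega>})" (is "?L = ?R")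
  proof
    show "?L \<subseteq> ?R"
    proof clarsimp
      fix \<omega> n assume "\<omega> \<in> space M" and *: "\<forall>s>0. \<exists>t>s. c * h t < X t \<omega>"
      moreover obtain t where "t > 1 + real n" "c * h t < X t \<omega>"
        using *[rule_format, of "1 + real n"] by auto
      ultimately show "\<exists>q. q \<in> \<rat> \<and> 1 + real n < q \<and> c * h q < X q \<omega>"
        using rational[of \<omega> "1 + real n" t] by auto
    qed
    show "?R \<subseteq> ?L"
    proof
      fix \<omega> assume R: "\<omega> \<in> ?R"
      have "\<exists>t>s. c * h t < X t \<omega>" for s
      proof -
        obtain n where "s < real n" using reals_Archimedean2 by blast
        moreover obtain q where "real (Suc n) < q" "c * h q < X q \<omega>"
          using R by blast
        ultimately show ?thesis
          by (intro exI[of _ q]) auto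
      qed
      moreover have "\<omega> \<in> space M" using R by blast
      ultimately show "\<omega> \<in> ?L" by blast
    qed
  qed
  also have "\<dots> \<in> sets M"
  proof -
    have "{\<omega> \<in> space M. c * h q < X q \<omega>} \<in> sets M" if "real (Suc n) < q" for n q
    proof -
      have [measurable]: "X q \<in> borel_measurable M" using meas[of q] that by auto
      show ?thesis by measurable
    qed
    moreover have "countable {q \<in> \<rat>. real (Suc n) < q}" for n
      by (rule countable_subset[OF _ countable_rat]) auto
    ultimately have "(\<Union>q\<in>{q\<in>\<rat>. q > real (Suc n)}. {\<omega>\<in>space M. c * h q < X q \<omega>}) \<in> sets M" for n
      by (intro sets.countable_UN') auto
    then show ?thesis
      by (intro sets.countable_INT) auto
  qed
  finally show ?thesis .
qed

end

theory Submission
  imports Defs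
begin

text \<open>
  Two consequences of the equation \<open>dX = 2 sqrt X dB + \<delta> dt\<close> suffice, and neither needs the
  transition density of \<open>X\<close> nor the general change of variables formula.

  Upper bound. For \<open>c > 0\<close> the process \<open>(c + t) powr (- \<delta> / 2) * exp (X t / (2 * (c + t)))\<close> is the
  stochastic exponential (up to its initial value) of \<open>sqrt X / (c + t)\<close>. Discretised, such an exponential is an exact
  martingale by the Gaussian Laplace transform, so in the limit Fatou gives a nonnegative
  supermartingale, and its maximal inequality bounds \<open>X\<close> on the blocks \<open>[q ^ n, q ^ Suc n]\<close> well
  enough for Borel-Cantelli. The factor \<open>1 + \<epsilon>\<close> absorbs all powers of \<open>h t / t\<close>.

  Lower bound. Since \<open>\<delta> \<ge> 2\<close>, the process \<open>sqrt X - B\<close> is almost surely nondecreasing. Hence a large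
  increment of \<open>B\<close> over \<open>[q ^ (n - m), q ^ n]\<close> forces a large value of \<open>X\<close> at time \<open>q ^ n\<close>, and
  increments over disjoint intervals are independent, so that the second Borel-Cantelli lemma applies.
\<close>

section \<open>Increments of Brownian motion\<close>

text \<open>The weight \<open>1 / (2 * (c + t))\<close> is forced. For a function \<lambda> of time,
  \<lambda> X has drift (\<lambda>' X + \<delta> \<lambda>) dt and martingale part 2 \<lambda> sqrt
  X dB; in the exponential the terms in X cancel exactly when \<lambda>' = - 2 \<lambda>^2, and
  \<delta> \<lambda> integrates to the power of c + t. The formal equation d sqrt X = dB + (\<delta>
  - 1) / (2 sqrt X) dt is singular where X vanishes. Its smooth substitute s = sqrt (X + \<eta>)
  carries only the part sqrt X / s of dB, so B - s keeps a martingale part. Because \<delta> \<ge>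
  2, the drift of (B - s) / sqrt \<eta> still compensates the exponential of that part, so an excess
  of \<theta> has probability at most exp (- \<theta> / (2 sqrt \<eta>)), which vanishes with
  \<eta>. What shapes the estimates is the Euler remainder of the stochastic integral over one step:
  it is controlled only in mean square and is too large for a sum of absolute values. Its weighted
  sums are therefore treated as martingale sums on a still finer grid.\<close>

locale brownian = prob_space M for M :: "'a measure" +
  fixes F :: "real \<Rightarrow> 'a measure" and B :: "real \<Rightarrow> 'a \<Rightarrow> real"
  assumes filtered: "filtered_prob_space M F" and brownian: "brownian_motion M F B"
begin

lemma subalg: "subalgebra M (F t)"
  using filtered by (auto simp: filtered_prob_space_def)

lemma space_F: "space (F t) = space M"
  using subalg[of t] by (simp add: subalgebra_def)

lemma sets_F_mono: "s \<le> t \<Longrightarrow> sets (F s) \<subseteq> sets (F t)"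
  using filtered unfolding filtered_prob_space_def by (auto dest: filtration.sets_F_mono)

lemma sets_F_M: "A \<in> sets (F t) \<Longrightarrow> A \<in> sets M"
  using subalg[of t] by (auto simp: subalgebra_def)

lemma measurable_F_mono: "f \<in> measurable (F s) N \<Longrightarrow> s \<le> t \<Longrightarrow> f \<in> measurable (F t) N"
  using measurable_mono[of N N "F s" "F t"] sets_F_mono[of s t] space_F by auto

lemma measurable_F_M: "f \<in> measurable (F s) N \<Longrightarrow> f \<in> measurable M N"
  using measurable_from_subalg[OF subalg] .

lemma B_adapted: "0 \<le> t \<Longrightarrow> B t \<in> borel_measurable (F t)"
  using brownian by (auto simp: brownian_motion_def adapted_def)

lemma B_adapted_le: "0 \<le> s \<Longrightarrow> s \<le> t \<Longrightarrow> B s \<in> borel_measurable (F t)"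
  using B_adapted measurable_F_mono by blast

lemma B_measurable: "0 \<le> t \<Longrightarrow> B t \<in> borel_measurable M"
  using B_adapted measurable_F_M by blast

lemma B_cont: "\<omega> \<in> space M \<Longrightarrow> continuous_on {0..} (\<lambda>t. B t \<omega>)"
  using brownian by (auto simp: brownian_motion_def continuous_paths_def)

lemma increment_distributed:
  assumes "0 \<le> u" "u < v"
  shows "distributed M lborel (\<lambda>\<omega>. B v \<omega> - B u \<omega>) (normal_density 0 (sqrt (v - u)))"
  using brownian assms unfolding brownian_motion_def by blast

lemma increment_indep:
  assumes "0 \<le> u" "u < v"
  shows "indep_set (sets (F u)) {(\<lambda>\<omega>. B v \<omega> - B u \<omega>) -` A \<inter> space M |A. A \<in> sets borel}"
proof -
  have "indep_set (sets (F u)) (sets (vimage_algebra (space M) (\<lambda>\<omega>. B v \<omega> - B u \<omega>) borel))"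
    using brownian assms unfolding brownian_motion_def by blast
  then show ?thesis by (subst (asm) sets_vimage_algebra2) auto
qed

lemma increment_measurable:
  assumes "0 \<le> u" "u < v"
  shows "(\<lambda>\<omega>. B v \<omega> - B u \<omega>) \<in> borel_measurable M"
  using assms by (intro borel_measurable_diff B_measurable) auto

text \<open>The identity map, read as a random element of \<open>F u\<close>, carries the whole past
  at once. Independence on rectangles \<open>A \<times> C\<close> then determines the joint law of
  past and increment as a product measure.\<close>

lemma distr_pair_increment:
  assumes uv: "0 \<le> u" "u < v"
  shows "distr M (F u) (\<lambda>\<omega>. \<omega>) \<Otimes>\<^sub>M distr M borel (\<lambda>\<omega>. B v \<omega> - B u \<omega>)
    = distr M (F u \<Otimes>\<^sub>M borel) (\<lambda>\<omega>. (\<omega>, B v \<omega> - B u \<omega>))"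
proof -
  let ?D = "\<lambda>\<omega>. B v \<omega> - B u \<omega>"
  have m[measurable]: "?D \<in> borel_measurable M"
    by (rule increment_measurable[OF uv])
  have i[measurable]: "(\<lambda>\<omega>. \<omega>) \<in> measurable M (F u)"
    using measurable_F_M[OF measurable_ident_sets[OF refl]] by simp
  have m2: "(\<lambda>\<omega>. (\<omega>, ?D \<omega>)) \<in> measurable M (F u \<Otimes>\<^sub>M borel)" by measurable
  interpret D: prob_space "distr M borel ?D" by (intro prob_space_distr) simp
  interpret U: prob_space "distr M (F u) (\<lambda>\<omega>. \<omega>)" by (intro prob_space_distr) simp
  show ?thesis
  proof (rule pair_measure_eqI)
    show "sigma_finite_measure (distr M (F u) (\<lambda>\<omega>. \<omega>))" "sigma_finite_measure (distr M borel ?D)"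
      by unfold_locales
    show "sets (distr M (F u) (\<lambda>\<omega>. \<omega>) \<Otimes>\<^sub>M distr M borel ?D)
      = sets (distr M (F u \<Otimes>\<^sub>M borel) (\<lambda>\<omega>. (\<omega>, ?D \<omega>)))"
      by simp
    fix A C assume "A \<in> sets (distr M (F u) (\<lambda>\<omega>. \<omega>))" "C \<in> sets (distr M borel ?D)"
    then have A: "A \<in> sets (F u)" and C: "C \<in> sets borel" by auto
    have AM: "A \<in> sets M" and "A \<subseteq> space M" using A sets_F_M sets.sets_into_space by blast+
    then have 1: "(\<lambda>\<omega>. \<omega>) -` A \<inter> space M = A" by auto
    have 2: "(\<lambda>\<omega>. (\<omega>, ?D \<omega>)) -` (A \<times> C) \<inter> space M = A \<inter> (?D -` C \<inter> space M)" by auto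
    have "prob (A \<inter> (?D -` C \<inter> space M)) = prob A * prob (?D -` C \<inter> space M)"
      using C by (intro indep_setD[OF increment_indep[OF uv] A]) auto
    then show "emeasure (distr M (F u) (\<lambda>\<omega>. \<omega>)) A * emeasure (distr M borel ?D) C
      = emeasure (distr M (F u \<Otimes>\<^sub>M borel) (\<lambda>\<omega>. (\<omega>, ?D \<omega>))) (A \<times> C)"
      using A C \<open>A \<subseteq> space M\<close>
      by (simp add: emeasure_distr 1 2 emeasure_distr[OF m2] emeasure_eq_measure ennreal_mult' Int_absorb2)
  qed
qed

text \<open>Conditioning on \<open>F u\<close> in the form of Fubini's theorem: the past is a fixed
  parameter while the increment is integrated against its Gaussian density.\<close>

lemma nn_integral_freeze:
  fixes f :: "'a \<times> real \<Rightarrow> ennreal"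
  assumes uv: "0 \<le> u" "u < v"
    and f[measurable]: "f \<in> borel_measurable (F u \<Otimes>\<^sub>M borel)"
  shows "(\<integral>\<^sup>+\<omega>. f (\<omega>, B v \<omega> - B u \<omega>) \<partial>M)
    = (\<integral>\<^sup>+\<omega>. (\<integral>\<^sup>+y. normal_density 0 (sqrt (v - u)) y * f (\<omega>, y) \<partial>lborel) \<partial>M)"
proof -
  let ?D = "\<lambda>\<omega>. B v \<omega> - B u \<omega>"
  have m[measurable]: "?D \<in> borel_measurable M"
    by (rule increment_measurable[OF uv])
  have i[measurable]: "(\<lambda>\<omega>. \<omega>) \<in> measurable M (F u)"
    using measurable_F_M[OF measurable_ident_sets[OF refl]] by simp
  have eq: "distr M (F u) (\<lambda>\<omega>. \<omega>) \<Otimes>\<^sub>M distr M borel ?D = distr M (F u \<Otimes>\<^sub>M borel) (\<lambda>\<omega>. (\<omega>, ?D \<omega>))"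
    by (rule distr_pair_increment[OF uv])
  interpret D: prob_space "distr M borel ?D" by (intro prob_space_distr) simp
  have m2: "(\<lambda>\<omega>. (\<omega>, ?D \<omega>)) \<in> measurable M (F u \<Otimes>\<^sub>M borel)" by measurable
  have "(\<integral>\<^sup>+\<omega>. f (\<omega>, ?D \<omega>) \<partial>M) = integral\<^sup>N (distr M (F u \<Otimes>\<^sub>M borel) (\<lambda>\<omega>. (\<omega>, ?D \<omega>))) f"
    using f by (subst nn_integral_distr[OF m2]) simp_all
  also have "\<dots> = integral\<^sup>N (distr M (F u) (\<lambda>\<omega>. \<omega>) \<Otimes>\<^sub>M distr M borel ?D) f"
    by (simp add: eq)
  also have "\<dots> = (\<integral>\<^sup>+\<omega>. (\<integral>\<^sup>+y. f (\<omega>, y) \<partial>distr M borel ?D) \<partial>distr M (F u) (\<lambda>\<omega>. \<omega>))"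
    by (rule D.nn_integral_fst[symmetric]) simp
  also have "\<dots> = (\<integral>\<^sup>+\<omega>. (\<integral>\<^sup>+y. f (\<omega>, y) \<partial>distr M borel ?D) \<partial>M)"
    by (subst nn_integral_distr) (simp_all add: D.borel_measurable_nn_integral)
  also have "\<dots> = (\<integral>\<^sup>+\<omega>. (\<integral>\<^sup>+y. normal_density 0 (sqrt (v - u)) y * f (\<omega>, y) \<partial>lborel) \<partial>M)"
  proof (rule nn_integral_cong)
    fix \<omega> assume "\<omega> \<in> space M"
    then have [measurable]: "(\<lambda>y. f (\<omega>, y)) \<in> borel_measurable borel"
      using space_F[of u] by (auto intro!: measurable_compose[OF _ f] measurable_Pair1')
    have "distr M borel ?D = distr M lborel ?D" by (rule distr_cong) auto
    also have "\<dots> = density lborel (normal_density 0 (sqrt (v - u)))"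
      using increment_distributed[OF uv] by (simp add: distributed_def)
    finally show "(\<integral>\<^sup>+y. f (\<omega>, y) \<partial>distr M borel ?D)
      = (\<integral>\<^sup>+y. normal_density 0 (sqrt (v - u)) y * f (\<omega>, y) \<partial>lborel)"
      by (simp add: nn_integral_density)
  qed
  finally show ?thesis .
qed

lemma exp_increment:
  assumes uv: "0 \<le> u" "u < v"
    and Y[measurable]: "Y \<in> borel_measurable (F u)" and a[measurable]: "a \<in> borel_measurable (F u)"
  shows "(\<integral>\<^sup>+\<omega>. Y \<omega> * ennreal (exp (a \<omega> * (B v \<omega> - B u \<omega>) - (a \<omega>)\<^sup>2 * (v - u) / 2)) \<partial>M)
    = (\<integral>\<^sup>+\<omega>. Y \<omega> \<partial>M)"
proof -
  let ?f = "\<lambda>(\<omega>, y). Y \<omega> * ennreal (exp (a \<omega> * y - (a \<omega>)\<^sup>2 * (v - u) / 2))"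
  have "(\<integral>\<^sup>+\<omega>. ?f (\<omega>, B v \<omega> - B u \<omega>) \<partial>M)
    = (\<integral>\<^sup>+\<omega>. (\<integral>\<^sup>+y. normal_density 0 (sqrt (v - u)) y * ?f (\<omega>, y) \<partial>lborel) \<partial>M)"
    by (rule nn_integral_freeze[OF uv, of ?f]) measurable
  also have "\<dots> = (\<integral>\<^sup>+\<omega>. Y \<omega> \<partial>M)"
  proof (rule nn_integral_cong)
    fix \<omega>
    \<comment> \<open>Completing the square: the exponential tilt of the centred Gaussian is the
      Gaussian with mean \<open>a \<omega> * (v - u)\<close>, so its total mass is 1 for every
      frozen \<omega>.\<close>
    have "normal_density 0 (sqrt (v - u)) y * exp (a \<omega> * y - (a \<omega>)\<^sup>2 * (v - u) / 2)
       = normal_density (a \<omega> * (v - u)) (sqrt (v - u)) y" for y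
      using uv by (simp add: normal_density_def mult_exp_exp power2_eq_square field_simps)
    then have "(\<integral>\<^sup>+y. normal_density 0 (sqrt (v - u)) y * ?f (\<omega>, y) \<partial>lborel)
      = (\<integral>\<^sup>+y. Y \<omega> * normal_density (a \<omega> * (v - u)) (sqrt (v - u)) y \<partial>lborel)"
      by (intro nn_integral_cong) (simp add: mult.left_commute ennreal_mult'[symmetric])
    also have "\<dots> = Y \<omega> * (\<integral>\<^sup>+y. normal_density (a \<omega> * (v - u)) (sqrt (v - u)) y \<partial>lborel)"
      by (rule nn_integral_cmult) simp
    also have "(\<integral>\<^sup>+y. normal_density (a \<omega> * (v - u)) (sqrt (v - u)) y \<partial>lborel) = 1"
      using uv by (subst nn_integral_eq_integral) auto
    finally show "(\<integral>\<^sup>+y. normal_density 0 (sqrt (v - u)) y * ?f (\<omega>, y) \<partial>lborel) = Y \<omega>" by simp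
  qed
  finally show ?thesis by simp
qed

text \<open>The signed version of freezing, for real weights. It makes cross terms vanish when the
  function \<phi> of the increment is centred.\<close>

lemma indep_mult:
  fixes Y :: "'a \<Rightarrow> real" and \<phi> :: "real \<Rightarrow> real"
  assumes uv: "0 \<le> u" "u < v"
    and Y: "Y \<in> borel_measurable (F u)" "integrable M Y"
    and p: "\<phi> \<in> borel_measurable borel" "integrable M (\<lambda>\<omega>. \<phi> (B v \<omega> - B u \<omega>))"
  shows "integrable M (\<lambda>\<omega>. Y \<omega> * \<phi> (B v \<omega> - B u \<omega>))"
    and "expectation (\<lambda>\<omega>. Y \<omega> * \<phi> (B v \<omega> - B u \<omega>)) = expectation Y * expectation (\<lambda>\<omega>. \<phi> (B v \<omega> - B u \<omega>))"
proof -
  let ?D = "\<lambda>\<omega>. B v \<omega> - B u \<omega>"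
  have mD: "?D \<in> borel_measurable M"
    by (rule increment_measurable[OF uv])
  have mY: "Y \<in> borel_measurable M" using Y measurable_F_M by blast
  have mp: "(\<lambda>\<omega>. \<phi> (?D \<omega>)) \<in> borel_measurable M" by (rule measurable_compose[OF mD p(1)])
  have "indep_set {Y -` A \<inter> space M |A. A \<in> sets borel} {(\<lambda>\<omega>. \<phi> (?D \<omega>)) -` A \<inter> space M |A. A \<in> sets borel}"
    unfolding indep_sets2_eq
  proof safe
    fix A :: "real set" assume A: "A \<in> sets borel"
    show "Y -` A \<inter> space M \<in> events" "(\<lambda>\<omega>. \<phi> (?D \<omega>)) -` A \<inter> space M \<in> events"
      using A mY mp by (auto intro: measurable_sets)
    fix C :: "real set" assume C: "C \<in> sets borel"
    have 1: "Y -` A \<inter> space M \<in> sets (F u)"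
      using measurable_sets[OF Y(1) A] by (simp add: space_F)
    have 2: "(\<lambda>\<omega>. \<phi> (?D \<omega>)) -` C \<inter> space M = ?D -` (\<phi> -` C) \<inter> space M" by auto
    have 3: "\<phi> -` C \<in> sets borel" using measurable_sets[OF p(1) C] by simp
    show "prob ((Y -` A \<inter> space M) \<inter> ((\<lambda>\<omega>. \<phi> (?D \<omega>)) -` C \<inter> space M))
      = prob (Y -` A \<inter> space M) * prob ((\<lambda>\<omega>. \<phi> (?D \<omega>)) -` C \<inter> space M)"
      unfolding 2 using 3 by (intro indep_setD[OF increment_indep[OF uv] 1]) auto
  qed
  \<comment> \<open>Preimages of Borel sets already form a \<sigma>-algebra, so independence of the
    two families is independence of the generated \<sigma>-algebras.\<close>
  moreover have "sigma_sets (space M) {Z -` A \<inter> space M |A. A \<in> sets borel}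
      = {Z -` A \<inter> space M |A. A \<in> sets borel}" for Z :: "'a \<Rightarrow> real"
    using sets.sigma_sets_eq[of "vimage_algebra (space M) Z borel"]
    by (simp add: sets_vimage_algebra2)
  ultimately have "indep_var borel Y borel (\<lambda>\<omega>. \<phi> (?D \<omega>))"
    unfolding indep_var_eq using mY mp by simp
  from indep_var_integrable[OF this Y(2) p(2)] indep_var_lebesgue_integral[OF this Y(2) p(2)]
  show "integrable M (\<lambda>\<omega>. Y \<omega> * \<phi> (B v \<omega> - B u \<omega>))"
    "expectation (\<lambda>\<omega>. Y \<omega> * \<phi> (B v \<omega> - B u \<omega>)) = expectation Y * expectation (\<lambda>\<omega>. \<phi> (B v \<omega> - B u \<omega>))"
    by auto
qed

lemma
  assumes uv: "0 \<le> u" "u < v"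
  shows increment_power_integrable: "integrable M (\<lambda>\<omega>. (B v \<omega> - B u \<omega>) ^ k)"
    and increment_mean: "expectation (\<lambda>\<omega>. B v \<omega> - B u \<omega>) = 0"
    and increment_moment2: "expectation (\<lambda>\<omega>. (B v \<omega> - B u \<omega>)\<^sup>2) = v - u"
    and increment_moment4: "expectation (\<lambda>\<omega>. (B v \<omega> - B u \<omega>) ^ 4) = 3 * (v - u)\<^sup>2"
proof -
  have s: "0 < sqrt (v - u)" using uv by simp
  note d = increment_distributed[OF uv]
  show "integrable M (\<lambda>\<omega>. (B v \<omega> - B u \<omega>) ^ k)"
    using integrable_normal_moment[OF s, of 0 k]
    by (subst distributed_integrable[OF d, symmetric]) auto
  have e: "expectation (\<lambda>\<omega>. (B v \<omega> - B u \<omega>) ^ k) = (\<integral>y. normal_density 0 (sqrt (v - u)) y * y ^ k \<partial>lborel)" for k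
    by (subst distributed_integral[OF d, symmetric]) auto
  show "expectation (\<lambda>\<omega>. B v \<omega> - B u \<omega>) = 0"
    using e[of 1] integral_normal_moment_odd[OF s, of 0 0] by simp
  show "expectation (\<lambda>\<omega>. (B v \<omega> - B u \<omega>)\<^sup>2) = v - u"
    using e[of 2] integral_normal_moment_even[OF s, of 0 1] uv by (simp add: fact_numeral)
  show "expectation (\<lambda>\<omega>. (B v \<omega> - B u \<omega>) ^ 4) = 3 * (v - u)\<^sup>2"
    using e[of 4] integral_normal_moment_even[OF s, of 0 2] uv
    by (simp add: fact_numeral power_divide field_simps)
qed

lemma increment_integrable:
  assumes uv: "0 \<le> u" "u < v"
  shows "integrable M (\<lambda>\<omega>. B v \<omega> - B u \<omega>)"
  using increment_power_integrable[OF uv, of 1] by simp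

end

section \<open>Martingale sums and convergence in probability\<close>

context brownian begin

lemma integrable_mult_bounded:
  fixes f g :: "'a \<Rightarrow> real"
  assumes f: "integrable M f" and g: "g \<in> borel_measurable M" and b: "\<And>\<omega>. \<omega> \<in> space M \<Longrightarrow> \<bar>g \<omega>\<bar> \<le> C"
  shows "integrable M (\<lambda>\<omega>. f \<omega> * g \<omega>)"
proof (rule Bochner_Integration.integrable_bound)
  show "integrable M (\<lambda>\<omega>. C * f \<omega>)" using f by simp
  show "(\<lambda>\<omega>. f \<omega> * g \<omega>) \<in> borel_measurable M" using f g by measurable
  show "AE \<omega> in M. norm (f \<omega> * g \<omega>) \<le> norm (C * f \<omega>)"
  proof (rule AE_I2)
    fix \<omega> assume w: "\<omega> \<in> space M"
    have "\<bar>f \<omega>\<bar> * \<bar>g \<omega>\<bar> \<le> \<bar>f \<omega>\<bar> * \<bar>C\<bar>" using b[OF w] by (intro mult_left_mono) auto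
    then show "norm (f \<omega> * g \<omega>) \<le> norm (C * f \<omega>)" by (simp add: abs_mult mult.commute)
  qed
qed

text \<open>Each summand is a coefficient known at the left end of its step times a centred function
  of the next increment. Mixed products therefore have mean zero and the squares add up. The
  function \<phi> is general because both the increment itself and its centred square occur
  later.\<close>

lemma martingale_sum_square:
  fixes a :: "nat \<Rightarrow> 'a \<Rightarrow> real" and \<phi> :: "real \<Rightarrow> real" and h :: real
  defines "\<zeta> \<equiv> \<lambda>k \<omega>. \<phi> (B (real (Suc k) * h) \<omega> - B (real k * h) \<omega>)"
  assumes h: "h > 0"
    and a: "\<And>k. a k \<in> borel_measurable (F (real k * h))" "\<And>k \<omega>. \<omega> \<in> space M \<Longrightarrow> \<bar>a k \<omega>\<bar> \<le> C"
    and p: "\<phi> \<in> borel_measurable borel" "\<And>k. integrable M (\<zeta> k)"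
      "\<And>k. integrable M (\<lambda>\<omega>. (\<zeta> k \<omega>)\<^sup>2)" "\<And>k. expectation (\<zeta> k) = 0"
  shows "integrable M (\<lambda>\<omega>. (\<Sum>k<N. a k \<omega> * \<zeta> k \<omega>)\<^sup>2)"
    and "expectation (\<lambda>\<omega>. (\<Sum>k<N. a k \<omega> * \<zeta> k \<omega>)\<^sup>2)
      = (\<Sum>k<N. expectation (\<lambda>\<omega>. (a k \<omega>)\<^sup>2) * expectation (\<lambda>\<omega>. (\<zeta> k \<omega>)\<^sup>2))"
proof -
  let ?S = "\<lambda>N \<omega>. \<Sum>k<N. a k \<omega> * \<zeta> k \<omega>"
  have uv: "0 \<le> real k * h" "real k * h < real (Suc k) * h" for k using h by auto
  have zm: "\<zeta> k \<in> borel_measurable (F (real (Suc k) * h))" for k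
    unfolding \<zeta>_def using uv[of k]
    by (intro measurable_compose[OF _ p(1)] borel_measurable_diff B_adapted_le) auto
  have Sm: "?S N \<in> borel_measurable (F (real N * h))" for N
  proof (intro borel_measurable_sum borel_measurable_times)
    fix k assume "k \<in> {..<N}"
    then have "real (Suc k) * h \<le> real N * h" using h by (intro mult_right_mono) auto
    then show "\<zeta> k \<in> borel_measurable (F (real N * h))" "a k \<in> borel_measurable (F (real N * h))"
      using measurable_F_mono[OF zm] measurable_F_mono[OF a(1)[of k]] uv(2)[of k] by auto
  qed
  have "integrable M (\<lambda>\<omega>. (?S N \<omega>)\<^sup>2) \<and> expectation (\<lambda>\<omega>. (?S N \<omega>)\<^sup>2)
      = (\<Sum>k<N. expectation (\<lambda>\<omega>. (a k \<omega>)\<^sup>2) * expectation (\<lambda>\<omega>. (\<zeta> k \<omega>)\<^sup>2))"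
  proof (induction N)
    case 0 then show ?case by simp
  next
    case (Suc N)
    note aM = measurable_F_M[OF a(1)[of N]] and SM = measurable_F_M[OF Sm[of N]]
    have Si: "integrable M (?S N)"
      using Suc SM by (auto intro: square_integrable_imp_integrable)
    have a2: "integrable M (\<lambda>\<omega>. (a N \<omega>)\<^sup>2)"
    proof (rule integrable_const_bound[of _ "C\<^sup>2"])
      show "AE \<omega> in M. norm ((a N \<omega>)\<^sup>2) \<le> C\<^sup>2"
        using a(2)[of _ N] by (auto intro!: AE_I2 power2_le_iff_abs_le[THEN iffD2] intro: order_trans[OF abs_ge_zero])
    qed (use aM in measurable)
    have Sa: "integrable M (\<lambda>\<omega>. ?S N \<omega> * a N \<omega>)"
      by (rule integrable_mult_bounded[OF Si aM a(2)])
    have Sam: "(\<lambda>\<omega>. ?S N \<omega> * a N \<omega>) \<in> borel_measurable (F (real N * h))"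
      using Sm[of N] a(1)[of N] by measurable
    have a2m: "(\<lambda>\<omega>. (a N \<omega>)\<^sup>2) \<in> borel_measurable (F (real N * h))"
      using a(1)[of N] by measurable
    have p2: "(\<lambda>y. (\<phi> y)\<^sup>2) \<in> borel_measurable borel" using p(1) by measurable
    have z: "\<zeta> N = (\<lambda>\<omega>. \<phi> (B (real (Suc N) * h) \<omega> - B (real N * h) \<omega>))"
      by (simp add: \<zeta>_def)
    have 1: "integrable M (\<lambda>\<omega>. ?S N \<omega> * a N \<omega> * \<zeta> N \<omega>)"
      "expectation (\<lambda>\<omega>. ?S N \<omega> * a N \<omega> * \<zeta> N \<omega>) = expectation (\<lambda>\<omega>. ?S N \<omega> * a N \<omega>) * expectation (\<zeta> N)"
      using indep_mult[OF uv Sam Sa p(1) p(2)[of N, unfolded z]] unfolding z by blast+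
    have 2: "integrable M (\<lambda>\<omega>. (a N \<omega>)\<^sup>2 * (\<zeta> N \<omega>)\<^sup>2)"
      "expectation (\<lambda>\<omega>. (a N \<omega>)\<^sup>2 * (\<zeta> N \<omega>)\<^sup>2) = expectation (\<lambda>\<omega>. (a N \<omega>)\<^sup>2) * expectation (\<lambda>\<omega>. (\<zeta> N \<omega>)\<^sup>2)"
      using indep_mult[OF uv a2m a2 p2 p(3)[of N, unfolded z]] unfolding z by blast+
    have eq: "(?S (Suc N) \<omega>)\<^sup>2 = (?S N \<omega>)\<^sup>2 + (2 * (?S N \<omega> * a N \<omega> * \<zeta> N \<omega>) + (a N \<omega>)\<^sup>2 * (\<zeta> N \<omega>)\<^sup>2)" for \<omega>
      by (simp add: power2_eq_square algebra_simps)
        show ?case unfolding eq using Suc 1 2 p(4)[of N] by simp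
  qed
  then show "integrable M (\<lambda>\<omega>. (?S N \<omega>)\<^sup>2)" "expectation (\<lambda>\<omega>. (?S N \<omega>)\<^sup>2)
      = (\<Sum>k<N. expectation (\<lambda>\<omega>. (a k \<omega>)\<^sup>2) * expectation (\<lambda>\<omega>. (\<zeta> k \<omega>)\<^sup>2))"
    by auto
qed

text \<open>The factors are integrated out from the last one backwards, each having conditional mean
  1. The weight \<open>Y\<close> from the past of index i makes this a martingale property and not
  just an identity of means.\<close>

lemma exponential_sum:
  fixes a :: "nat \<Rightarrow> 'a \<Rightarrow> real" and h :: real
  assumes h: "h > 0" and a: "\<And>k. a k \<in> borel_measurable (F (real k * h))"
    and Y: "Y \<in> borel_measurable (F (real i * h))" and ij: "i \<le> j"
  shows "(\<integral>\<^sup>+\<omega>. Y \<omega> * ennreal (exp (\<Sum>k\<in>{i..<j}. a k \<omega> * (B (real (Suc k) * h) \<omega> - B (real k * h) \<omega>)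
      - (a k \<omega>)\<^sup>2 * h / 2)) \<partial>M) = (\<integral>\<^sup>+\<omega>. Y \<omega> \<partial>M)"
  using ij
proof (induction j rule: dec_induct)
  case base then show ?case by simp
next
  case (step j)
  let ?s = "\<lambda>k \<omega>. a k \<omega> * (B (real (Suc k) * h) \<omega> - B (real k * h) \<omega>) - (a k \<omega>)\<^sup>2 * h / 2"
  let ?Z = "\<lambda>\<omega>. Y \<omega> * ennreal (exp (\<Sum>k\<in>{i..<j}. ?s k \<omega>))"
  have le: "real k * h \<le> real j * h" if "k \<le> j" for k using h that by (intro mult_right_mono) auto
  have "?s k \<in> borel_measurable (F (real j * h))" if "k \<in> {i..<j}" for k
    using that h measurable_F_mono[OF a le] B_adapted_le[OF _ le, of k] B_adapted_le[OF _ le, of "Suc k"]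
    by auto
  then have "(\<lambda>\<omega>. \<Sum>k\<in>{i..<j}. ?s k \<omega>) \<in> borel_measurable (F (real j * h))"
    by (rule borel_measurable_sum)
  moreover have "Y \<in> borel_measurable (F (real j * h))"
    using measurable_F_mono[OF Y le] step by simp
  ultimately have "?Z \<in> borel_measurable (F (real j * h))" by measurable
  from exp_increment[OF _ _ this a[of j], of "real (Suc j) * h"] h
  have *: "(\<integral>\<^sup>+\<omega>. ?Z \<omega> * ennreal (exp (?s j \<omega>)) \<partial>M) = (\<integral>\<^sup>+\<omega>. ?Z \<omega> \<partial>M)"
    by (simp add: algebra_simps)
  have "(\<integral>\<^sup>+\<omega>. Y \<omega> * ennreal (exp (\<Sum>k\<in>{i..<Suc j}. ?s k \<omega>)) \<partial>M) = (\<integral>\<^sup>+\<omega>. ?Z \<omega> * ennreal (exp (?s j \<omega>)) \<partial>M)"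
    using step by (intro nn_integral_cong) (simp add: exp_add ennreal_mult' mult.assoc)
  then show ?case using * step by simp
qed

end

section \<open>Convergence in probability\<close>

context prob_space begin

text \<open>No measurability is needed: \<open>measure\<close> vanishes on sets that are not measurable.\<close>

lemma vanishes_in_probabilityI:
  assumes "\<And>\<omega> e. \<omega> \<in> space M \<Longrightarrow> e > 0 \<Longrightarrow> \<forall>\<^sub>F n in sequentially. Z n \<omega> \<le> ennreal e"
  shows "vanishes_in_probability M Z"
  unfolding vanishes_in_probability_def
proof (intro allI impI)
  fix e :: real assume e: "e > 0"
  define A where "A n = (let S = {\<omega> \<in> space M. ennreal e < Z n \<omega>} in if S \<in> events then S else {})" for n
  have A: "A n \<in> events" "A n \<subseteq> {\<omega> \<in> space M. ennreal e < Z n \<omega>}"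
    "measure M {\<omega> \<in> space M. ennreal e < Z n \<omega>} = measure M (A n)" for n
    by (auto simp: A_def Let_def measure_notin_sets)
  have "(\<lambda>n. \<integral>\<omega>. indicator (A n) \<omega> \<partial>M) \<longlonglongrightarrow> (\<integral>\<omega>. (0::real) \<partial>M)"
  proof (rule integral_dominated_convergence[where w="\<lambda>_. 1"])
    show "AE \<omega> in M. (\<lambda>n. indicator (A n) \<omega>) \<longlonglongrightarrow> (0::real)"
    proof (rule AE_I2)
      fix \<omega> assume "\<omega> \<in> space M"
      then have "\<forall>\<^sub>F n in sequentially. Z n \<omega> \<le> ennreal e" using assms e by blast
      then have "\<forall>\<^sub>F n in sequentially. indicator (A n) \<omega> = (0::real)"
        by eventually_elim (use A(2) in \<open>force simp: indicator_def\<close>)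
      then show "(\<lambda>n. indicator (A n) \<omega>) \<longlonglongrightarrow> (0::real)" by (rule tendsto_eventually)
    qed
  qed (use A(1) in auto)
  then show "(\<lambda>n. measure M {\<omega> \<in> space M. ennreal e < Z n \<omega>}) \<longlonglongrightarrow> 0"
    using A(1) by (simp add: A(3) Int_absorb2 sets.sets_into_space)
qed

text \<open>Indices are chosen along which exceeding \<open>(1/2)^k\<close> has probability below
  \<open>(1/2)^k\<close>; the first Borel-Cantelli lemma does the rest.\<close>

lemma vanishes_in_probability_subseq:
  assumes v: "vanishes_in_probability M Z" and m[measurable]: "\<And>n. Z n \<in> borel_measurable M"
  obtains r where "strict_mono r" "AE \<omega> in M. \<forall>e>0. \<forall>\<^sub>F n in sequentially. Z (r n) \<omega> \<le> ennreal e"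
proof -
  let ?p = "\<lambda>k n. measure M {\<omega> \<in> space M. ennreal ((1/2)^k) < Z n \<omega>}"
  have "\<exists>N. \<forall>n\<ge>N. ?p k n < (1/2)^k" for k
  proof -
    have "?p k \<longlonglongrightarrow> 0" using v unfolding vanishes_in_probability_def by simp
    then show ?thesis using order_tendstoD(2)[of "?p k" 0 sequentially "(1/2)^k"]
      by (auto simp: eventually_sequentially)
  qed
  then obtain N where N: "\<And>k n. n \<ge> N k \<Longrightarrow> ?p k n < (1/2)^k" by metis
  \<comment> \<open>The maximum secures both strict growth and \<open>r k \<ge> N k\<close>.\<close>
  define r where "r = rec_nat (N 0) (\<lambda>k m. max (Suc m) (N (Suc k)))"
  have r: "strict_mono r" unfolding strict_mono_Suc_iff r_def by (simp add: less_max_iff_disj)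
  have rN: "r k \<ge> N k" for k unfolding r_def by (cases k) auto
  have "AE \<omega> in M. \<forall>\<^sub>F n in sequentially. \<omega> \<in> space M - {\<omega> \<in> space M. ennreal ((1/2)^n) < Z (r n) \<omega>}"
  proof (rule borel_cantelli_AE1)
    show "{\<omega> \<in> space M. ennreal ((1/2)^n) < Z (r n) \<omega>} \<in> events" for n by measurable
    show "emeasure M {\<omega> \<in> space M. ennreal ((1/2)^n) < Z (r n) \<omega>} < \<infinity>" for n
      by (simp add: emeasure_eq_measure)
    show "summable (\<lambda>n. measure M {\<omega> \<in> space M. ennreal ((1/2)^n) < Z (r n) \<omega>})"
      by (rule summable_comparison_test'[of "\<lambda>n. (1/2)^n" 0])
         (use N rN in \<open>auto intro: less_imp_le\<close>)
  qed
  then have "AE \<omega> in M. \<forall>e>0. \<forall>\<^sub>F n in sequentially. Z (r n) \<omega> \<le> ennreal e"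
  proof eventually_elim
    case (elim \<omega>)
    show ?case
    proof (intro allI impI)
      fix e :: real assume "e > 0"
      then have "\<forall>\<^sub>F n in sequentially. (1/2)^n < e"
        using order_tendstoD(2)[OF LIMSEQ_realpow_zero[of "1/2"]] by auto
      with elim show "\<forall>\<^sub>F n in sequentially. Z (r n) \<omega> \<le> ennreal e"
      proof eventually_elim
        case (elim n)
        then have "Z (r n) \<omega> \<le> ennreal ((1/2)^n)" by (auto simp: not_less)
        also have "\<dots> \<le> ennreal e" using elim by (intro ennreal_leI) auto
        finally show ?case .
      qed
    qed
  qed
  with r show thesis by (rule that)
qed

end

section \<open>Dyadic approximation of the stochastic integral\<close>

definition mesh :: "nat \<Rightarrow> real" where "mesh n = (1/2)^n"

abbreviation grid :: "nat \<Rightarrow> nat \<Rightarrow> real" where "grid n k \<equiv> real k * mesh n"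

lemma mesh_pos: "0 < mesh n"
  by (simp add: mesh_def)

lemma mesh_le_1: "mesh n \<le> 1"
  by (simp add: mesh_def power_le_one)

lemma mesh_tendsto_0: "mesh \<longlonglongrightarrow> 0"
  unfolding mesh_def by (rule LIMSEQ_realpow_zero) auto

lemma mesh_mult: "2 ^ n * mesh n = 1"
  by (simp add: mesh_def power_one_over)

lemma grid_le: "j \<le> k \<Longrightarrow> grid n j \<le> grid n k"
  using mesh_pos[of n] by (intro mult_right_mono) auto

lemma grid_refine: "n \<le> m \<Longrightarrow> grid m (p * 2 ^ (m - n)) = grid n p"
  by (simp add: mesh_def power_one_over field_simps power_add[symmetric])

text \<open>Level m of the approximation has \<open>4 ^ m\<close> steps of length
  \<open>mesh m\<close>. A fixed grid point of level N with index j lies in that range as soon as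
  \<open>m \<ge> N + j\<close>.\<close>

lemma refined_index_bound:
  assumes "N + j \<le> m"
  shows "j * 2 ^ (m - N) \<le> 4 ^ m"
proof -
  have "j * 2 ^ (m - N) \<le> 2 ^ j * 2 ^ (m - N)" by (intro mult_right_mono) (auto intro: less_imp_le less_exp)
  also have "\<dots> = 2 ^ (j + (m - N))" by (simp add: power_add)
  also have "\<dots> \<le> 2 ^ (2 * m)" using assms by (intro power_increasing) auto
  also have "\<dots> = 4 ^ m" by (simp add: power_mult)
  finally show ?thesis .
qed

text \<open>Turns the uniform distance of two continuous processes into a countable supremum, which
  is measurable.\<close>

lemma SUP_Rats_Icc:
  fixes f :: "real \<Rightarrow> real" and T :: real
  assumes c: "continuous_on {0..} f"
  shows "(SUP t\<in>{0..T}. ennreal \<bar>f t\<bar>) = (SUP t\<in>{0..T} \<inter> \<rat>. ennreal \<bar>f t\<bar>)"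
proof (rule antisym)
  show "(SUP t\<in>{0..T} \<inter> \<rat>. ennreal \<bar>f t\<bar>) \<le> (SUP t\<in>{0..T}. ennreal \<bar>f t\<bar>)"
    by (rule SUP_subset_mono) auto
  show "(SUP t\<in>{0..T}. ennreal \<bar>f t\<bar>) \<le> (SUP t\<in>{0..T} \<inter> \<rat>. ennreal \<bar>f t\<bar>)" (is "_ \<le> ?R")
  proof (rule SUP_least)
    fix t assume t: "t \<in> {0..T}"
    have "ennreal \<bar>f t\<bar> \<le> ?R + ennreal e" if e: "e > 0" for e
    proof -
      obtain d where d: "d > 0" "\<And>s. s \<ge> 0 \<Longrightarrow> \<bar>s - t\<bar> < d \<Longrightarrow> \<bar>f s - f t\<bar> < e"
        using c t e unfolding continuous_on_iff dist_real_def by fastforce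
      obtain q where q: "q \<in> {0..T} \<inter> \<rat>" "\<bar>q - t\<bar> < d"
      proof (cases "t = 0")
        case True with t d that[of 0] show thesis by auto
      next
        case False
        then obtain q where "q \<in> \<rat>" "max 0 (t - d) < q" "q < t"
          using Rats_dense_in_real[of "max 0 (t - d)" t] t d by auto
        with t that[of q] show thesis by auto
      qed
      then have "\<bar>f t\<bar> \<le> \<bar>f q\<bar> + e" using d(2)[of q] by auto
      then have "ennreal \<bar>f t\<bar> \<le> ennreal \<bar>f q\<bar> + ennreal e"
        using e by (simp add: ennreal_plus[symmetric] ennreal_leI del: ennreal_plus)
      also have "\<dots> \<le> ?R + ennreal e" using q by (intro add_right_mono SUP_upper) auto
      finally show ?thesis .
    qed
    then show "ennreal \<bar>f t\<bar> \<le> ?R" by (rule ennreal_le_epsilon)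
  qed
qed

locale squared_bessel_process = brownian M F B for M :: "'a measure" and F B +
  fixes X I :: "real \<Rightarrow> 'a \<Rightarrow> real" and x \<delta> :: real
  assumes X_ad: "adapted F X" and X_paths: "continuous_paths M X"
    and X_nonneg: "\<And>\<omega> t. \<omega> \<in> space M \<Longrightarrow> 0 \<le> t \<Longrightarrow> 0 \<le> X t \<omega>"
    and ito: "ito_integral M F B (\<lambda>s \<omega>. sqrt (X s \<omega>)) I"
    and X_eq: "AE \<omega> in M. \<forall>t\<ge>0. X t \<omega> = x + 2 * I t \<omega> + \<delta> * t"
    and \<delta>_ge: "\<delta> \<ge> 2"
begin

lemma X_adapted: "0 \<le> t \<Longrightarrow> X t \<in> borel_measurable (F t)"
  using X_ad by (auto simp: adapted_def)

lemma X_measurable: "0 \<le> t \<Longrightarrow> X t \<in> borel_measurable M"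
  using X_adapted measurable_F_M by blast

lemma X_cont: "\<omega> \<in> space M \<Longrightarrow> continuous_on {0..} (\<lambda>t. X t \<omega>)"
  using X_paths by (auto simp: continuous_paths_def)

lemma I_cont: "\<omega> \<in> space M \<Longrightarrow> continuous_on {0..} (\<lambda>t. I t \<omega>)"
  using ito by (auto simp: ito_integral_def continuous_paths_def)

lemma I_measurable: "0 \<le> t \<Longrightarrow> I t \<in> borel_measurable M"
  using ito by (auto simp: ito_integral_def)

text \<open>Coefficients of elementary processes have to be bounded, hence the cap n. A path of
  \<open>sqrt X\<close> is bounded on compact time intervals, so there the cap is eventually
  inactive.\<close>

definition \<xi> :: "nat \<Rightarrow> nat \<Rightarrow> 'a \<Rightarrow> real" where
  "\<xi> n k \<omega> = min (real n) (sqrt (X (grid n k) \<omega>))"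

text \<open>With \<open>4 ^ n\<close> steps of length \<open>(1/2)^n\<close> the covered times are
  those in \<open>{0<..2 ^ n}\<close>, so mesh and horizon improve together.\<close>

definition E :: "nat \<Rightarrow> 'a elementary" where
  "E n = map (\<lambda>k. (grid n k, grid n (Suc k), \<xi> n k)) [0..<4 ^ n]"

definition J :: "nat \<Rightarrow> real \<Rightarrow> 'a \<Rightarrow> real" where
  "J n = elementary_integral (E n) B"

definition dB :: "nat \<Rightarrow> nat \<Rightarrow> 'a \<Rightarrow> real" where
  "dB n k \<omega> = B (grid n (Suc k)) \<omega> - B (grid n k) \<omega>"

lemma grid_nonneg: "0 \<le> grid n k"
  using mesh_pos[of n] by simp

lemma \<xi>_adapted: "\<xi> n k \<in> borel_measurable (F (grid n k))"
  unfolding \<xi>_def using X_adapted[OF grid_nonneg, of k n] by measurable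

lemma \<xi>_bounds: "\<omega> \<in> space M \<Longrightarrow> 0 \<le> \<xi> n k \<omega>" "\<omega> \<in> space M \<Longrightarrow> \<xi> n k \<omega> \<le> real n"
  using X_nonneg[OF _ grid_nonneg] by (auto simp: \<xi>_def)

lemma J_sum: "J n t \<omega> = (\<Sum>k<4 ^ n. \<xi> n k \<omega> * (B (min (grid n (Suc k)) t) \<omega> - B (min (grid n k) t) \<omega>))"
  by (simp add: J_def elementary_integral_def E_def comp_def interv_sum_list_conv_sum_set_nat atLeast0LessThan)

lemma J_grid:
  assumes "p \<le> 4 ^ n"
  shows "J n (grid n p) \<omega> = (\<Sum>k<p. \<xi> n k \<omega> * dB n k \<omega>)"
proof -
  have "J n (grid n p) \<omega> = (\<Sum>k<4 ^ n. if k < p then \<xi> n k \<omega> * dB n k \<omega> else 0)"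
    unfolding J_sum
  proof (rule sum.cong)
    fix k
    show "\<xi> n k \<omega> * (B (min (grid n (Suc k)) (grid n p)) \<omega> - B (min (grid n k) (grid n p)) \<omega>)
      = (if k < p then \<xi> n k \<omega> * dB n k \<omega> else 0)"
      using grid_le[of "Suc k" p n] grid_le[of p k n] grid_le[of k p n] grid_le[of p "Suc k" n]
      by (auto simp: min_absorb1 min_absorb2 dB_def not_less simp del: of_nat_Suc)
  qed simp
  also have "\<dots> = (\<Sum>k\<in>{..<4 ^ n} \<inter> {k. k < p}. \<xi> n k \<omega> * dB n k \<omega>)"
    by (simp add: sum.inter_restrict)
  also have "{..<4 ^ n} \<inter> {k. k < p} = {..<p}" using assms by auto
  finally show ?thesis .
qed

lemma J_cont: "\<omega> \<in> space M \<Longrightarrow> continuous_on {0..} (\<lambda>t. J n t \<omega>)"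
  unfolding J_sum using mesh_pos[of n]
  by (intro continuous_intros continuous_on_compose2[OF B_cont]) auto

lemma J_measurable: "0 \<le> t \<Longrightarrow> J n t \<in> borel_measurable M"
  unfolding J_sum using mesh_pos[of n]
  by (intro borel_measurable_sum borel_measurable_times borel_measurable_diff B_measurable
      measurable_F_M[OF \<xi>_adapted]) auto

lemma elementary_val_E:
  assumes k: "k < 4 ^ n" and s: "grid n k < s" "s \<le> grid n (Suc k)"
  shows "elementary_val (E n) s \<omega> = \<xi> n k \<omega>"
proof -
  have "elementary_val (E n) s \<omega> = (\<Sum>j<4 ^ n. \<xi> n j \<omega> * indicator {grid n j<..grid n (Suc j)} s)"
    by (simp add: elementary_val_def E_def comp_def interv_sum_list_conv_sum_set_nat atLeast0LessThan)
  also have "\<dots> = (\<Sum>j<4 ^ n. if j = k then \<xi> n k \<omega> else 0)"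
  proof (rule sum.cong)
    fix j
    consider "j < k" | "j = k" | "k < j" by linarith
    then show "\<xi> n j \<omega> * indicator {grid n j<..grid n (Suc j)} s = (if j = k then \<xi> n k \<omega> else 0)"
    proof cases
      case 1 then show ?thesis using grid_le[of "Suc j" k n] s by (auto simp: indicator_def)
    next
      case 2 then show ?thesis using s by (auto simp: indicator_def)
    next
      case 3 then show ?thesis using grid_le[of "Suc k" j n] s by (auto simp: indicator_def)
    qed
  qed simp
  finally show ?thesis using k by simp
qed

lemma grid_interval:
  assumes s: "0 < s" "s \<le> 2 ^ n"
  obtains k where "k < 4 ^ n" "grid n k < s" "s \<le> grid n (Suc k)"
proof
  \<comment> \<open>The intervals are open on the left, so the index is the ceiling minus one;
    positivity of s makes the subtraction on naturals exact.\<close>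
  let ?k = "nat \<lceil>s * 2 ^ n\<rceil> - 1"
  have pos: "0 < s * 2 ^ n" using s by simp
  then have k1: "real (Suc ?k) = of_int \<lceil>s * 2 ^ n\<rceil>"
    using zero_less_ceiling[of "s * 2 ^ n"] by (simp add: of_nat_diff)
  have "s * 2 ^ n \<le> 2 ^ n * 2 ^ n" using s by (intro mult_right_mono) auto
  also have "\<dots> = (4::real) ^ n" by (simp add: power_mult_distrib[symmetric])
  finally have "\<lceil>s * 2 ^ n\<rceil> \<le> 4 ^ n" by (simp add: ceiling_le_iff)
  then have "nat \<lceil>s * 2 ^ n\<rceil> \<le> 4 ^ n" by (simp add: nat_le_iff)
  moreover have "0 < nat \<lceil>s * 2 ^ n\<rceil>" using pos by simp
  ultimately show "?k < 4 ^ n" by linarith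
  have c: "s * 2 ^ n \<le> real (Suc ?k)" "real ?k < s * 2 ^ n"
    using k1 ceiling_correct[of "s * 2 ^ n"] by linarith+
  have m: "mesh n = 1 / 2 ^ n" by (simp add: mesh_def power_one_over)
  show "grid n ?k < s" "s \<le> grid n (Suc ?k)"
    using c unfolding m by (simp_all add: field_simps)
qed

text \<open>The convergence even holds path by path: on \<open>{0..T}\<close> the path of
  \<open>sqrt X\<close> is bounded and uniformly continuous, so a fine mesh and a high cap bring the
  step function uniformly close.\<close>

lemma E_approximates: "approximates M F E (\<lambda>s \<omega>. sqrt (X s \<omega>))"
  unfolding approximates_def
proof (intro conjI allI impI)
  fix n
  have "\<exists>C. \<forall>\<omega>\<in>space M. \<bar>\<xi> n k \<omega>\<bar> \<le> C" for k
    using \<xi>_bounds[of _ n k] by (intro exI[of _ "real n"]) auto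
  then show "elementary_process M F (E n)"
    using \<xi>_adapted grid_nonneg[of _ n] grid_le[of _ _ n]
    by (auto simp: elementary_process_def E_def simp del: of_nat_Suc)
next
  fix T :: real assume T: "0 \<le> T"
  show "vanishes_in_probability M (\<lambda>n \<omega>. \<integral>\<^sup>+ s\<in>{0..T}. ennreal ((elementary_val (E n) s \<omega> - sqrt (X s \<omega>))\<^sup>2) \<partial>lborel)"
  proof (rule vanishes_in_probabilityI)
    fix \<omega> e assume w: "\<omega> \<in> space M" and e: "e > (0::real)"
    define f where "f s = sqrt (X s \<omega>)" for s
    have f: "continuous_on {0..T} f"
      unfolding f_def by (intro continuous_intros continuous_on_subset[OF X_cont[OF w]]) auto
    obtain K where "\<forall>y\<in>f ` {0..T}. norm y \<le> K"
      using compact_imp_bounded[OF compact_continuous_image[OF f]] unfolding bounded_iff by auto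
    then have K: "\<bar>f s\<bar> \<le> K" if "s \<in> {0..T}" for s using that by auto
    define q where "q = sqrt (e / (T + 1))"
    have q: "q > 0" "q\<^sup>2 = e / (T + 1)" using e T by (auto simp: q_def)
    obtain d where d: "d > 0" "\<And>s t. s \<in> {0..T} \<Longrightarrow> t \<in> {0..T} \<Longrightarrow> \<bar>s - t\<bar> < d \<Longrightarrow> \<bar>f s - f t\<bar> < q"
      by (rule uniformly_continuous_onE[OF compact_uniformly_continuous[OF f compact_Icc] q(1)])
         (auto simp: dist_real_def)
    have "\<forall>\<^sub>F n in sequentially. mesh n < d"
      using order_tendstoD(2)[OF mesh_tendsto_0] d by blast
    moreover have "\<forall>\<^sub>F n in sequentially. n \<ge> nat \<lceil>max K T\<rceil>" by (rule eventually_ge_at_top)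
    ultimately show "\<forall>\<^sub>F n in sequentially. (\<integral>\<^sup>+ s\<in>{0..T}. ennreal ((elementary_val (E n) s \<omega> - sqrt (X s \<omega>))\<^sup>2) \<partial>lborel) \<le> ennreal e"
    proof eventually_elim
      case (elim n)
      then have n: "K \<le> real n" "T \<le> real n" by linarith+
      have "real n \<le> 2 ^ n" by (simp add: less_imp_le of_nat_less_two_power)
      with n have T2: "T \<le> 2 ^ n" by linarith
      have A: "\<bar>elementary_val (E n) s \<omega> - f s\<bar> \<le> q" if s: "s \<in> {0..T}" "s \<noteq> 0" for s
      proof -
        obtain k where k: "k < 4 ^ n" "grid n k < s" "s \<le> grid n (Suc k)"
          using grid_interval[of s n] s T2 by auto
        then have k0: "grid n k \<in> {0..T}" "\<bar>grid n k - s\<bar> < d"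
          using s grid_nonneg[of k n] elim by (auto simp: algebra_simps)
        have "elementary_val (E n) s \<omega> = f (grid n k)"
          using elementary_val_E[OF k, of \<omega>] abs_le_D1[OF K[OF k0(1)]] n(1)
          unfolding \<xi>_def f_def by linarith
        then show ?thesis using d(2)[OF k0(1) s(1) k0(2)] by simp
      qed
      then have *: "(elementary_val (E n) s \<omega> - f s)\<^sup>2 \<le> q\<^sup>2" if "s \<in> {0..T}" "s \<noteq> 0" for s
        using power_mono[OF A[OF that] abs_ge_zero, of 2] by simp
      have "(\<integral>\<^sup>+ s\<in>{0..T}. ennreal ((elementary_val (E n) s \<omega> - f s)\<^sup>2) \<partial>lborel)
        \<le> (\<integral>\<^sup>+ s. ennreal (q\<^sup>2) * indicator {0..T} s \<partial>lborel)"
      proof (rule nn_integral_mono_AE)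
        show "AE s in lborel. ennreal ((elementary_val (E n) s \<omega> - f s)\<^sup>2) * indicator {0..T} s
          \<le> ennreal (q\<^sup>2) * indicator {0..T} s"
          \<comment> \<open>Time 0 lies in none of the left-open intervals, but it is a null
            set.\<close>
          using AE_lborel_singleton[of "0::real"]
          by eventually_elim (use * in \<open>auto simp: indicator_def intro!: ennreal_leI\<close>)
      qed
      also have "\<dots> = ennreal (q\<^sup>2) * ennreal T" using T by (simp add: nn_integral_cmult_indicator)
      also have "\<dots> = ennreal (q\<^sup>2 * T)" by (rule ennreal_mult''[symmetric, OF T])
      also have "\<dots> \<le> ennreal e" using T e unfolding q(2) by (intro ennreal_leI) (simp add: field_simps)
      finally show ?case by (simp add: f_def)
    qed
  qed
qed

text \<open>The defining property of the Ito integral, applied to the concrete sequence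
  \<open>E\<close>, gives uniform convergence in probability. All later passages from
  \<open>J\<close> to \<open>I\<close> are made path by path along such a subsequence.\<close>

lemma J_subseq_uniform:
  fixes T :: real
  assumes T: "T \<ge> 0"
  obtains r where "strict_mono r"
    "AE \<omega> in M. \<forall>e>0. \<forall>\<^sub>F n in sequentially. \<forall>t\<in>{0..T}. \<bar>J (r n) t \<omega> - I t \<omega>\<bar> \<le> e"
proof -
  let ?Z = "\<lambda>n \<omega>. SUP t\<in>{0..T}. ennreal \<bar>J n t \<omega> - I t \<omega>\<bar>"
  have v: "vanishes_in_probability M ?Z"
    using ito E_approximates T unfolding ito_integral_def J_def by blast
  have m: "?Z n \<in> borel_measurable M" for n
  proof -
    have "?Z n \<omega> = (SUP t\<in>{0..T} \<inter> \<rat>. ennreal \<bar>J n t \<omega> - I t \<omega>\<bar>)" if "\<omega> \<in> space M" for \<omega>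
      using that by (intro SUP_Rats_Icc continuous_intros J_cont I_cont)
    moreover have "(\<lambda>\<omega>. SUP t\<in>{0..T} \<inter> \<rat>. ennreal \<bar>J n t \<omega> - I t \<omega>\<bar>) \<in> borel_measurable M"
    proof (rule borel_measurable_SUP)
      show "countable ({0..T} \<inter> \<rat>)" by (rule countable_subset[OF _ countable_rat]) auto
      fix t assume "t \<in> {0..T} \<inter> \<rat>"
      then have [measurable]: "J n t \<in> borel_measurable M" "I t \<in> borel_measurable M"
        using J_measurable I_measurable by auto
      show "(\<lambda>\<omega>. ennreal \<bar>J n t \<omega> - I t \<omega>\<bar>) \<in> borel_measurable M" by measurable
    qed
    ultimately show ?thesis by (simp cong: measurable_cong)
  qed
  obtain r where r: "strict_mono r" "AE \<omega> in M. \<forall>e>0. \<forall>\<^sub>F n in sequentially. ?Z (r n) \<omega> \<le> ennreal e"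
    using vanishes_in_probability_subseq[OF v m] by blast
  have "AE \<omega> in M. \<forall>e>0. \<forall>\<^sub>F n in sequentially. \<forall>t\<in>{0..T}. \<bar>J (r n) t \<omega> - I t \<omega>\<bar> \<le> e"
    using r(2)
  proof eventually_elim
    case (elim \<omega>)
    show ?case
    proof (intro allI impI)
      fix e :: real assume e: "e > 0"
      with elim have "\<forall>\<^sub>F n in sequentially. ?Z (r n) \<omega> \<le> ennreal e" by blast
      then show "\<forall>\<^sub>F n in sequentially. \<forall>t\<in>{0..T}. \<bar>J (r n) t \<omega> - I t \<omega>\<bar> \<le> e"
        by eventually_elim (use e in \<open>auto simp: SUP_le_iff\<close>)
    qed
  qed
  with r(1) show thesis by (rule that)
qed

end

section \<open>The exponential supermartingale\<close>

text \<open>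
  One step of the telescoping sum for \<open>Y\<close>. The two correction terms in \<open>V\<close> that involve \<open>e\<close> absorb the
  distance between the elementary integral \<open>J\<close> and \<open>I\<close> (summation by parts, as \<open>1 / (c + t)\<close> decreases)
  and the oscillation of \<open>X t / (c + t)\<close> over one step.
\<close>

lemma exponent_step:
  fixes c h t e \<delta> :: real
  assumes c: "c > 0" and t: "t \<ge> 0" and h: "h > 0" and d: "\<delta> \<ge> 0" and e: "e \<ge> 0"
    and J: "z = J' - J0" "\<bar>J' - I'\<bar> \<le> e" "X0 = x + 2 * I0 + \<delta> * t" "X' = x + 2 * I' + \<delta> * (t + h)"
    and u: "\<bar>X' / (c + (t + h)) - X0 / (c + t)\<bar> \<le> e"
  defines "V \<equiv> \<lambda>Jt It Xt t. (Jt - It) / (c + t) + Xt / (2 * (c + t)) - \<delta> / 2 * ln (c + t)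
    + (\<delta> / 2 * h + e) / (c + t) - e * t / (2 * c)"
  shows "V J' I' X' (t + h) - V J0 I0 X0 t \<le> z / (c + t) - X0 / (c + t)\<^sup>2 * h / 2"
proof -
  define g where "g = 1 / (c + t)"
  define g' where "g' = 1 / (c + (t + h))"
  have pos: "c + t > 0" "c + (t + h) > 0" using c t h by auto
  have gpos: "g > 0" "g' > 0" using pos by (auto simp: g_def g'_def)
  \<comment> \<open>Discrete counterpart of d(1 / (c + t)) = - (1 / (c + t))^2 dt.\<close>
  have gg: "g - g' = g * g' * h"
    using pos by (simp add: g_def g'_def field_simps)
  have gle: "g \<le> 1 / c" "g' \<le> g" using c t h by (auto simp: g_def g'_def field_simps)
  have ln: "g' * h \<le> ln (c + (t + h)) - ln (c + t)"
  proof -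
    have "ln ((c + t) / (c + (t + h))) \<le> (c + t) / (c + (t + h)) - 1"
      using pos by (intro ln_le_minus_one) auto
    also have "\<dots> = - (g' * h)" using pos by (simp add: g'_def field_simps)
    finally show ?thesis using pos by (simp add: ln_div)
  qed
  define D where "D = J0 - I0"
  define D' where "D' = J' - I'"
  have "z / (c + t) - X0 / (c + t)\<^sup>2 * h / 2 = g * (D' - D) + g * (X' - X0 - \<delta> * h) / 2 - g\<^sup>2 * X0 * h / 2"
  proof -
    have z: "z = D' - D + (X' - X0 - \<delta> * h) / 2"
    proof -
      have "X' - X0 = 2 * (I' - I0) + \<delta> * h" using J by (simp add: algebra_simps)
      then have *: "(X' - X0 - \<delta> * h) / 2 = I' - I0" by simp
      show ?thesis unfolding * D_def D'_def using J(1) by linarith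
    qed
    have "z / (c + t) = g * z" "X0 / (c + t)\<^sup>2 = g\<^sup>2 * X0"
      by (simp_all add: g_def power_divide)
    then show ?thesis unfolding z by (simp add: algebra_simps)
  qed
  also have "\<dots> = g' * D' - g * D + (g - g') * D' + ((g' * X' - g * X0) + (g - g') * X' - g\<^sup>2 * X0 * h) / 2
      - \<delta> / 2 * (g' * h) - \<delta> / 2 * (g - g') * h"
    by (simp add: field_simps)
  \<comment> \<open>The two terms quadratic in g cancel up to the oscillation of X / (c + t) over
    the step, which the hypothesis \<open>u\<close> bounds by e.\<close>
  also have "(g' * X' - g * X0) + (g - g') * X' - g\<^sup>2 * X0 * h = (g' * X' - g * X0) + h * (g * (g' * X' - g * X0))"
  proof -
    have "(g - g') * X' = g * g' * h * X'" by (simp only: gg)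
    then show ?thesis by (simp add: power2_eq_square algebra_simps)
  qed
  finally have eq: "z / (c + t) - X0 / (c + t)\<^sup>2 * h / 2 = g' * D' - g * D + (g - g') * D'
      + ((g' * X' - g * X0) + h * (g * (g' * X' - g * X0))) / 2
      - \<delta> / 2 * (g' * h) - \<delta> / 2 * (g - g') * h" .
  have 1: "(g - g') * D' \<ge> - ((g - g') * e)"
  proof -
    have "(g - g') * (- e) \<le> (g - g') * D'" using J(2) gle by (intro mult_left_mono) (auto simp: D'_def)
    then show ?thesis by simp
  qed
  have 2: "h * (g * (g' * X' - g * X0)) \<ge> - (h * e / c)"
  proof -
    have "\<bar>g * (g' * X' - g * X0)\<bar> \<le> 1 / c * e"
      unfolding abs_mult using u gle gpos c by (intro mult_mono) (auto simp: g_def g'_def)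
    then have "- (1 / c * e) \<le> g * (g' * X' - g * X0)" by linarith
    then have "h * (- (1 / c * e)) \<le> h * (g * (g' * X' - g * X0))" using h by (intro mult_left_mono) auto
    then show ?thesis by simp
  qed
  have 3: "\<delta> / 2 * (g' * h) \<le> \<delta> / 2 * (ln (c + (t + h)) - ln (c + t))"
    using ln d by (intro mult_left_mono) auto
  have V: "V J' I' X' (t + h) - V J0 I0 X0 t = g' * D' - g * D + (g' * X' - g * X0) / 2
      - \<delta> / 2 * (ln (c + (t + h)) - ln (c + t)) - (\<delta> / 2 * h + e) * (g - g') - h * e / c / 2"
    using c pos unfolding V_def g_def g'_def D_def D'_def
    by (simp add: add_divide_distrib diff_divide_distrib algebra_simps)
  have 4: "(\<delta> / 2 * h + e) * (g - g') = \<delta> / 2 * (g - g') * h + (g - g') * e"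
    by (simp add: algebra_simps)
  show ?thesis unfolding V eq 4 using 1 2 3 by argo
qed

lemma exp_le_iff_eps:
  fixes R :: ennreal
  assumes "\<And>e. e > 0 \<Longrightarrow> ennreal (exp (y - e)) \<le> R"
  shows "ennreal (exp y) \<le> R"
proof (rule LIMSEQ_le_const2)
  show "(\<lambda>n. ennreal (exp (y - 1 / real (Suc n)))) \<longlonglongrightarrow> ennreal (exp y)"
  proof (intro tendsto_ennrealI tendsto_exp)
    have "(\<lambda>n. y - inverse (real (Suc n))) \<longlonglongrightarrow> y - 0"
      by (intro tendsto_intros LIMSEQ_inverse_real_of_nat)
    then show "(\<lambda>n. y - 1 / real (Suc n)) \<longlonglongrightarrow> y" by (simp add: inverse_eq_divide)
  qed
qed (use assms in auto)

context squared_bessel_process begin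

definition Y :: "real \<Rightarrow> real \<Rightarrow> 'a \<Rightarrow> real" where
  "Y c u \<omega> = X u \<omega> / (2 * (c + u)) - \<delta> / 2 * ln (c + u)"

lemma Y_adapted: "0 \<le> u \<Longrightarrow> Y c u \<in> borel_measurable (F u)"
  unfolding Y_def using X_adapted[of u] by measurable

text \<open>\<open>exponent_step\<close> is telescoped along the grid. The cap must be inactive on
  the path, since \<open>\<xi> n k\<close> enters squared and its square has to be X. The subtracted
  error depends on the number of steps only through the final time, so it vanishes with e and the
  mesh.\<close>

lemma exponent_lower_bound:
  assumes w: "\<omega> \<in> space M" and c: "c > 0" and ij: "i \<le> j" "j \<le> 4 ^ n" and e: "e \<ge> 0"
    and eq: "\<forall>t\<ge>0. X t \<omega> = x + 2 * I t \<omega> + \<delta> * t"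
    and J: "\<And>k. k \<le> j \<Longrightarrow> \<bar>J n (grid n k) \<omega> - I (grid n k) \<omega>\<bar> \<le> e"
    and n: "\<And>k. k \<le> j \<Longrightarrow> sqrt (X (grid n k) \<omega>) \<le> real n"
    and u: "\<And>k. k < j \<Longrightarrow> \<bar>X (grid n (Suc k)) \<omega> / (c + grid n (Suc k)) - X (grid n k) \<omega> / (c + grid n k)\<bar> \<le> e"
  shows "Y c (grid n j) \<omega> - Y c (grid n i) \<omega> - (3 * e + \<delta> / 2 * mesh n + e * grid n j / 2) / c
    \<le> (\<Sum>k\<in>{i..<j}. \<xi> n k \<omega> / (c + grid n k) * dB n k \<omega> - (\<xi> n k \<omega> / (c + grid n k))\<^sup>2 * mesh n / 2)"
proof -
  define V where "V k = (J n (grid n k) \<omega> - I (grid n k) \<omega>) / (c + grid n k) + Y c (grid n k) \<omega>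
    + (\<delta> / 2 * mesh n + e) / (c + grid n k) - e * grid n k / (2 * c)" for k
  have "V j - V i = (\<Sum>k\<in>{i..<j}. V (Suc k) - V k)"
    using ij by (simp add: sum_Suc_diff')
  also have "\<dots> \<le> (\<Sum>k\<in>{i..<j}. \<xi> n k \<omega> / (c + grid n k) * dB n k \<omega> - (\<xi> n k \<omega> / (c + grid n k))\<^sup>2 * mesh n / 2)"
  proof (rule sum_mono)
    fix k assume k: "k \<in> {i..<j}"
    have g: "grid n (Suc k) = grid n k + mesh n" by (simp add: algebra_simps)
    have z: "\<xi> n k \<omega> * dB n k \<omega> = J n (grid n (Suc k)) \<omega> - J n (grid n k) \<omega>"
      using k ij by (simp add: J_grid del: of_nat_Suc)
    have sq: "(\<xi> n k \<omega>)\<^sup>2 = X (grid n k) \<omega>"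
      using n[of k] k X_nonneg[OF w grid_nonneg[of k n]] by (simp add: \<xi>_def min_absorb2)
    have "V (Suc k) - V k \<le> \<xi> n k \<omega> * dB n k \<omega> / (c + grid n k) - X (grid n k) \<omega> / (c + grid n k)\<^sup>2 * mesh n / 2"
      unfolding V_def Y_def
      using exponent_step[OF c grid_nonneg[of k n] mesh_pos[of n] _ e z, of \<delta>
          "I (grid n (Suc k)) \<omega>" "X (grid n k) \<omega>" x "I (grid n k) \<omega>" "X (grid n (Suc k)) \<omega>"]
        \<delta>_ge eq k J[of "Suc k"] u[of k] grid_nonneg[of k n] grid_nonneg[of "Suc k" n]
      unfolding g[symmetric] by (simp add: add_diff_eq del: of_nat_Suc)
    also have "\<dots> = \<xi> n k \<omega> / (c + grid n k) * dB n k \<omega> - (\<xi> n k \<omega> / (c + grid n k))\<^sup>2 * mesh n / 2"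
      by (simp add: power_divide sq)
    finally show "V (Suc k) - V k \<le> \<dots>" .
  qed
  finally have 1: "V j - V i \<le> (\<Sum>k\<in>{i..<j}. \<xi> n k \<omega> / (c + grid n k) * dB n k \<omega> - (\<xi> n k \<omega> / (c + grid n k))\<^sup>2 * mesh n / 2)" .
  have q: "\<bar>(J n (grid n k) \<omega> - I (grid n k) \<omega>) / (c + grid n k)\<bar> \<le> e / c" if "k \<le> j" for k
    using J[OF that] c e grid_nonneg[of k n] by (auto simp: abs_divide intro!: frac_le)
  have "(\<delta> / 2 * mesh n + e) / (c + grid n i) \<le> (\<delta> / 2 * mesh n + e) / c"
    using c e \<delta>_ge mesh_pos[of n] grid_nonneg[of i n]
    by (intro divide_left_mono mult_pos_pos add_pos_nonneg) auto
  moreover have "(\<delta> / 2 * mesh n + e) / (c + grid n j) \<ge> 0"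
    using c e \<delta>_ge mesh_pos[of n] grid_nonneg[of j n] by (intro divide_nonneg_nonneg) auto
  moreover have "e * grid n i / (2 * c) \<ge> 0" using c e grid_nonneg[of i n] by (intro divide_nonneg_nonneg) auto
  \<comment> \<open>Of the three multiples of \<open>e / c\<close>, two bound the distance of
    \<open>J\<close> from \<open>I\<close> at both ends and one comes from the correction in
    \<open>V i\<close>. The same correction in \<open>V j\<close> is nonnegative and is
    dropped.\<close>
  ultimately have "V j - V i \<ge> Y c (grid n j) \<omega> - Y c (grid n i) \<omega> - 2 * (e / c) - (\<delta> / 2 * mesh n + e) / c - e * grid n j / (2 * c)"
    unfolding V_def using abs_le_D2[OF q[of j]] abs_le_D1[OF q[of i]] ij by linarith
  moreover have "2 * (e / c) + (\<delta> / 2 * mesh n + e) / c + e * grid n j / (2 * c) = (3 * e + \<delta> / 2 * mesh n + e * grid n j / 2) / c"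
    using c by (simp add: field_simps)
  ultimately show ?thesis using 1 by linarith
qed

lemma J_zero: "J n 0 \<omega> = 0"
  using J_grid[of 0 n \<omega>] by simp

text \<open>The value of \<open>I\<close> at time 0 is fixed only as a limit of elementary
  integrals, and these all vanish there.\<close>

lemma X_zero: "AE \<omega> in M. X 0 \<omega> = x"
proof -
  obtain r where r: "strict_mono r"
    "AE \<omega> in M. \<forall>e>0. \<forall>\<^sub>F n in sequentially. \<forall>t\<in>{0..0}. \<bar>J (r n) t \<omega> - I t \<omega>\<bar> \<le> e"
    using J_subseq_uniform[of 0] by blast
  show ?thesis using X_eq r(2)
  proof eventually_elim
    case (elim \<omega>)
    have "\<bar>I 0 \<omega>\<bar> \<le> e" if "e > 0" for e
      using elim(2) that by (auto simp: J_zero eventually_sequentially)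
    then have "\<bar>I 0 \<omega>\<bar> \<le> 0" by (rule field_le_epsilon[of _ 0, simplified])
    with elim(1) show ?case by simp
  qed
qed

text \<open>Grid points of level N persist on all finer grids, so both end points stay fixed while
  the errors of \<open>exponent_lower_bound\<close> tend to 0 along the path.\<close>

lemma exponent_liminf:
  assumes c: "c > 0" and ij: "i \<le> j" and r: "strict_mono r"
    and J: "\<forall>e>0. \<forall>\<^sub>F n in sequentially. \<forall>t\<in>{0..grid N j}. \<bar>J (r n) t \<omega> - I t \<omega>\<bar> \<le> e"
    and eq: "\<forall>t\<ge>0. X t \<omega> = x + 2 * I t \<omega> + \<delta> * t"
    and w: "\<omega> \<in> space M" and e: "e > 0"
  shows "\<forall>\<^sub>F n in sequentially. Y c (grid N j) \<omega> - Y c (grid N i) \<omega> - e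
    \<le> (\<Sum>k\<in>{i * 2 ^ (r n - N)..<j * 2 ^ (r n - N)}. \<xi> (r n) k \<omega> / (c + grid (r n) k) * dB (r n) k \<omega>
      - (\<xi> (r n) k \<omega> / (c + grid (r n) k))\<^sup>2 * mesh (r n) / 2)"
proof -
  define T where "T = grid N j"
  have T: "T \<ge> 0" unfolding T_def by (rule grid_nonneg)
  \<comment> \<open>Half of the budget \<open>e * c\<close> goes to \<open>d * (3 + T / 2)\<close>,
    the other half to \<open>\<delta> / 2 * mesh (r n)\<close>; this is why the mesh is taken below
    \<open>e * c / \<delta>\<close>.\<close>
  define d where "d = e * c / 2 / (3 + T / 2)"
  have d: "d > 0" using e c T by (simp add: d_def)
  define f where "f s = sqrt (X s \<omega>)" for s
  define g where "g s = X s \<omega> / (c + s)" for s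
  have f: "continuous_on {0..T} f" and g: "continuous_on {0..T} g"
    unfolding f_def g_def using c by (intro continuous_intros continuous_on_subset[OF X_cont[OF w]]; force)+
  obtain K where "\<forall>y\<in>f ` {0..T}. norm y \<le> K"
    using compact_imp_bounded[OF compact_continuous_image[OF f]] unfolding bounded_iff by auto
  then have K: "f s \<le> K" if "s \<in> {0..T}" for s using that abs_le_D1[of "f s" K] by auto
  obtain q where q: "q > 0" "\<And>s t. s \<in> {0..T} \<Longrightarrow> t \<in> {0..T} \<Longrightarrow> \<bar>s - t\<bar> < q \<Longrightarrow> \<bar>g s - g t\<bar> < d"
    by (rule uniformly_continuous_onE[OF compact_uniformly_continuous[OF g compact_Icc] d])
       (auto simp: dist_real_def)
  have lim: "(\<lambda>n. mesh (r n)) \<longlonglongrightarrow> 0"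
    using LIMSEQ_subseq_LIMSEQ[OF mesh_tendsto_0 r] by (simp add: comp_def)
  have "min q (e * c / \<delta>) > 0" using q e c \<delta>_ge by auto
  then have "\<forall>\<^sub>F n in sequentially. mesh (r n) < min q (e * c / \<delta>)"
    using order_tendstoD(2)[OF lim] by blast
  moreover have "\<forall>\<^sub>F n in sequentially. n \<ge> max (nat \<lceil>K\<rceil>) (N + j)" by (rule eventually_ge_at_top)
  moreover have "\<forall>\<^sub>F n in sequentially. \<forall>t\<in>{0..T}. \<bar>J (r n) t \<omega> - I t \<omega>\<bar> \<le> d"
    using J d unfolding T_def by blast
  ultimately show ?thesis
  proof eventually_elim
    case (elim n)
    have rn: "r n \<ge> n" by (rule seq_suble[OF r])
    have nK: "K \<le> real (r n)" "N + j \<le> r n" using elim(2) rn by linarith+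
    let ?p = "2 ^ (r n - N) :: nat"
    have j4: "j * ?p \<le> 4 ^ r n" by (rule refined_index_bound[OF nK(2)])
    have ref: "grid (r n) (l * ?p) = grid N l" for l using grid_refine[of N "r n" l] nK by simp
    have gT: "grid (r n) k \<in> {0..T}" if "k \<le> j * ?p" for k
      using grid_le[OF that, of "r n"] grid_nonneg[of k "r n"] unfolding T_def ref[of j, symmetric] by auto
    have "Y c (grid (r n) (j * ?p)) \<omega> - Y c (grid (r n) (i * ?p)) \<omega>
        - (3 * d + \<delta> / 2 * mesh (r n) + d * grid (r n) (j * ?p) / 2) / c
      \<le> (\<Sum>k\<in>{i * ?p..<j * ?p}. \<xi> (r n) k \<omega> / (c + grid (r n) k) * dB (r n) k \<omega>
        - (\<xi> (r n) k \<omega> / (c + grid (r n) k))\<^sup>2 * mesh (r n) / 2)"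
    proof (rule exponent_lower_bound[OF w c _ j4 _ eq])
      show "\<bar>J (r n) (grid (r n) k) \<omega> - I (grid (r n) k) \<omega>\<bar> \<le> d" if "k \<le> j * ?p" for k
        using elim(3) gT[OF that] by blast
      show "sqrt (X (grid (r n) k) \<omega>) \<le> real (r n)" if "k \<le> j * ?p" for k
        using K[OF gT[OF that]] nK(1) unfolding f_def by linarith
      show "\<bar>X (grid (r n) (Suc k)) \<omega> / (c + grid (r n) (Suc k)) - X (grid (r n) k) \<omega> / (c + grid (r n) k)\<bar> \<le> d"
        if "k < j * ?p" for k
      proof -
        have "\<bar>grid (r n) (Suc k) - grid (r n) k\<bar> < q"
          using elim(1) mesh_pos[of "r n"] by (simp add: algebra_simps)
        from q(2)[OF gT gT this] that show ?thesis unfolding g_def by simp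
      qed
    qed (use d ij in auto)
    moreover have "(3 * d + \<delta> / 2 * mesh (r n) + d * grid (r n) (j * ?p) / 2) / c \<le> e"
    proof -
      have "d * (3 + T / 2) = e * c / 2"
        using T nonzero_eq_divide_eq[of "3 + T / 2" d "e * c / 2"] by (simp add: d_def)
      moreover have "\<delta> * mesh (r n) \<le> e * c" using elim(1) \<delta>_ge by (simp add: field_simps)
      ultimately have "3 * d + \<delta> / 2 * mesh (r n) + d * T / 2 \<le> e * c" by (simp add: algebra_simps)
      then show ?thesis using c unfolding ref T_def by (simp add: divide_le_eq)
    qed
    ultimately show ?case unfolding ref by linarith
  qed
qed

text \<open>The discretised exponentials are exact martingales, and the lower limit of their
  exponents is at least the increment of \<open>Y\<close>. Fatou's lemma then turns the equality
  into an inequality. Integrating over an arbitrary event A of the earlier time plays the role of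
  conditioning.\<close>

lemma exp_supermartingale:
  assumes c: "c > 0" and ij: "i \<le> j" and A: "A \<in> sets (F (grid N i))"
  shows "(\<integral>\<^sup>+\<omega>. indicator A \<omega> * ennreal (exp (Y c (grid N j) \<omega>)) \<partial>M)
    \<le> (\<integral>\<^sup>+\<omega>. indicator A \<omega> * ennreal (exp (Y c (grid N i) \<omega>)) \<partial>M)" (is "_ \<le> ?R")
proof -
  obtain r where r: "strict_mono r"
    "AE \<omega> in M. \<forall>e>0. \<forall>\<^sub>F n in sequentially. \<forall>t\<in>{0..grid N j}. \<bar>J (r n) t \<omega> - I t \<omega>\<bar> \<le> e"
    using J_subseq_uniform[OF grid_nonneg] by blast
  define L where "L n \<omega> = (\<Sum>k\<in>{i * 2 ^ (r n - N)..<j * 2 ^ (r n - N)}. \<xi> (r n) k \<omega> / (c + grid (r n) k) * dB (r n) k \<omega>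
      - (\<xi> (r n) k \<omega> / (c + grid (r n) k))\<^sup>2 * mesh (r n) / 2)" for n \<omega>
  define W where "W \<omega> = indicator A \<omega> * ennreal (exp (Y c (grid N i) \<omega>))" for \<omega>
  have Wm: "W \<in> borel_measurable (F (grid N i))"
    unfolding W_def using A Y_adapted[OF grid_nonneg, of c i N] by measurable
  have [measurable]: "dB n k \<in> borel_measurable M" "\<xi> n k \<in> borel_measurable M" for n k
    unfolding dB_def using measurable_F_M[OF \<xi>_adapted] B_measurable[OF grid_nonneg] by (auto simp del: of_nat_Suc)
  have [measurable]: "W \<in> borel_measurable M" using measurable_F_M[OF Wm] .
  have Lm: "(\<lambda>\<omega>. W \<omega> * ennreal (exp (L n \<omega>))) \<in> borel_measurable M" for n
    unfolding L_def by measurable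
  have int: "(\<integral>\<^sup>+\<omega>. W \<omega> * ennreal (exp (L n \<omega>)) \<partial>M) = ?R" if n: "n \<ge> N" for n
  proof -
    have N: "N \<le> r n" using n seq_suble[OF r(1), of n] by simp
    have "(\<lambda>\<omega>. \<xi> (r n) k \<omega> / (c + grid (r n) k)) \<in> borel_measurable (F (grid (r n) k))" for k
      using \<xi>_adapted[of "r n" k] by measurable
    moreover have "W \<in> borel_measurable (F (real (i * 2 ^ (r n - N)) * mesh (r n)))"
      using Wm by (simp only: grid_refine[OF N])
    ultimately show ?thesis unfolding L_def dB_def
      using exponential_sum[OF mesh_pos[of "r n"], of "\<lambda>k \<omega>. \<xi> (r n) k \<omega> / (c + grid (r n) k)"
        W "i * 2 ^ (r n - N)" "j * 2 ^ (r n - N)"] ij by (simp add: W_def)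
  qed
  have AE: "AE \<omega> in M. indicator A \<omega> * ennreal (exp (Y c (grid N j) \<omega>)) \<le> liminf (\<lambda>n. W \<omega> * ennreal (exp (L n \<omega>)))"
    using r(2) X_eq AE_space
  proof eventually_elim
    case (elim \<omega>)
    show ?case
    proof (cases "\<omega> \<in> A")
      case True
      have "ennreal (exp (Y c (grid N j) \<omega>)) \<le> liminf (\<lambda>n. W \<omega> * ennreal (exp (L n \<omega>)))"
      proof (rule exp_le_iff_eps)
        fix e :: real assume e: "e > 0"
        show "ennreal (exp (Y c (grid N j) \<omega> - e)) \<le> liminf (\<lambda>n. W \<omega> * ennreal (exp (L n \<omega>)))"
        proof (rule Liminf_bounded)
          show "\<forall>\<^sub>F n in sequentially. ennreal (exp (Y c (grid N j) \<omega> - e)) \<le> W \<omega> * ennreal (exp (L n \<omega>))"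
            using exponent_liminf[OF c ij r(1) elim e, folded L_def]
          proof eventually_elim
            case (elim n)
            then have "exp (Y c (grid N j) \<omega> - e) \<le> exp (Y c (grid N i) \<omega> + L n \<omega>)" by simp
            then show ?case using True by (simp add: W_def exp_add ennreal_mult'[symmetric])
          qed
        qed
      qed
      then show ?thesis using True by simp
    qed simp
  qed
  have "(\<integral>\<^sup>+\<omega>. indicator A \<omega> * ennreal (exp (Y c (grid N j) \<omega>)) \<partial>M)
    \<le> (\<integral>\<^sup>+\<omega>. liminf (\<lambda>n. W \<omega> * ennreal (exp (L n \<omega>))) \<partial>M)"
    by (rule nn_integral_mono_AE[OF AE])
  also have "\<dots> \<le> liminf (\<lambda>n. \<integral>\<^sup>+\<omega>. W \<omega> * ennreal (exp (L n \<omega>)) \<partial>M)"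
    by (rule nn_integral_liminf[OF Lm])
  also have "\<dots> = liminf (\<lambda>n. ?R)"
    by (intro Liminf_eq eventually_sequentiallyI[of N] int)
  also have "\<dots> = ?R" by (simp add: Liminf_const)
  finally show ?thesis .
qed

end

section \<open>Maximal inequality and moments\<close>

lemma grid_floor:
  assumes t: "t \<ge> 0"
  shows "(\<lambda>N. grid N (nat \<lfloor>t * 2 ^ N\<rfloor>)) \<longlonglongrightarrow> t"
proof -
  have m: "mesh N = 1 / 2 ^ N" for N by (simp add: mesh_def power_one_over)
  have "norm (grid N (nat \<lfloor>t * 2 ^ N\<rfloor>) - t) \<le> mesh N" for N
  proof -
    have "real (nat \<lfloor>t * 2 ^ N\<rfloor>) = of_int \<lfloor>t * 2 ^ N\<rfloor>" using t by simp
    then have "\<bar>real (nat \<lfloor>t * 2 ^ N\<rfloor>) - t * 2 ^ N\<bar> \<le> 1" by linarith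
    then have "\<bar>real (nat \<lfloor>t * 2 ^ N\<rfloor>) - t * 2 ^ N\<bar> * mesh N \<le> 1 * mesh N"
      using mesh_pos[of N] by (intro mult_right_mono) auto
    moreover have "(real (nat \<lfloor>t * 2 ^ N\<rfloor>) - t * 2 ^ N) * mesh N = grid N (nat \<lfloor>t * 2 ^ N\<rfloor>) - t"
      using mesh_mult[of N] by (simp add: left_diff_distrib mult.assoc)
    ultimately show ?thesis using mesh_pos[of N] by (metis abs_mult abs_of_pos mult_1 real_norm_def)
  qed
  then have "(\<lambda>N. grid N (nat \<lfloor>t * 2 ^ N\<rfloor>) - t) \<longlonglongrightarrow> 0"
    by (intro Lim_null_comparison[OF _ mesh_tendsto_0]) auto
  then show ?thesis by (simp add: LIM_zero_iff)
qed

section \<open>One step of Doob's inequality, and mean square bounds under almost sure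
  limits\<close>

context prob_space begin

text \<open>G and G' are to be the events that the level has not been reached before and after a
  step. On the exit event \<open>G - G'\<close> the integrand is at least K and so pays for the
  probability of leaving.\<close>

lemma exit_bound:
  fixes f :: "'a \<Rightarrow> ennreal"
  assumes G: "G \<in> events" "G' \<in> events" "G' \<subseteq> G" and f[measurable]: "f \<in> borel_measurable M"
    and K: "\<And>\<omega>. \<omega> \<in> G - G' \<Longrightarrow> K \<le> f \<omega>"
  shows "K * emeasure M (G - G') + (\<integral>\<^sup>+\<omega>. indicator G' \<omega> * f \<omega> \<partial>M) \<le> (\<integral>\<^sup>+\<omega>. indicator G \<omega> * f \<omega> \<partial>M)"
proof -
  have [measurable]: "G \<in> events" "G' \<in> events" using G by auto
  have "K * emeasure M (G - G') + (\<integral>\<^sup>+\<omega>. indicator G' \<omega> * f \<omega> \<partial>M)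
    = (\<integral>\<^sup>+\<omega>. K * indicator (G - G') \<omega> + indicator G' \<omega> * f \<omega> \<partial>M)"
    by (subst nn_integral_add) (auto simp: nn_integral_cmult_indicator)
  also have "\<dots> \<le> (\<integral>\<^sup>+\<omega>. indicator G \<omega> * f \<omega> \<partial>M)"
    using K G(3) by (intro nn_integral_mono) (auto simp: indicator_def)
  finally show ?thesis .
qed

text \<open>Transfers second moment estimates from elementary integrals to \<open>I\<close>: almost
  sure convergence and a uniform bound suffice by Fatou's lemma.\<close>

lemma square_fatou:
  fixes f :: "nat \<Rightarrow> 'a \<Rightarrow> real" and g :: "'a \<Rightarrow> real"
  assumes lim: "AE \<omega> in M. (\<lambda>n. f n \<omega>) \<longlonglongrightarrow> g \<omega>" and g[measurable]: "g \<in> borel_measurable M"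
    and f[measurable]: "\<And>n. f n \<in> borel_measurable M"
    and b: "\<forall>\<^sub>F n in sequentially. integrable M (\<lambda>\<omega>. (f n \<omega>)\<^sup>2) \<and> expectation (\<lambda>\<omega>. (f n \<omega>)\<^sup>2) \<le> C"
  shows "integrable M (\<lambda>\<omega>. (g \<omega>)\<^sup>2)" and "expectation (\<lambda>\<omega>. (g \<omega>)\<^sup>2) \<le> C"
proof -
  obtain N where N: "integrable M (\<lambda>\<omega>. (f n \<omega>)\<^sup>2)" "expectation (\<lambda>\<omega>. (f n \<omega>)\<^sup>2) \<le> C" if "n \<ge> N" for n
    using b unfolding eventually_sequentially by blast
  have "0 \<le> expectation (\<lambda>\<omega>. (f N \<omega>)\<^sup>2)" by simp
  then have C: "0 \<le> C" using N(2)[of N] by linarith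
  have "(\<integral>\<^sup>+\<omega>. ennreal ((g \<omega>)\<^sup>2) \<partial>M) \<le> (\<integral>\<^sup>+\<omega>. liminf (\<lambda>n. ennreal ((f n \<omega>)\<^sup>2)) \<partial>M)"
  proof (rule nn_integral_mono_AE)
    show "AE \<omega> in M. ennreal ((g \<omega>)\<^sup>2) \<le> liminf (\<lambda>n. ennreal ((f n \<omega>)\<^sup>2))"
      using lim
    proof eventually_elim
      case (elim \<omega>)
      then have "(\<lambda>n. ennreal ((f n \<omega>)\<^sup>2)) \<longlonglongrightarrow> ennreal ((g \<omega>)\<^sup>2)"
        by (intro tendsto_ennrealI tendsto_power)
      from lim_imp_Liminf[OF sequentially_bot this] show ?case by simp
    qed
  qed
  also have "\<dots> \<le> liminf (\<lambda>n. \<integral>\<^sup>+\<omega>. ennreal ((f n \<omega>)\<^sup>2) \<partial>M)"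
    by (rule nn_integral_liminf) measurable
  also have "\<dots> \<le> liminf (\<lambda>n. ennreal C)"
  proof (rule Liminf_mono)
    show "\<forall>\<^sub>F n in sequentially. (\<integral>\<^sup>+\<omega>. ennreal ((f n \<omega>)\<^sup>2) \<partial>M) \<le> ennreal C"
    proof (rule eventually_sequentiallyI)
      fix n assume "N \<le> n"
      then show "(\<integral>\<^sup>+\<omega>. ennreal ((f n \<omega>)\<^sup>2) \<partial>M) \<le> ennreal C"
        using N[of n] by (subst nn_integral_eq_integral) (auto intro: ennreal_leI)
    qed
  qed
  also have "\<dots> = ennreal C" by (simp add: Liminf_const)
  finally have le: "(\<integral>\<^sup>+\<omega>. ennreal ((g \<omega>)\<^sup>2) \<partial>M) \<le> ennreal C" .
  show i: "integrable M (\<lambda>\<omega>. (g \<omega>)\<^sup>2)"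
    using le by (intro integrableI_nonneg) (auto simp: less_top[symmetric] top_unique intro: le_less_trans)
  show "expectation (\<lambda>\<omega>. (g \<omega>)\<^sup>2) \<le> C"
    using le C nn_integral_eq_integral[OF i] by simp
qed

end

context squared_bessel_process begin

lemma exp_Y_measurable: "0 \<le> u \<Longrightarrow> (\<lambda>\<omega>. ennreal (exp (Y c u \<omega>))) \<in> borel_measurable (F u)"
  using Y_adapted[of u c] by measurable

lemma nn_integral_exp_Y_zero: "(\<integral>\<^sup>+\<omega>. ennreal (exp (Y c 0 \<omega>)) \<partial>M) = ennreal (exp (x / (2 * c) - \<delta> / 2 * ln c))"
proof -
  have "(\<integral>\<^sup>+\<omega>. ennreal (exp (Y c 0 \<omega>)) \<partial>M) = (\<integral>\<^sup>+\<omega>. ennreal (exp (x / (2 * c) - \<delta> / 2 * ln c)) \<partial>M)"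
    by (rule nn_integral_cong_AE) (use X_zero in \<open>eventually_elim, simp add: Y_def\<close>)
  then show ?thesis by (simp add: emeasure_space_1)
qed

lemma nn_integral_exp_Y_grid:
  assumes c: "c > 0"
  shows "(\<integral>\<^sup>+\<omega>. ennreal (exp (Y c (grid N k) \<omega>)) \<partial>M) \<le> ennreal (exp (x / (2 * c) - \<delta> / 2 * ln c))"
proof -
  have "space M \<in> sets (F (grid N 0))" using space_F sets.top by metis
  from exp_supermartingale[OF c _ this, of k]
  have "(\<integral>\<^sup>+\<omega>. indicator (space M) \<omega> * ennreal (exp (Y c (grid N k) \<omega>)) \<partial>M)
    \<le> (\<integral>\<^sup>+\<omega>. indicator (space M) \<omega> * ennreal (exp (Y c 0 \<omega>)) \<partial>M)" by simp
  also have "(\<integral>\<^sup>+\<omega>. indicator (space M) \<omega> * ennreal (exp (Y c (grid N k) \<omega>)) \<partial>M) = (\<integral>\<^sup>+\<omega>. ennreal (exp (Y c (grid N k) \<omega>)) \<partial>M)"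
    by (intro nn_integral_cong) simp
  also have "(\<integral>\<^sup>+\<omega>. indicator (space M) \<omega> * ennreal (exp (Y c 0 \<omega>)) \<partial>M) = (\<integral>\<^sup>+\<omega>. ennreal (exp (Y c 0 \<omega>)) \<partial>M)"
    by (intro nn_integral_cong) simp
  finally show ?thesis by (simp only: nn_integral_exp_Y_zero)
qed

lemma maximal_grid:
  assumes c: "c > 0" and K: "K > 0"
  shows "prob {\<omega> \<in> space M. \<exists>k\<le>j. K \<le> exp (Y c (grid N k) \<omega>)} \<le> exp (x / (2 * c) - \<delta> / 2 * ln c) / K"
proof -
  define G where "G j = {\<omega> \<in> space M. \<forall>k\<le>j. exp (Y c (grid N k) \<omega>) < K}" for j
  let ?C = "ennreal (exp (x / (2 * c) - \<delta> / 2 * ln c))"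
  have GF: "G j \<in> sets (F (grid N j))" for j
  proof -
    have m: "Y c (grid N k) \<in> borel_measurable (F (grid N j))" if "k \<le> j" for k
      using measurable_F_mono[OF Y_adapted[OF grid_nonneg] grid_le[OF that]] .
    have "{\<omega> \<in> space (F (grid N j)). \<forall>k\<in>{..j}. exp (Y c (grid N k) \<omega>) < K} \<in> sets (F (grid N j))"
    proof (rule sets.sets_Collect_finite_All)
      fix k assume "k \<in> {..j}"
      then have [measurable]: "Y c (grid N k) \<in> borel_measurable (F (grid N j))" using m by auto
      show "{\<omega> \<in> space (F (grid N j)). exp (Y c (grid N k) \<omega>) < K} \<in> sets (F (grid N j))" by measurable
    qed simp
    moreover have "{\<omega> \<in> space (F (grid N j)). \<forall>k\<in>{..j}. exp (Y c (grid N k) \<omega>) < K} = G j"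
      unfolding G_def space_F by auto
    ultimately show ?thesis by simp
  qed
  have GM: "G j \<in> events" for j using GF sets_F_M by blast
  have fm: "(\<lambda>\<omega>. ennreal (exp (Y c (grid N k) \<omega>))) \<in> borel_measurable M" for k
    using measurable_F_M[OF exp_Y_measurable[OF grid_nonneg]] .
  \<comment> \<open>The invariant keeps the mean over the paths that have not reached K. What leaves
    \<open>G j\<close> in one step is charged by \<open>exit_bound\<close>, and what stays does not
    gain by the supermartingale property.\<close>
  have "ennreal K * emeasure M (space M - G j) + (\<integral>\<^sup>+\<omega>. indicator (G j) \<omega> * ennreal (exp (Y c (grid N j) \<omega>)) \<partial>M) \<le> ?C"
  proof (induction j)
    case 0
    have "ennreal K * emeasure M (space M - G 0) + (\<integral>\<^sup>+\<omega>. indicator (G 0) \<omega> * ennreal (exp (Y c (grid N 0) \<omega>)) \<partial>M)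
      \<le> (\<integral>\<^sup>+\<omega>. indicator (space M) \<omega> * ennreal (exp (Y c (grid N 0) \<omega>)) \<partial>M)"
      by (rule exit_bound[OF _ GM _ fm]) (auto simp: G_def not_less intro: ennreal_leI)
    also have "\<dots> = (\<integral>\<^sup>+\<omega>. ennreal (exp (Y c 0 \<omega>)) \<partial>M)"
      by (intro nn_integral_cong) simp
    finally show ?case by (simp only: nn_integral_exp_Y_zero)
  next
    case (Suc j)
    have sub: "G (Suc j) \<subseteq> G j" by (auto simp: G_def)
    have "space M - G (Suc j) = (space M - G j) \<union> (G j - G (Suc j))"
      using sub by (auto simp: G_def)
    then have e: "emeasure M (space M - G (Suc j)) = emeasure M (space M - G j) + emeasure M (G j - G (Suc j))"
      using GM by (simp add: plus_emeasure Diff_Int_distrib2 disjoint_iff)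
    have "ennreal K * emeasure M (G j - G (Suc j)) + (\<integral>\<^sup>+\<omega>. indicator (G (Suc j)) \<omega> * ennreal (exp (Y c (grid N (Suc j)) \<omega>)) \<partial>M)
      \<le> (\<integral>\<^sup>+\<omega>. indicator (G j) \<omega> * ennreal (exp (Y c (grid N (Suc j)) \<omega>)) \<partial>M)"
      by (rule exit_bound[OF GM GM sub fm])
         (auto simp: G_def not_less le_Suc_eq intro!: ennreal_leI simp del: of_nat_Suc)
    also have "\<dots> \<le> (\<integral>\<^sup>+\<omega>. indicator (G j) \<omega> * ennreal (exp (Y c (grid N j) \<omega>)) \<partial>M)"
      by (rule exp_supermartingale[OF c _ GF]) simp
    finally have "ennreal K * emeasure M (space M - G (Suc j)) + (\<integral>\<^sup>+\<omega>. indicator (G (Suc j)) \<omega> * ennreal (exp (Y c (grid N (Suc j)) \<omega>)) \<partial>M)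
      \<le> ennreal K * emeasure M (space M - G j) + (\<integral>\<^sup>+\<omega>. indicator (G j) \<omega> * ennreal (exp (Y c (grid N j) \<omega>)) \<partial>M)"
      unfolding e distrib_left add.assoc by (rule add_left_mono)
    with Suc show ?case by (rule order_trans[rotated])
  qed
  then have "ennreal K * emeasure M (space M - G j) \<le> ?C"
    by (rule order_trans[rotated]) simp
  then have "ennreal (K * prob (space M - G j)) \<le> ?C"
    using K by (simp add: emeasure_eq_measure ennreal_mult')
  then have "K * prob (space M - G j) \<le> exp (x / (2 * c) - \<delta> / 2 * ln c)"
    by (simp add: ennreal_le_iff)
  moreover have "space M - G j = {\<omega> \<in> space M. \<exists>k\<le>j. K \<le> exp (Y c (grid N k) \<omega>)}"
    by (auto simp: G_def not_less)
  ultimately show ?thesis using K by (simp add: field_simps)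
qed

text \<open>U is the union of the exceedance events on the grids, so the continuum of times enters
  only through path continuity. The strict inequality at time t leaves room for moving to a nearby
  grid point.\<close>

lemma maximal_inequality:
  assumes c: "c > 0" and K: "K > 0"
  obtains U where "U \<in> events" "prob U \<le> exp (x / (2 * c) - \<delta> / 2 * ln c) / K"
    "\<And>\<omega> t. \<omega> \<in> space M \<Longrightarrow> t \<ge> 0 \<Longrightarrow> K < exp (Y c t \<omega>) \<Longrightarrow> \<omega> \<in> U"
proof
  define A where "A N = {\<omega> \<in> space M. \<exists>k\<le>4 ^ N. K \<le> exp (Y c (grid N k) \<omega>)}" for N :: nat
  let ?U = "\<Union>N. A N"
  have A: "A N \<in> events" for N
  proof -
    have "{\<omega> \<in> space M. \<exists>k\<in>{..4^N}. K \<le> exp (Y c (grid N k) \<omega>)} \<in> events"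
    proof (rule sets.sets_Collect_finite_Ex)
      fix k
      have [measurable]: "Y c (grid N k) \<in> borel_measurable M" using measurable_F_M[OF Y_adapted[OF grid_nonneg]] .
      show "{\<omega> \<in> space M. K \<le> exp (Y c (grid N k) \<omega>)} \<in> events" by measurable
    qed simp
    moreover have "{\<omega> \<in> space M. \<exists>k\<in>{..4^N}. K \<le> exp (Y c (grid N k) \<omega>)} = A N"
      unfolding A_def by blast
    ultimately show ?thesis by (simp only:)
  qed
  then show "?U \<in> events" by auto
  \<comment> \<open>Refinement doubles the index of a grid point while the range of indices
    quadruples, so the events increase and the uniform bound passes to their union.\<close>
  have "incseq A"
  proof (rule incseq_SucI)
    fix N
    show "A N \<subseteq> A (Suc N)"
    proof
      fix \<omega> assume "\<omega> \<in> A N"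
      then obtain k where k: "\<omega> \<in> space M" "k \<le> 4 ^ N" "K \<le> exp (Y c (grid N k) \<omega>)"
        unfolding A_def by blast
      have "grid (Suc N) (k * 2) = grid N k" using grid_refine[of N "Suc N" k] by simp
      then have "K \<le> exp (Y c (grid (Suc N) (k * 2)) \<omega>)" using k(3) by (simp only:)
      moreover have "k * 2 \<le> 4 ^ Suc N" using k(2) by simp
      ultimately show "\<omega> \<in> A (Suc N)" using k(1) unfolding A_def by blast
    qed
  qed
  then have lim: "(\<lambda>N. prob (A N)) \<longlonglongrightarrow> prob ?U"
    using A by (intro finite_Lim_measure_incseq) auto
  have "prob (A N) \<le> exp (x / (2 * c) - \<delta> / 2 * ln c) / K" for N
    unfolding A_def by (rule maximal_grid[OF c K])
  then show "prob ?U \<le> exp (x / (2 * c) - \<delta> / 2 * ln c) / K"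
    by (intro LIMSEQ_le_const2[OF lim] exI allI impI)
  fix \<omega> t assume w: "\<omega> \<in> space M" and t: "t \<ge> 0" and K': "K < exp (Y c t \<omega>)"
  have "continuous_on {0..} (\<lambda>s. exp (Y c s \<omega>))"
    unfolding Y_def using c by (intro continuous_intros X_cont[OF w]) auto
  from continuous_on_tendsto_compose[OF this grid_floor[OF t]] t
  have "(\<lambda>N. exp (Y c (grid N (nat \<lfloor>t * 2 ^ N\<rfloor>)) \<omega>)) \<longlonglongrightarrow> exp (Y c t \<omega>)"
    by (simp only: atLeast_iff grid_nonneg eventually_True)
  from order_tendstoD(1)[OF this K'] have "\<forall>\<^sub>F N in sequentially. K < exp (Y c (grid N (nat \<lfloor>t * 2 ^ N\<rfloor>)) \<omega>)" .
  moreover have "\<forall>\<^sub>F N in sequentially. N \<ge> nat \<lceil>t\<rceil>" by (rule eventually_ge_at_top)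
  ultimately have "\<forall>\<^sub>F N in sequentially. \<omega> \<in> A N"
  proof eventually_elim
    case (elim N)
    have "t \<le> real N" using elim(2) by linarith
    also have "\<dots> \<le> 2 ^ N" by (simp add: less_imp_le of_nat_less_two_power)
    finally have "t * 2 ^ N \<le> 2 ^ N * 2 ^ N" by (intro mult_right_mono) auto
    also have "\<dots> = (4::real) ^ N" by (simp add: power_mult_distrib[symmetric])
    finally have "\<lfloor>t * 2 ^ N\<rfloor> \<le> 4 ^ N" by (simp add: floor_le_iff)
    then have "nat \<lfloor>t * 2 ^ N\<rfloor> \<le> 4 ^ N" by (simp add: nat_le_iff)
    then show ?case using less_imp_le[OF elim(1)] w unfolding A_def by blast
  qed
  then show "\<omega> \<in> ?U" by (auto simp: eventually_sequentially)
qed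

text \<open>Up to a constant, the exponential supermartingale with c = 1 dominates
  \<open>X\<^sup>2\<close>, by \<open>z\<^sup>2 / 2 \<le> exp z\<close>. Its mean never exceeds the
  initial one, which makes the bound uniform over all grid points up to T.\<close>

lemma X_second_moment:
  obtains C where "C \<ge> 0" "\<And>N k. grid N k \<le> T \<Longrightarrow> integrable M (\<lambda>\<omega>. (X (grid N k) \<omega>)\<^sup>2)"
    "\<And>N k. grid N k \<le> T \<Longrightarrow> expectation (\<lambda>\<omega>. (X (grid N k) \<omega>)\<^sup>2) \<le> C"
proof -
  define b where "b = 8 * (1 + T)\<^sup>2 * exp (\<delta> / 2 * ln (1 + T))"
  define C where "C = b * exp (x / 2)"
  have b0: "b \<ge> 0" by (simp add: b_def)
  have *: "integrable M (\<lambda>\<omega>. (X u \<omega>)\<^sup>2) \<and> expectation (\<lambda>\<omega>. (X u \<omega>)\<^sup>2) \<le> C"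
    if u: "u = grid N k" "u \<le> T" for N k u
  proof -
    have u0: "u \<ge> 0" using grid_nonneg u by simp
    have [measurable]: "X u \<in> borel_measurable M" "Y 1 u \<in> borel_measurable M"
      using X_measurable[OF u0] measurable_F_M[OF Y_adapted[OF u0]] by auto
    have "(X u \<omega>)\<^sup>2 \<le> b * exp (Y 1 u \<omega>)" if w: "\<omega> \<in> space M" for \<omega>
    proof -
      let ?z = "X u \<omega> / (2 * (1 + u))"
      have z: "?z \<ge> 0" using X_nonneg[OF w u0] u0 by simp
      have "?z\<^sup>2 / 2 \<le> exp ?z" using exp_lower_Taylor_quadratic[OF z] z by linarith
      have "X u \<omega> = 2 * (1 + u) * ?z" using u0 by simp
      then have "(X u \<omega>)\<^sup>2 = (2 * (1 + u))\<^sup>2 * ?z\<^sup>2" by (metis power_mult_distrib)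
      also have "\<dots> = 8 * (1 + u)\<^sup>2 * (?z\<^sup>2 / 2)" unfolding power_mult_distrib by simp
      finally have "(X u \<omega>)\<^sup>2 = 8 * (1 + u)\<^sup>2 * (?z\<^sup>2 / 2)" .
      also have "\<dots> \<le> 8 * (1 + u)\<^sup>2 * exp ?z" using \<open>?z\<^sup>2 / 2 \<le> exp ?z\<close> by (intro mult_left_mono) auto
      also have "exp ?z = exp (\<delta> / 2 * ln (1 + u)) * exp (Y 1 u \<omega>)"
        by (simp add: Y_def exp_add[symmetric])
      also have "8 * (1 + u)\<^sup>2 * (exp (\<delta> / 2 * ln (1 + u)) * exp (Y 1 u \<omega>)) \<le> 8 * (1 + T)\<^sup>2 * (exp (\<delta> / 2 * ln (1 + T)) * exp (Y 1 u \<omega>))"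
        using u u0 \<delta>_ge by (intro mult_mono power_mono) auto
      finally show ?thesis by (simp add: b_def mult.assoc)
    qed
    then have "(\<integral>\<^sup>+\<omega>. ennreal ((X u \<omega>)\<^sup>2) \<partial>M) \<le> (\<integral>\<^sup>+\<omega>. ennreal b * ennreal (exp (Y 1 u \<omega>)) \<partial>M)"
      by (intro nn_integral_mono) (simp add: ennreal_mult'[symmetric, OF b0] ennreal_leI)
    also have "\<dots> = ennreal b * (\<integral>\<^sup>+\<omega>. ennreal (exp (Y 1 u \<omega>)) \<partial>M)"
      by (rule nn_integral_cmult) measurable
    also have "\<dots> \<le> ennreal b * ennreal (exp (x / 2))"
      using nn_integral_exp_Y_grid[of 1 k N] u by (intro mult_left_mono) auto
    also have "\<dots> = ennreal C" unfolding C_def by (rule ennreal_mult'[symmetric, OF b0])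
    finally have le: "(\<integral>\<^sup>+\<omega>. ennreal ((X u \<omega>)\<^sup>2) \<partial>M) \<le> ennreal C" .
    have i: "integrable M (\<lambda>\<omega>. (X u \<omega>)\<^sup>2)"
      using le by (intro integrableI_nonneg) (auto simp: less_top[symmetric] top_unique)
    then show ?thesis using le b0 nn_integral_eq_integral[OF i] by (simp add: C_def)
  qed
  show thesis by (rule that[of C]) (use * b0 in \<open>auto simp: C_def\<close>)
qed

end

section \<open>Mean square increments\<close>

text \<open>Truncation contracts distances, and
  \<open>\<bar>sqrt a - sqrt b\<bar> \<le> sqrt a + sqrt b\<close> replaces one factor of the square
  by the conjugate. In this way increments of the integrand are controlled by increments of
  X.\<close>

lemma power2_diff_sqrt_le:
  fixes a b m :: real
  assumes "a \<ge> 0" "b \<ge> 0"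
  shows "(min m (sqrt a) - min m (sqrt b))\<^sup>2 \<le> \<bar>a - b\<bar>"
proof -
  have "\<bar>min m (sqrt a) - min m (sqrt b)\<bar> \<le> \<bar>sqrt a - sqrt b\<bar>" by linarith
  then have "(min m (sqrt a) - min m (sqrt b))\<^sup>2 \<le> (sqrt a - sqrt b)\<^sup>2" by (simp add: abs_le_square_iff)
  also have "\<dots> = \<bar>sqrt a - sqrt b\<bar> * \<bar>sqrt a - sqrt b\<bar>" by (simp add: power2_eq_square)
  also have "\<dots> \<le> \<bar>sqrt a - sqrt b\<bar> * (sqrt a + sqrt b)"
    using assms by (intro mult_left_mono) (auto simp: abs_le_iff)
  also have "\<dots> = \<bar>(sqrt a - sqrt b) * (sqrt a + sqrt b)\<bar>" using assms by (simp add: abs_mult)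
  also have "(sqrt a - sqrt b) * (sqrt a + sqrt b) = a - b" using assms by (simp add: algebra_simps)
  finally show ?thesis .
qed

lemma abs_le_young:
  fixes z q :: real
  assumes "q > 0"
  shows "\<bar>z\<bar> \<le> (q + z\<^sup>2 / q) / 2"
proof -
  have "0 \<le> (q - \<bar>z\<bar>)\<^sup>2" by simp
  then have "2 * q * \<bar>z\<bar> \<le> q\<^sup>2 + z\<^sup>2" by (simp add: power2_diff)
  then show ?thesis using assms by (simp add: field_simps power2_eq_square)
qed

context prob_space begin

text \<open>Young's inequality with a free weight q; a weight of order sqrt D gives the order sqrt D
  of the Cauchy-Schwarz inequality.\<close>

lemma expectation_abs_le:
  fixes f :: "'a \<Rightarrow> real"
  assumes f: "f \<in> borel_measurable M" "integrable M (\<lambda>\<omega>. (f \<omega>)\<^sup>2)" and b: "expectation (\<lambda>\<omega>. (f \<omega>)\<^sup>2) \<le> D" and q: "q > 0"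
  shows "integrable M (\<lambda>\<omega>. \<bar>f \<omega>\<bar>)" "expectation (\<lambda>\<omega>. \<bar>f \<omega>\<bar>) \<le> (q + D / q) / 2"
proof -
  show i: "integrable M (\<lambda>\<omega>. \<bar>f \<omega>\<bar>)"
    using square_integrable_imp_integrable[OF f] by simp
  have "expectation (\<lambda>\<omega>. \<bar>f \<omega>\<bar>) \<le> expectation (\<lambda>\<omega>. (q + (f \<omega>)\<^sup>2 / q) / 2)"
  proof (rule integral_mono[OF i])
    show "integrable M (\<lambda>\<omega>. (q + (f \<omega>)\<^sup>2 / q) / 2)" using f(2) by simp
  qed (rule abs_le_young[OF q])
  also have "\<dots> = (q + expectation (\<lambda>\<omega>. (f \<omega>)\<^sup>2) / q) / 2"
    using f(2) by (simp add: prob_space)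
  also have "\<dots> \<le> (q + D / q) / 2" using b q by (simp add: divide_right_mono)
  finally show "expectation (\<lambda>\<omega>. \<bar>f \<omega>\<bar>) \<le> (q + D / q) / 2" .
qed

end

context squared_bessel_process begin

lemma grid_Suc_less: "grid n k < grid n (Suc k)"
  using mesh_pos[of n] by simp

lemma grid_Suc_diff: "grid n (Suc k) - grid n k = mesh n"
  by (simp add: algebra_simps)

lemma dB_measurable: "dB n k \<in> borel_measurable M"
  unfolding dB_def by (rule increment_measurable[OF grid_nonneg grid_Suc_less])

lemmas dB_moments =
  increment_power_integrable[OF grid_nonneg grid_Suc_less, folded dB_def]
  increment_integrable[OF grid_nonneg grid_Suc_less, folded dB_def]
  increment_mean[OF grid_nonneg grid_Suc_less, folded dB_def]
  increment_moment2[OF grid_nonneg grid_Suc_less, folded dB_def, unfolded grid_Suc_diff]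
  increment_moment4[OF grid_nonneg grid_Suc_less, folded dB_def, unfolded grid_Suc_diff]

lemma dB_sum_square:
  assumes a: "\<And>k. a k \<in> borel_measurable (F (grid n k))" "\<And>k \<omega>. \<omega> \<in> space M \<Longrightarrow> \<bar>a k \<omega>\<bar> \<le> C"
  shows "integrable M (\<lambda>\<omega>. (\<Sum>k<N. a k \<omega> * dB n k \<omega>)\<^sup>2)"
    "expectation (\<lambda>\<omega>. (\<Sum>k<N. a k \<omega> * dB n k \<omega>)\<^sup>2) = (\<Sum>k<N. expectation (\<lambda>\<omega>. (a k \<omega>)\<^sup>2) * mesh n)"
  using martingale_sum_square[OF mesh_pos[of n] a, of "\<lambda>y. y" N] dB_moments[of n]
  unfolding dB_def by simp_all

text \<open>The square of a Gaussian of variance \<open>mesh n\<close> has variance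
  \<open>2 * (mesh n)\<^sup>2\<close>. Over a bounded time the fluctuation of the quadratic
  variation of \<open>B\<close> is therefore of order \<open>mesh n\<close> in second
  moment.\<close>

lemma dB_sum_square_centered:
  assumes a: "\<And>k. a k \<in> borel_measurable (F (grid n k))" "\<And>k \<omega>. \<omega> \<in> space M \<Longrightarrow> \<bar>a k \<omega>\<bar> \<le> C"
  shows "integrable M (\<lambda>\<omega>. (\<Sum>k<N. a k \<omega> * ((dB n k \<omega>)\<^sup>2 - mesh n))\<^sup>2)"
    "expectation (\<lambda>\<omega>. (\<Sum>k<N. a k \<omega> * ((dB n k \<omega>)\<^sup>2 - mesh n))\<^sup>2) = (\<Sum>k<N. expectation (\<lambda>\<omega>. (a k \<omega>)\<^sup>2) * (2 * (mesh n)\<^sup>2))"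
proof -
  let ?\<phi> = "\<lambda>y. y\<^sup>2 - mesh n"
  have eq: "(?\<phi> y)\<^sup>2 = y ^ 4 - 2 * mesh n * y\<^sup>2 + (mesh n)\<^sup>2" for y
    by (simp add: power2_diff power_mult[symmetric] mult.commute)
  have m: "3 * (mesh n)\<^sup>2 - 2 * mesh n * mesh n + (mesh n)\<^sup>2 = 2 * (mesh n)\<^sup>2"
    by (simp add: power2_eq_square)
  have 1: "integrable M (\<lambda>\<omega>. ?\<phi> (dB n k \<omega>))" "integrable M (\<lambda>\<omega>. (?\<phi> (dB n k \<omega>))\<^sup>2)"
    "expectation (\<lambda>\<omega>. ?\<phi> (dB n k \<omega>)) = 0" "expectation (\<lambda>\<omega>. (?\<phi> (dB n k \<omega>))\<^sup>2) = 2 * (mesh n)\<^sup>2" for k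
    unfolding eq using dB_moments[of n k] m by (simp_all add: prob_space)
  have p: "?\<phi> \<in> borel_measurable borel" by measurable
  note 2 = martingale_sum_square[OF mesh_pos[of n] a, of ?\<phi> N, folded dB_def, OF _ p 1(1) 1(2) 1(3)]
  show "integrable M (\<lambda>\<omega>. (\<Sum>k<N. a k \<omega> * ((dB n k \<omega>)\<^sup>2 - mesh n))\<^sup>2)"
    "expectation (\<lambda>\<omega>. (\<Sum>k<N. a k \<omega> * ((dB n k \<omega>)\<^sup>2 - mesh n))\<^sup>2) = (\<Sum>k<N. expectation (\<lambda>\<omega>. (a k \<omega>)\<^sup>2) * (2 * (mesh n)\<^sup>2))"
    using 2 1(4) by simp_all
qed

lemma subseq_grid:
  assumes r: "strict_mono r" and T: "grid N j \<le> T"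
    and J: "\<forall>e>0. \<forall>\<^sub>F n in sequentially. \<forall>t\<in>{0..T}. \<bar>J (r n) t \<omega> - I t \<omega>\<bar> \<le> e"
  shows "(\<lambda>n. J (r n) (grid N j) \<omega>) \<longlonglongrightarrow> I (grid N j) \<omega>"
proof (rule tendstoI)
  fix e :: real assume "e > 0"
  then have "\<forall>\<^sub>F n in sequentially. \<forall>t\<in>{0..T}. \<bar>J (r n) t \<omega> - I t \<omega>\<bar> \<le> e / 2"
    by (intro J[THEN spec, THEN mp]) simp
  then show "\<forall>\<^sub>F n in sequentially. dist (J (r n) (grid N j) \<omega>) (I (grid N j) \<omega>) < e"
  proof eventually_elim
    case (elim n)
    then have "\<bar>J (r n) (grid N j) \<omega> - I (grid N j) \<omega>\<bar> \<le> e / 2" using T grid_nonneg[of j N] by auto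
    then show ?case using \<open>e > 0\<close> by (simp add: dist_real_def)
  qed
qed

text \<open>The isometry holds for the elementary integrals \<open>J m\<close> and passes to
  \<open>I\<close> as an inequality by Fatou's lemma. The mean of X is bounded through
  \<open>X \<le> 1 + X\<^sup>2\<close>, hence the constant \<open>1 + C\<close> with C the second
  moment bound.\<close>

lemma I_increment_bound:
  obtains C where "C \<ge> 0"
    "\<And>N i j. i \<le> j \<Longrightarrow> grid N j \<le> T \<Longrightarrow> integrable M (\<lambda>\<omega>. (I (grid N j) \<omega> - I (grid N i) \<omega>)\<^sup>2)"
    "\<And>N i j. i \<le> j \<Longrightarrow> grid N j \<le> T \<Longrightarrow> expectation (\<lambda>\<omega>. (I (grid N j) \<omega> - I (grid N i) \<omega>)\<^sup>2) \<le> C * (grid N j - grid N i)"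
proof -
  obtain C where C: "C \<ge> 0" "\<And>N k. grid N k \<le> T \<Longrightarrow> integrable M (\<lambda>\<omega>. (X (grid N k) \<omega>)\<^sup>2)"
    "\<And>N k. grid N k \<le> T \<Longrightarrow> expectation (\<lambda>\<omega>. (X (grid N k) \<omega>)\<^sup>2) \<le> C"
    using X_second_moment[of T] by blast
  have *: "integrable M (\<lambda>\<omega>. (I (grid N j) \<omega> - I (grid N i) \<omega>)\<^sup>2) \<and>
    expectation (\<lambda>\<omega>. (I (grid N j) \<omega> - I (grid N i) \<omega>)\<^sup>2) \<le> (1 + C) * (grid N j - grid N i)"
    if ij: "i \<le> j" and jT: "grid N j \<le> T" for N i j
  proof -
    have T: "T \<ge> 0" using jT grid_nonneg[of j N] by linarith
    obtain r where r: "strict_mono r"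
      "AE \<omega> in M. \<forall>e>0. \<forall>\<^sub>F n in sequentially. \<forall>t\<in>{0..T}. \<bar>J (r n) t \<omega> - I t \<omega>\<bar> \<le> e"
      using J_subseq_uniform[OF T] by blast
    have lim: "AE \<omega> in M. (\<lambda>n. J (r n) (grid N j) \<omega> - J (r n) (grid N i) \<omega>) \<longlonglongrightarrow> I (grid N j) \<omega> - I (grid N i) \<omega>"
      using r(2)
    proof eventually_elim
      case (elim \<omega>)
      have "grid N i \<le> T" using grid_le[OF ij, of N] jT by linarith
      then show ?case using jT by (intro tendsto_diff subseq_grid[OF r(1) _ elim])
    qed
    have b: "integrable M (\<lambda>\<omega>. (J m (grid N j) \<omega> - J m (grid N i) \<omega>)\<^sup>2) \<and>
      expectation (\<lambda>\<omega>. (J m (grid N j) \<omega> - J m (grid N i) \<omega>)\<^sup>2) \<le> (1 + C) * (grid N j - grid N i)"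
      if m: "N + j \<le> m" for m
    proof -
      let ?p = "2 ^ (m - N) :: nat"
      \<comment> \<open>Switching off the coefficients before the earlier time writes the increment
        as one sum from index 0, the form in which the isometry is stated.\<close>
      define a where "a k \<omega> = (if i * ?p \<le> k then \<xi> m k \<omega> else 0)" for k \<omega>
      have le: "i * ?p \<le> j * ?p" using ij by simp
      have ref: "grid m (l * ?p) = grid N l" for l using grid_refine[of N m l] m by simp
      have am: "a k \<in> borel_measurable (F (grid m k))" for k
        unfolding a_def using \<xi>_adapted[of m k] by (cases "i * ?p \<le> k") simp_all
      have ab: "\<bar>a k \<omega>\<bar> \<le> real m" if "\<omega> \<in> space M" for k \<omega>
        using \<xi>_bounds[OF that, of m k] by (auto simp: a_def)
      have eq: "J m (grid N j) \<omega> - J m (grid N i) \<omega> = (\<Sum>k<j * ?p. a k \<omega> * dB m k \<omega>)" for \<omega>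
      proof -
        have ip: "i * ?p \<le> 4 ^ m" using refined_index_bound[OF m] le by linarith
        have "J m (grid N j) \<omega> - J m (grid N i) \<omega> = (\<Sum>k<j * ?p. \<xi> m k \<omega> * dB m k \<omega>) - (\<Sum>k<i * ?p. \<xi> m k \<omega> * dB m k \<omega>)"
          unfolding ref[symmetric] using J_grid[OF refined_index_bound[OF m]] J_grid[OF ip] by simp
        also have "(\<Sum>k<i * ?p. \<xi> m k \<omega> * dB m k \<omega>) = (\<Sum>k<j * ?p. if k < i * ?p then \<xi> m k \<omega> * dB m k \<omega> else 0)"
        proof -
          have "{..<j * ?p} \<inter> {k. k < i * ?p} = {..<i * ?p}"
            using less_le_trans[OF _ le] by blast
          then show ?thesis
            using sum.inter_restrict[of "{..<j * ?p}" "\<lambda>k. \<xi> m k \<omega> * dB m k \<omega>" "{k. k < i * ?p}"] by simp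
        qed
        also have "(\<Sum>k<j * ?p. \<xi> m k \<omega> * dB m k \<omega>) - \<dots> = (\<Sum>k<j * ?p. a k \<omega> * dB m k \<omega>)"
          unfolding sum_subtractf[symmetric] by (intro sum.cong) (auto simp: a_def)
        finally show ?thesis .
      qed
      have X1: "expectation (\<lambda>\<omega>. (a k \<omega>)\<^sup>2) \<le> (if i * ?p \<le> k then 1 + C else 0)" if k: "k < j * ?p" for k
      proof (cases "i * ?p \<le> k")
        case True
        have kT: "grid m k \<le> T" using grid_le[of k "j * ?p" m] k ref[of j] jT by linarith
        have "integrable M (\<lambda>\<omega>. (a k \<omega>)\<^sup>2)"
        proof (rule integrable_const_bound[of _ "(real m)\<^sup>2"])
          show "AE \<omega> in M. norm ((a k \<omega>)\<^sup>2) \<le> (real m)\<^sup>2"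
          proof (rule AE_I2)
            fix \<omega> assume "\<omega> \<in> space M"
            then have "\<bar>a k \<omega>\<bar>\<^sup>2 \<le> (real m)\<^sup>2" by (intro power_mono ab) auto
            then show "norm ((a k \<omega>)\<^sup>2) \<le> (real m)\<^sup>2" by simp
          qed
        qed (use measurable_F_M[OF am[of k]] in measurable)
        then have "expectation (\<lambda>\<omega>. (a k \<omega>)\<^sup>2) \<le> expectation (\<lambda>\<omega>. 1 + (X (grid m k) \<omega>)\<^sup>2)"
        proof (rule integral_mono)
          show "integrable M (\<lambda>\<omega>. 1 + (X (grid m k) \<omega>)\<^sup>2)" using C(2)[OF kT] by simp
          fix \<omega> assume w: "\<omega> \<in> space M"
          have X0: "X (grid m k) \<omega> \<ge> 0" using X_nonneg[OF w grid_nonneg] .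
          have "(a k \<omega>)\<^sup>2 \<le> (sqrt (X (grid m k) \<omega>))\<^sup>2"
            using True \<xi>_bounds(1)[OF w, of m k] by (intro power_mono) (auto simp: a_def \<xi>_def)
          also have "\<dots> = X (grid m k) \<omega>" using X0 by simp
          also have "\<dots> \<le> 1 + (X (grid m k) \<omega>)\<^sup>2"
            using abs_le_young[of 1 "X (grid m k) \<omega>"] X0 by simp
          finally show "(a k \<omega>)\<^sup>2 \<le> 1 + (X (grid m k) \<omega>)\<^sup>2" .
        qed
        also have "\<dots> \<le> 1 + C" using C(2,3)[OF kT] by (simp add: prob_space)
        finally show ?thesis using True by simp
      qed (simp add: a_def)
      have "(\<Sum>k<j * ?p. expectation (\<lambda>\<omega>. (a k \<omega>)\<^sup>2) * mesh m) \<le> (\<Sum>k<j * ?p. (if i * ?p \<le> k then 1 + C else 0) * mesh m)"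
        using X1 mesh_pos[of m] by (intro sum_mono mult_right_mono) auto
      also have "\<dots> = (\<Sum>k\<in>{i * ?p..<j * ?p}. (1 + C) * mesh m)"
      proof -
        have "{..<j * ?p} \<inter> {k. i * ?p \<le> k} = {i * ?p..<j * ?p}" by auto
        then have "(\<Sum>k\<in>{i * ?p..<j * ?p}. (1 + C) * mesh m) = (\<Sum>k<j * ?p. if i * ?p \<le> k then (1 + C) * mesh m else 0)"
          using sum.inter_restrict[of "{..<j * ?p}" "\<lambda>k. (1 + C) * mesh m" "{k. i * ?p \<le> k}"] by simp
        also have "\<dots> = (\<Sum>k<j * ?p. (if i * ?p \<le> k then 1 + C else 0) * mesh m)"
          by (intro sum.cong) auto
        finally show ?thesis by simp
      qed
      also have "\<dots> = (1 + C) * ((real (j * ?p) - real (i * ?p)) * mesh m)"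
        using le by (simp add: of_nat_diff)
      also have "\<dots> = (1 + C) * (grid m (j * ?p) - grid m (i * ?p))" by (simp only: left_diff_distrib)
      finally show ?thesis unfolding eq using dB_sum_square[OF am ab, of "j * ?p"] unfolding ref by simp
    qed
    have m: "I (grid N l) \<in> borel_measurable M" "J n (grid N l) \<in> borel_measurable M" for n l
      using I_measurable[OF grid_nonneg] J_measurable[OF grid_nonneg] by auto
    have "\<forall>\<^sub>F n in sequentially. integrable M (\<lambda>\<omega>. (J (r n) (grid N j) \<omega> - J (r n) (grid N i) \<omega>)\<^sup>2) \<and>
      expectation (\<lambda>\<omega>. (J (r n) (grid N j) \<omega> - J (r n) (grid N i) \<omega>)\<^sup>2) \<le> (1 + C) * (grid N j - grid N i)"
      using seq_suble[OF r(1)] by (intro eventually_sequentiallyI[of "N + j"] b) (meson le_trans)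
    then show ?thesis
      using square_fatou[OF lim borel_measurable_diff[OF m(1) m(1)] borel_measurable_diff[OF m(2) m(2)]] by blast
  qed
  show thesis by (rule that[of "1 + C"]) (use * C(1) in auto)
qed

text \<open>The stochastic part has second moment of order \<open>mesh n\<close>, which the weight
  \<open>sqrt (mesh n)\<close> in \<open>expectation_abs_le\<close> turns into order
  \<open>sqrt (mesh n)\<close> in mean; the drift is smaller. The level m of the two points is
  separate from n because fine grid points will be compared with the start of a coarse cell.\<close>

lemma X_increment_bound:
  obtains C where "C \<ge> 0"
    "\<And>m k l n. k \<le> l \<Longrightarrow> grid m l \<le> T \<Longrightarrow> grid m l - grid m k \<le> mesh n \<Longrightarrow>
      integrable M (\<lambda>\<omega>. \<bar>X (grid m l) \<omega> - X (grid m k) \<omega>\<bar>)"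
    "\<And>m k l n. k \<le> l \<Longrightarrow> grid m l \<le> T \<Longrightarrow> grid m l - grid m k \<le> mesh n \<Longrightarrow>
      expectation (\<lambda>\<omega>. \<bar>X (grid m l) \<omega> - X (grid m k) \<omega>\<bar>) \<le> C * sqrt (mesh n)"
proof -
  obtain C where C: "C \<ge> 0"
    "\<And>N i j. i \<le> j \<Longrightarrow> grid N j \<le> T \<Longrightarrow> integrable M (\<lambda>\<omega>. (I (grid N j) \<omega> - I (grid N i) \<omega>)\<^sup>2)"
    "\<And>N i j. i \<le> j \<Longrightarrow> grid N j \<le> T \<Longrightarrow> expectation (\<lambda>\<omega>. (I (grid N j) \<omega> - I (grid N i) \<omega>)\<^sup>2) \<le> C * (grid N j - grid N i)"
    using I_increment_bound[of T] by blast
  have *: "integrable M (\<lambda>\<omega>. \<bar>X (grid m l) \<omega> - X (grid m k) \<omega>\<bar>) \<and>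
      expectation (\<lambda>\<omega>. \<bar>X (grid m l) \<omega> - X (grid m k) \<omega>\<bar>) \<le> (1 + C + \<delta>) * sqrt (mesh n)"
    if kl: "k \<le> l" and T: "grid m l \<le> T" and le: "grid m l - grid m k \<le> mesh n" for m k l n
  proof -
    let ?D = "\<lambda>\<omega>. I (grid m l) \<omega> - I (grid m k) \<omega>"
    have q: "sqrt (mesh n) > 0" using mesh_pos[of n] by simp
    have "C * (grid m l - grid m k) \<le> C * mesh n" using C(1) le by (intro mult_left_mono)
    then have "expectation (\<lambda>\<omega>. (?D \<omega>)\<^sup>2) \<le> C * mesh n" using C(3)[OF kl T] by linarith
    from expectation_abs_le[OF _ C(2)[OF kl T] this q]
    have D: "integrable M (\<lambda>\<omega>. \<bar>?D \<omega>\<bar>)" "expectation (\<lambda>\<omega>. \<bar>?D \<omega>\<bar>) \<le> (sqrt (mesh n) + C * mesh n / sqrt (mesh n)) / 2"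
      using borel_measurable_diff[OF I_measurable[OF grid_nonneg] I_measurable[OF grid_nonneg]] by auto
    have e: "C * mesh n / sqrt (mesh n) = C * sqrt (mesh n)"
      using real_div_sqrt[of "mesh n"] mesh_pos[of n] by (metis less_imp_le times_divide_eq_right)
    have AE: "AE \<omega> in M. \<bar>X (grid m l) \<omega> - X (grid m k) \<omega>\<bar> \<le> 2 * \<bar>?D \<omega>\<bar> + \<delta> * mesh n"
      using X_eq
    proof eventually_elim
      case (elim \<omega>)
      have "X (grid m l) \<omega> - X (grid m k) \<omega> = 2 * ?D \<omega> + \<delta> * (grid m l - grid m k)"
        using elim grid_nonneg[of l m] grid_nonneg[of k m] by (simp add: algebra_simps)
      moreover have "\<delta> * (grid m l - grid m k) \<le> \<delta> * mesh n" "0 \<le> \<delta> * (grid m l - grid m k)"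
        using \<delta>_ge le grid_le[OF kl, of m] by (auto intro!: mult_left_mono mult_nonneg_nonneg)
      moreover have "\<bar>y\<bar> \<le> 2 * \<bar>d\<bar> + e" if "y = 2 * d + u" "u \<le> e" "0 \<le> u" for y d u e :: real
        using that by linarith
      ultimately show ?case by blast
    qed
    have Xm: "(\<lambda>\<omega>. X (grid m l) \<omega> - X (grid m k) \<omega>) \<in> borel_measurable M"
      by (intro borel_measurable_diff X_measurable grid_nonneg)
    have i: "integrable M (\<lambda>\<omega>. 2 * \<bar>?D \<omega>\<bar> + \<delta> * mesh n)" using D(1) by simp
    have i2: "integrable M (\<lambda>\<omega>. \<bar>X (grid m l) \<omega> - X (grid m k) \<omega>\<bar>)"
    proof (rule Bochner_Integration.integrable_bound[OF i])
      show "AE \<omega> in M. norm \<bar>X (grid m l) \<omega> - X (grid m k) \<omega>\<bar> \<le> norm (2 * \<bar>?D \<omega>\<bar> + \<delta> * mesh n)"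
        using AE by eventually_elim auto
    qed (use Xm in measurable)
    have "expectation (\<lambda>\<omega>. \<bar>X (grid m l) \<omega> - X (grid m k) \<omega>\<bar>) \<le> expectation (\<lambda>\<omega>. 2 * \<bar>?D \<omega>\<bar> + \<delta> * mesh n)"
      by (rule integral_mono_AE[OF i2 i AE])
    also have "\<dots> = 2 * expectation (\<lambda>\<omega>. \<bar>?D \<omega>\<bar>) + \<delta> * mesh n" using D(1) by (simp add: prob_space)
    also have "\<dots> \<le> sqrt (mesh n) + C * sqrt (mesh n) + \<delta> * sqrt (mesh n)"
    proof -
      have "(mesh n)\<^sup>2 \<le> mesh n" using mesh_pos[of n] mesh_le_1[of n] by (simp add: power2_eq_square mult_left_le)
      then have "mesh n \<le> sqrt (mesh n)" by (rule real_le_rsqrt)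
      then have "\<delta> * mesh n \<le> \<delta> * sqrt (mesh n)" using \<delta>_ge by (intro mult_left_mono) auto
      moreover have "2 * expectation (\<lambda>\<omega>. \<bar>?D \<omega>\<bar>) \<le> sqrt (mesh n) + C * sqrt (mesh n)"
        using D(2)[unfolded e] by (simp only: pos_le_divide_eq zero_less_numeral mult.commute)
      ultimately show ?thesis by (rule add_mono[rotated])
    qed
    finally show ?thesis using i2 by (simp add: algebra_simps)
  qed
  show thesis by (rule that[of "1 + C + \<delta>"]) (use * C(1) \<delta>_ge in auto)
qed

end

section \<open>A second order expansion of the square root\<close>

text \<open>Two remainder bounds are combined: the cubic one where d0 dominates, the cruder
  quadratic one where b dominates. In the application d0 is the Brownian part and b contains the
  Euler remainder, which is controlled only in mean square, so that no third power of b may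
  appear.\<close>

lemma sqrt_taylor:
  fixes s s' e d0 b :: real
  assumes e: "e > 0" "e \<le> s" "e \<le> s'" and d: "s'\<^sup>2 - s\<^sup>2 = d0 + b"
  defines "d \<equiv> d0 + b"
  shows "s - s' \<le> - d / (2 * s) + d\<^sup>2 / (8 * s ^ 3) + (1 / (2 * e ^ 3) + 3 / (8 * e ^ 5)) * (8 * \<bar>d0\<bar> ^ 3 + 4 * b\<^sup>2)"
proof -
  define t where "t = s + s'"
  have pos: "s > 0" "s' > 0" "t > 0" using e by (auto simp: t_def)
  have te: "t \<ge> e" "t \<ge> s" using e by (auto simp: t_def)
  have dt: "d = (s' - s) * t" using d by (simp add: d_def t_def power2_eq_square algebra_simps)
  \<comment> \<open>An exact identity; the second order Taylor term differs from it only by having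
    \<open>2 * s\<close> in place of t.\<close>
  have id: "s - s' = - d / (2 * s) + d\<^sup>2 / (2 * s * t\<^sup>2)"
  proof -
    have "d\<^sup>2 = (s' - s)\<^sup>2 * t\<^sup>2" by (simp add: dt power_mult_distrib)
    then have "- d / (2 * s) + d\<^sup>2 / (2 * s * t\<^sup>2) = (- d + (s' - s)\<^sup>2) / (2 * s)"
      using pos by (simp add: diff_divide_distrib)
    also have "- d + (s' - s)\<^sup>2 = (s - s') * (2 * s)"
      unfolding dt t_def by (simp add: power2_eq_square algebra_simps)
    finally show ?thesis using pos by simp
  qed
  have bd2: "d\<^sup>2 / (2 * s * t\<^sup>2) \<le> 1 / (2 * e ^ 3) * d\<^sup>2"
  proof -
    have "e * e\<^sup>2 \<le> s * t\<^sup>2" using e te by (intro mult_mono power_mono) auto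
    then have "2 * e ^ 3 \<le> 2 * s * t\<^sup>2" by (simp add: power3_eq_cube power2_eq_square)
    then have "d\<^sup>2 / (2 * s * t\<^sup>2) \<le> d\<^sup>2 / (2 * e ^ 3)" using e pos by (intro divide_left_mono) auto
    then show ?thesis by simp
  qed
  have bd3: "d\<^sup>2 / (2 * s * t\<^sup>2) - d\<^sup>2 / (8 * s ^ 3) \<le> 3 / (8 * e ^ 5) * \<bar>d\<bar> ^ 3"
  proof -
    have "d\<^sup>2 / (2 * s * t\<^sup>2) - d\<^sup>2 / (8 * s ^ 3) = d\<^sup>2 * ((2 * s - t) * (2 * s + t)) / (8 * s ^ 3 * t\<^sup>2)"
    proof -
      have "d\<^sup>2 / (2 * s * t\<^sup>2) = (4 * s\<^sup>2) * d\<^sup>2 / ((4 * s\<^sup>2) * (2 * s * t\<^sup>2))"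
        using pos by (intro mult_divide_mult_cancel_left[symmetric]) simp
      also have "(4 * s\<^sup>2) * (2 * s * t\<^sup>2) = 8 * s ^ 3 * t\<^sup>2"
        by (simp add: power2_eq_square power3_eq_cube)
      finally have 1: "d\<^sup>2 / (2 * s * t\<^sup>2) = (4 * s\<^sup>2) * d\<^sup>2 / (8 * s ^ 3 * t\<^sup>2)" .
      have 2: "d\<^sup>2 / (8 * s ^ 3) = d\<^sup>2 * t\<^sup>2 / (8 * s ^ 3 * t\<^sup>2)"
        using pos by (intro mult_divide_mult_cancel_right[symmetric]) simp
      have 3: "(4 * s\<^sup>2) * d\<^sup>2 - d\<^sup>2 * t\<^sup>2 = d\<^sup>2 * ((2 * s - t) * (2 * s + t))"
        by (simp add: power2_eq_square algebra_simps)
      show ?thesis unfolding 1 2 using 3 by (simp only: diff_divide_distrib[symmetric])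
    qed
    also have "d\<^sup>2 * ((2 * s - t) * (2 * s + t)) \<le> d\<^sup>2 * (3 * \<bar>d\<bar>)"
    proof (intro mult_left_mono)
      have "2 * s - t = s - s'" by (simp add: t_def)
      then have "(2 * s - t) * (2 * s + t) \<le> \<bar>s' - s\<bar> * (2 * s + t)"
        using pos by (intro mult_right_mono) auto
      also have "\<dots> \<le> \<bar>s' - s\<bar> * (3 * t)"
        using te by (intro mult_left_mono) auto
      finally have "(2 * s - t) * (2 * s + t) \<le> \<bar>s' - s\<bar> * (3 * t)" .
      also have "\<bar>s' - s\<bar> * (3 * t) = 3 * \<bar>d\<bar>" using pos by (simp add: dt abs_mult)
      finally show "(2 * s - t) * (2 * s + t) \<le> 3 * \<bar>d\<bar>" .
    qed simp
    also have "d\<^sup>2 * (3 * \<bar>d\<bar>) = 3 * \<bar>d\<bar> ^ 3"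
    proof -
      have "\<bar>d\<bar> ^ 3 = \<bar>d\<bar> * \<bar>d\<bar>\<^sup>2" by (simp only: power3_eq_cube power2_eq_square mult.assoc)
      then show ?thesis by (simp only: power2_abs mult_ac)
    qed
    finally have "d\<^sup>2 / (2 * s * t\<^sup>2) - d\<^sup>2 / (8 * s ^ 3) \<le> 3 * \<bar>d\<bar> ^ 3 / (8 * s ^ 3 * t\<^sup>2)"
      using pos by (simp add: divide_right_mono)
    also have "\<dots> \<le> 3 * \<bar>d\<bar> ^ 3 / (8 * e ^ 5)"
    proof (rule divide_left_mono)
      have "e ^ 3 * e\<^sup>2 \<le> s ^ 3 * t\<^sup>2" using e te by (intro mult_mono power_mono) auto
      then show "8 * e ^ 5 \<le> 8 * s ^ 3 * t\<^sup>2" by (simp add: power_add[symmetric])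
    qed (use e pos in auto)
    finally show ?thesis by simp
  qed
  have "d\<^sup>2 / (2 * s * t\<^sup>2) - d\<^sup>2 / (8 * s ^ 3) \<le> (1 / (2 * e ^ 3) + 3 / (8 * e ^ 5)) * (8 * \<bar>d0\<bar> ^ 3 + 4 * b\<^sup>2)"
  proof (cases "\<bar>b\<bar> \<le> \<bar>d0\<bar>")
    case True
    then have "\<bar>d\<bar> ^ 3 \<le> (2 * \<bar>d0\<bar>) ^ 3" unfolding d_def by (intro power_mono) auto
    then have "\<bar>d\<bar> ^ 3 \<le> 8 * \<bar>d0\<bar> ^ 3 + 4 * b\<^sup>2" by (simp add: power_mult_distrib add_increasing2)
    then have "3 / (8 * e ^ 5) * \<bar>d\<bar> ^ 3 \<le> (1 / (2 * e ^ 3) + 3 / (8 * e ^ 5)) * (8 * \<bar>d0\<bar> ^ 3 + 4 * b\<^sup>2)"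
      using e by (intro mult_mono) auto
    then show ?thesis using bd3 by linarith
  next
    case False
    then have "\<bar>d\<bar>\<^sup>2 \<le> (2 * \<bar>b\<bar>)\<^sup>2" unfolding d_def by (intro power_mono) auto
    then have "d\<^sup>2 \<le> 8 * \<bar>d0\<bar> ^ 3 + 4 * b\<^sup>2" by (simp add: power_mult_distrib add_increasing)
    then have "1 / (2 * e ^ 3) * d\<^sup>2 \<le> (1 / (2 * e ^ 3) + 3 / (8 * e ^ 5)) * (8 * \<bar>d0\<bar> ^ 3 + 4 * b\<^sup>2)"
      using e by (intro mult_mono) auto
    moreover have "0 \<le> d\<^sup>2 / (8 * s ^ 3)" using pos by simp
    ultimately show ?thesis using bd2 by linarith
  qed
  then show ?thesis unfolding id by linarith
qed

text \<open>
  Here \<open>a\<close>, \<open>b\<close> are consecutive values of \<open>X\<close>, \<open>z\<close> is the increment of \<open>B\<close> and \<open>q ^ 4\<close> the length of the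
  time step. The factor \<open>1 / sqrt \<eta>\<close> is the largest exponent for which the drift of
  \<open>sqrt (X + \<eta>)\<close> still dominates the compensator of the exponential martingale.
\<close>

lemma sqrt_step:
  fixes \<eta> \<delta> :: real
  assumes \<eta>: "\<eta> > 0" and \<delta>: "\<delta> \<ge> 2"
  obtains K where "K \<ge> 0"
    "\<And>a b z R q. \<lbrakk>a \<ge> 0; b \<ge> 0; 0 < q; q \<le> 1; b = a + 2 * sqrt a * z + \<delta> * q ^ 4 + 2 * R\<rbrakk> \<Longrightarrow>
      (z - (sqrt (b + \<eta>) - sqrt (a + \<eta>))) / sqrt \<eta>
      \<le> (1 - sqrt a / sqrt (a + \<eta>)) / sqrt \<eta> * z - ((1 - sqrt a / sqrt (a + \<eta>)) / sqrt \<eta>)\<^sup>2 * q ^ 4 / 2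
        - 1 / (sqrt \<eta> * sqrt (a + \<eta>)) * R + a / (2 * sqrt \<eta> * sqrt (a + \<eta>) ^ 3) * (z\<^sup>2 - q ^ 4)
        + K * (q * (a * z\<^sup>2) + (q ^ 8 + R\<^sup>2) / q + (1 + a\<^sup>2) * (q\<^sup>2 * z\<^sup>2 + z ^ 4 / q\<^sup>2))"
proof -
  define e where "e = sqrt \<eta>"
  have e: "e > 0" "e\<^sup>2 = \<eta>" using \<eta> by (auto simp: e_def)
  define c where "c = 1 / (2 * e ^ 3) + 3 / (8 * e ^ 5)"
  define K where "K = ((20 + 4 * \<delta>\<^sup>2) / (8 * e ^ 3) + c * (64 + 8 * \<delta>\<^sup>2)) / e"
  have c: "c \<ge> 0" using e by (simp add: c_def)
  have "K \<ge> 0" using e c by (simp add: K_def)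
  moreover have "(z - (sqrt (b + \<eta>) - sqrt (a + \<eta>))) / e
      \<le> (1 - sqrt a / sqrt (a + \<eta>)) / e * z - ((1 - sqrt a / sqrt (a + \<eta>)) / e)\<^sup>2 * q ^ 4 / 2
        - 1 / (e * sqrt (a + \<eta>)) * R + a / (2 * e * sqrt (a + \<eta>) ^ 3) * (z\<^sup>2 - q ^ 4)
        + K * (q * (a * z\<^sup>2) + (q ^ 8 + R\<^sup>2) / q + (1 + a\<^sup>2) * (q\<^sup>2 * z\<^sup>2 + z ^ 4 / q\<^sup>2))"
    if a: "a \<ge> 0" and b: "b \<ge> 0" and q: "0 < q" "q \<le> 1" and eq: "b = a + 2 * sqrt a * z + \<delta> * q ^ 4 + 2 * R"
    for a b z R q :: real
  proof -
    define s where "s = sqrt (a + \<eta>)"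
    define s' where "s' = sqrt (b + \<eta>)"
    define u where "u = sqrt a"
    define \<beta> where "\<beta> = \<delta> * q ^ 4 + 2 * R"
    define d0 where "d0 = 2 * u * z"
    define S1 where "S1 = q * (a * z\<^sup>2)"
    define S2 where "S2 = (q ^ 8 + R\<^sup>2) / q"
    define S3 where "S3 = (1 + a\<^sup>2) * (q\<^sup>2 * z\<^sup>2 + z ^ 4 / q\<^sup>2)"
    have u: "u \<ge> 0" "u\<^sup>2 = a" using a by (auto simp: u_def)
    have s: "s\<^sup>2 = a + \<eta>" "s'\<^sup>2 = b + \<eta>" using a b \<eta> by (auto simp: s_def s'_def)
    have se: "e \<le> s" "e \<le> s'" using a b by (auto simp: e_def s_def s'_def)
    have sp: "s > 0" using se e by linarith
    have su: "s \<le> u + e"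
      unfolding s_def u_def e_def using a \<eta> by (intro sqrt_add_le_add_sqrt) auto
    have us: "u \<le> s" unfolding s_def u_def using \<eta> by simp
    have S: "S1 \<ge> 0" "S2 \<ge> 0" "S3 \<ge> 0" using a q by (auto simp: S1_def S2_def S3_def)
    have "s'\<^sup>2 - s\<^sup>2 = d0 + \<beta>" unfolding s using eq by (simp add: d0_def \<beta>_def u_def)
    note T = sqrt_taylor[OF e(1) se this, folded c_def]
    have b2: "\<beta>\<^sup>2 \<le> (2 * \<delta>\<^sup>2 + 8) * (q ^ 8 + R\<^sup>2)"
    proof -
      have "\<beta>\<^sup>2 \<le> 2 * (\<delta> * q ^ 4)\<^sup>2 + 2 * (2 * R)\<^sup>2"
        unfolding \<beta>_def using sum_squares_bound[of "\<delta> * q ^ 4" "2 * R"] by (simp add: power2_sum)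
      also have "\<dots> = 2 * \<delta>\<^sup>2 * q ^ 8 + 8 * R\<^sup>2" by (simp add: power_mult_distrib power_mult[symmetric])
      also have "\<dots> \<le> (2 * \<delta>\<^sup>2 + 8) * (q ^ 8 + R\<^sup>2)" by (simp add: algebra_simps)
      finally show ?thesis .
    qed
    have b2q: "\<beta>\<^sup>2 / q \<le> (2 * \<delta>\<^sup>2 + 8) * S2"
      using divide_right_mono[OF b2, of q] q by (simp add: S2_def)
    have "\<beta>\<^sup>2 \<le> \<beta>\<^sup>2 / q" using q by (simp add: le_divide_eq mult_left_le)
    then have b2': "\<beta>\<^sup>2 \<le> (2 * \<delta>\<^sup>2 + 8) * S2" using b2q by linarith
    \<comment> \<open>The cross term mixes the Brownian part with \<beta>. Young's inequality with
      weight q splits it into \<open>q * d0\<^sup>2\<close> and \<open>\<beta>\<^sup>2 / q\<close>,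
      both of mean order \<open>q ^ 5\<close> in the application, below the time step
      \<open>q ^ 4\<close>.\<close>
    have d2: "(d0 + \<beta>)\<^sup>2 \<le> 4 * (a * z\<^sup>2) + (20 + 4 * \<delta>\<^sup>2) * (S1 + S2)"
    proof -
      have "2 * d0 * \<beta> \<le> q * d0\<^sup>2 + \<beta>\<^sup>2 / q"
      proof -
        have "0 \<le> (q * d0 - \<beta>)\<^sup>2 / q" using q by simp
        also have "\<dots> = q * d0\<^sup>2 - 2 * d0 * \<beta> + \<beta>\<^sup>2 / q"
          using q by (simp add: power2_eq_square field_simps)
        finally show ?thesis by simp
      qed
      moreover have d02: "d0\<^sup>2 = 4 * (a * z\<^sup>2)" by (simp add: d0_def power_mult_distrib u)
      moreover have "q * d0\<^sup>2 = 4 * S1" by (simp add: d02 S1_def)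
      moreover have "(d0 + \<beta>)\<^sup>2 = d0\<^sup>2 + 2 * d0 * \<beta> + \<beta>\<^sup>2" by (simp add: power2_sum)
      ultimately have "(d0 + \<beta>)\<^sup>2 \<le> 4 * (a * z\<^sup>2) + 4 * S1 + 2 * ((2 * \<delta>\<^sup>2 + 8) * S2)"
        using b2q b2' by linarith
      also have "\<dots> \<le> 4 * (a * z\<^sup>2) + (20 + 4 * \<delta>\<^sup>2) * (S1 + S2)"
      proof -
        have "0 \<le> (16 + 4 * \<delta>\<^sup>2) * S1 + 4 * S2" using S by simp
        then show ?thesis by (simp add: algebra_simps)
      qed
      finally show ?thesis .
    qed
    have d3: "8 * \<bar>d0\<bar> ^ 3 + 4 * \<beta>\<^sup>2 \<le> (64 + 8 * \<delta>\<^sup>2) * (S2 + S3)"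
    proof -
      \<comment> \<open>The third absolute power is traded for even powers, whose Gaussian moments
        are explicit. The weights balance because \<open>q\<^sup>2\<close> is the standard deviation
        of an increment over a step of length \<open>q ^ 4\<close>.\<close>
      have "\<bar>z\<bar> ^ 3 \<le> (q\<^sup>2 * z\<^sup>2 + z ^ 4 / q\<^sup>2) / 2"
      proof -
        have "0 \<le> (q * \<bar>z\<bar> - z\<^sup>2 / q)\<^sup>2" by simp
        also have "\<dots> = q\<^sup>2 * z\<^sup>2 + z ^ 4 / q\<^sup>2 - 2 * (\<bar>z\<bar> * z\<^sup>2)"
          using q by (simp add: power2_diff power_mult_distrib power_divide power_mult[symmetric] mult.assoc)
        also have "\<bar>z\<bar> * z\<^sup>2 = \<bar>z\<bar> ^ 3"
        proof -
          have "\<bar>z\<bar> ^ 3 = \<bar>z\<bar> * \<bar>z\<bar>\<^sup>2" by (simp only: power3_eq_cube power2_eq_square mult.assoc)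
          then show ?thesis by (simp only: power2_abs)
        qed
        finally show ?thesis by simp
      qed
      moreover have "u ^ 3 \<le> 1 + a\<^sup>2"
      proof (cases "u \<le> 1")
        case True
        then have "u ^ 3 \<le> 1" using u by (intro power_le_one) auto
        then show ?thesis by (simp add: add_increasing2)
      next
        case False
        then have "u ^ 3 \<le> u ^ 4" by (intro power_increasing) auto
        also have "\<dots> = a\<^sup>2" unfolding u(2)[symmetric] by (simp add: power_mult[symmetric])
        finally show ?thesis by simp
      qed
      ultimately have "u ^ 3 * \<bar>z\<bar> ^ 3 \<le> (1 + a\<^sup>2) * ((q\<^sup>2 * z\<^sup>2 + z ^ 4 / q\<^sup>2) / 2)"
        using u by (intro mult_mono) auto
      then have "8 * \<bar>d0\<bar> ^ 3 \<le> 32 * S3"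
        using u by (simp add: d0_def abs_mult power_mult_distrib S3_def)
      then have "8 * \<bar>d0\<bar> ^ 3 + 4 * \<beta>\<^sup>2 \<le> 32 * S3 + 4 * ((2 * \<delta>\<^sup>2 + 8) * S2)" using b2' by linarith
      also have "\<dots> \<le> (64 + 8 * \<delta>\<^sup>2) * (S2 + S3)"
      proof -
        have "0 \<le> 32 * S2 + (32 + 8 * \<delta>\<^sup>2) * S3" using S by simp
        then show ?thesis by (simp add: algebra_simps)
      qed
      finally show ?thesis .
    qed
    define \<kappa> where "\<kappa> = 1 - u / s"
    have k0: "\<kappa> = (s - u) / s" using sp by (simp add: \<kappa>_def diff_divide_distrib)
    have k: "\<kappa> \<ge> 0" "\<kappa> \<le> 1" "\<kappa> \<le> e / s"
      using u us sp su by (simp add: k0, simp add: \<kappa>_def, simp add: k0 divide_right_mono)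
    \<comment> \<open>Here \<open>\<delta> \<ge> 2\<close> enters:
      \<open>\<kappa>\<^sup>2 \<le> \<kappa> \<le> e / s\<close> bounds the compensator by
      \<open>1 / s\<close>, the Ito correction \<open>a / s ^ 3\<close> is at most another
      \<open>1 / s\<close>, and \<open>\<delta> / s\<close> has to cover both.\<close>
    have comp: "\<kappa>\<^sup>2 / e \<le> \<delta> / s - a / s ^ 3"
    proof -
      have "\<kappa>\<^sup>2 \<le> \<kappa> * 1" unfolding power2_eq_square using k by (intro mult_left_mono) auto
      then have "\<kappa>\<^sup>2 / e \<le> (e / s) / e" using k e by (intro divide_right_mono) auto
      also have "\<dots> = 1 / s" using e by simp
      finally have 1: "\<kappa>\<^sup>2 / e \<le> 1 / s" .
      have "a / s ^ 3 \<le> s\<^sup>2 / s ^ 3" using s \<eta> sp by (intro divide_right_mono) auto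
      also have "\<dots> = 1 / s" using sp by (simp add: power2_eq_square power3_eq_cube)
      finally have 2: "a / s ^ 3 \<le> 1 / s" .
      have "2 / s \<le> \<delta> / s" using \<delta> sp by (intro divide_right_mono) auto
      then show ?thesis using 1 2 by simp
    qed
    have "(d0 + \<beta>)\<^sup>2 / (8 * s ^ 3) \<le> (4 * (a * z\<^sup>2) + (20 + 4 * \<delta>\<^sup>2) * (S1 + S2)) / (8 * s ^ 3)"
      using d2 sp by (intro divide_right_mono) auto
    also have "\<dots> = a * z\<^sup>2 / (2 * s ^ 3) + (20 + 4 * \<delta>\<^sup>2) * (S1 + S2) / (8 * s ^ 3)"
      by (simp add: add_divide_distrib)
    also have "(20 + 4 * \<delta>\<^sup>2) * (S1 + S2) / (8 * s ^ 3) \<le> (20 + 4 * \<delta>\<^sup>2) * (S1 + S2) / (8 * e ^ 3)"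
      using S e se by (intro divide_left_mono mult_left_mono power_mono mult_nonneg_nonneg mult_pos_pos) auto
    finally have q2: "(d0 + \<beta>)\<^sup>2 / (8 * s ^ 3) \<le> a * z\<^sup>2 / (2 * s ^ 3) + (20 + 4 * \<delta>\<^sup>2) * (S1 + S2) / (8 * e ^ 3)"
      by simp
    have q3: "c * (8 * \<bar>d0\<bar> ^ 3 + 4 * \<beta>\<^sup>2) \<le> c * ((64 + 8 * \<delta>\<^sup>2) * (S2 + S3))"
      by (rule mult_left_mono[OF d3 c])
    have lin: "- (d0 + \<beta>) / (2 * s) = (\<kappa> - 1) * z - \<delta> * q ^ 4 / (2 * s) - R / s"
      using sp by (simp add: d0_def \<beta>_def \<kappa>_def field_simps)
    have KS: "(20 + 4 * \<delta>\<^sup>2) * (S1 + S2) / (8 * e ^ 3) + c * ((64 + 8 * \<delta>\<^sup>2) * (S2 + S3)) \<le> e * K * (S1 + S2 + S3)"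
    proof -
      have 1: "(20 + 4 * \<delta>\<^sup>2) / (8 * e ^ 3) * (S1 + S2) \<le> (20 + 4 * \<delta>\<^sup>2) / (8 * e ^ 3) * (S1 + S2 + S3)"
        using S e by (intro mult_left_mono) auto
      have 2: "c * (64 + 8 * \<delta>\<^sup>2) * (S2 + S3) \<le> c * (64 + 8 * \<delta>\<^sup>2) * (S1 + S2 + S3)"
        using S c by (intro mult_left_mono) auto
      have 3: "e * K = (20 + 4 * \<delta>\<^sup>2) / (8 * e ^ 3) + c * (64 + 8 * \<delta>\<^sup>2)" using e by (simp add: K_def)
      show ?thesis
        unfolding 3 distrib_right[of "(20 + 4 * \<delta>\<^sup>2) / (8 * e ^ 3)"]
        using add_mono[OF 1 2] by (simp only: times_divide_eq_left mult.assoc)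
    qed
    have comp2: "\<kappa>\<^sup>2 / e * q ^ 4 \<le> (\<delta> / s - a / s ^ 3) * q ^ 4"
      using comp q by (intro mult_right_mono) auto
    have "z - (s' - s) \<le> \<kappa> * z - \<delta> * q ^ 4 / (2 * s) - R / s + a * z\<^sup>2 / (2 * s ^ 3) + e * K * (S1 + S2 + S3)"
      using T q2 q3 lin KS by (simp add: left_diff_distrib)
    also have "\<dots> \<le> \<kappa> * z - \<kappa>\<^sup>2 / e * q ^ 4 / 2 - R / s + a / (2 * s ^ 3) * (z\<^sup>2 - q ^ 4) + e * K * (S1 + S2 + S3)"
      using comp2 by (simp add: left_diff_distrib right_diff_distrib)
    finally have "(z - (s' - s)) / e \<le> (\<kappa> * z - \<kappa>\<^sup>2 / e * q ^ 4 / 2 - R / s + a / (2 * s ^ 3) * (z\<^sup>2 - q ^ 4) + e * K * (S1 + S2 + S3)) / e"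
      using e by (intro divide_right_mono) auto
    also have "\<dots> = \<kappa> / e * z - (\<kappa> / e)\<^sup>2 * q ^ 4 / 2 - 1 / (e * s) * R + a / (2 * e * s ^ 3) * (z\<^sup>2 - q ^ 4) + K * (S1 + S2 + S3)"
      using e sp by (simp add: add_divide_distrib diff_divide_distrib power_divide power2_eq_square mult_ac)
    finally show ?thesis
      unfolding \<kappa>_def u_def s_def s'_def S1_def S2_def S3_def by (simp add: add.assoc)
  qed
  ultimately show thesis unfolding e_def by (rule that)
qed

section \<open>Discretisation errors\<close>

text \<open>If \<open>q\<close> is this quantity, a time step has length \<open>q ^ 4\<close> and its error terms are of order \<open>q ^ 5\<close>
  in mean, so that their sum over all steps vanishes in the limit.\<close>

definition fourth_root_mesh :: "nat \<Rightarrow> real" where "fourth_root_mesh n = sqrt (sqrt (mesh n))"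

lemma fourth_root_mesh:
  "0 < fourth_root_mesh n" "fourth_root_mesh n \<le> 1" "fourth_root_mesh n ^ 4 = mesh n"
  "(fourth_root_mesh n)\<^sup>2 = sqrt (mesh n)"
proof -
  show "0 < fourth_root_mesh n" "fourth_root_mesh n \<le> 1"
    using mesh_pos[of n] mesh_le_1[of n] by (auto simp: fourth_root_mesh_def)
  show 2: "(fourth_root_mesh n)\<^sup>2 = sqrt (mesh n)"
    using mesh_pos[of n] by (simp add: fourth_root_mesh_def)
  have "fourth_root_mesh n ^ 4 = ((fourth_root_mesh n)\<^sup>2)\<^sup>2" by (simp add: power_mult[symmetric])
  then show "fourth_root_mesh n ^ 4 = mesh n" using mesh_pos[of n] by (simp add: 2)
qed

lemma fourth_root_mesh_tendsto_0: "fourth_root_mesh \<longlonglongrightarrow> 0"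
proof -
  have "(\<lambda>n. sqrt (sqrt (mesh n))) \<longlonglongrightarrow> sqrt (sqrt 0)"
    by (intro tendsto_real_sqrt mesh_tendsto_0)
  then show ?thesis by (simp add: fourth_root_mesh_def[abs_def])
qed

context squared_bessel_process begin

text \<open>The Euler remainder of one step. With it the equation for X reads X' = X + 2 sqrt X dB +
  \<delta> \<open>mesh n\<close> + 2 R almost surely, without approximation.\<close>

definition R :: "nat \<Rightarrow> nat \<Rightarrow> 'a \<Rightarrow> real" where
  "R n k \<omega> = I (grid n (Suc k)) \<omega> - I (grid n k) \<omega> - sqrt (X (grid n k) \<omega>) * dB n k \<omega>"

lemma R_measurable: "R n k \<in> borel_measurable M"
  unfolding R_def using I_measurable[OF grid_nonneg[of k n]] I_measurable[OF grid_nonneg[of "Suc k" n]]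
    X_measurable[OF grid_nonneg[of k n]] dB_measurable[of n k] by measurable

text \<open>\<open>l div p\<close> is the coarse cell containing the fine step l. Regrouped this
  way, the coarse remainders form a single martingale sum on the fine grid, whose coefficients are
  the small increments of \<xi> within a cell.\<close>

lemma refined_sum:
  fixes w :: "nat \<Rightarrow> 'a \<Rightarrow> real"
  assumes m: "n + j \<le> m"
  defines "p \<equiv> 2 ^ (m - n) :: nat"
  shows "(\<Sum>l<j * p. w (l div p) \<omega> * (\<xi> m l \<omega> - \<xi> m (l div p * p) \<omega>) * dB m l \<omega>)
    = (\<Sum>k<j. w k \<omega> * (J m (grid n (Suc k)) \<omega> - J m (grid n k) \<omega> - \<xi> m (k * p) \<omega> * dB n k \<omega>))"
proof -
  let ?f = "\<lambda>l. w (l div p) \<omega> * (\<xi> m l \<omega> - \<xi> m (l div p * p) \<omega>) * dB m l \<omega>"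
  have p: "p > 0" by (simp add: p_def)
  have ref: "grid m (l * p) = grid n l" for l using grid_refine[of n m l] m by (simp add: p_def)
  have "(\<Sum>l<j * p. ?f l) = (\<Sum>k<j. sum ?f {k * p..<k * p + p})"
    by (rule sum.nat_group[symmetric])
  also have "\<dots> = (\<Sum>k<j. w k \<omega> * (J m (grid n (Suc k)) \<omega> - J m (grid n k) \<omega> - \<xi> m (k * p) \<omega> * dB n k \<omega>))"
  proof (rule sum.cong[OF refl])
    fix k assume k: "k \<in> {..<j}"
    have e: "k * p + p = Suc k * p" by simp
    have "Suc k * p \<le> j * p" using k by (intro mult_right_mono) auto
    then have b: "Suc k * p \<le> 4 ^ m" "k * p \<le> 4 ^ m"
      using refined_index_bound[OF m, folded p_def] by auto
    have "sum ?f {k * p..<k * p + p} = (\<Sum>l\<in>{k * p..<k * p + p}. w k \<omega> * (\<xi> m l \<omega> * dB m l \<omega> - \<xi> m (k * p) \<omega> * dB m l \<omega>))"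
    proof (rule sum.cong[OF refl])
      fix l assume "l \<in> {k * p..<k * p + p}"
      then have "l div p = k" by (intro div_nat_eqI) (auto simp: mult.commute)
      then show "?f l = w k \<omega> * (\<xi> m l \<omega> * dB m l \<omega> - \<xi> m (k * p) \<omega> * dB m l \<omega>)" by (simp add: algebra_simps)
    qed
    also have "\<dots> = w k \<omega> * ((\<Sum>l\<in>{k * p..<k * p + p}. \<xi> m l \<omega> * dB m l \<omega>) - \<xi> m (k * p) \<omega> * (\<Sum>l\<in>{k * p..<k * p + p}. dB m l \<omega>))"
      by (simp only: sum_distrib_left sum_subtractf right_diff_distrib)
    also have "(\<Sum>l\<in>{k * p..<k * p + p}. dB m l \<omega>) = dB n k \<omega>"
    proof -
      have "(\<Sum>l\<in>{k * p..<k * p + p}. dB m l \<omega>) = B (grid m (k * p + p)) \<omega> - B (grid m (k * p)) \<omega>"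
        unfolding dB_def by (rule sum_Suc_diff') simp
      then show ?thesis unfolding e ref dB_def .
    qed
    also have "(\<Sum>l\<in>{k * p..<k * p + p}. \<xi> m l \<omega> * dB m l \<omega>) = J m (grid n (Suc k)) \<omega> - J m (grid n k) \<omega>"
    proof -
      have "(\<Sum>l\<in>{0..<k * p}. \<xi> m l \<omega> * dB m l \<omega>) + (\<Sum>l\<in>{k * p..<Suc k * p}. \<xi> m l \<omega> * dB m l \<omega>)
        = (\<Sum>l\<in>{0..<Suc k * p}. \<xi> m l \<omega> * dB m l \<omega>)"
        by (rule sum.atLeastLessThan_concat) auto
      then show ?thesis
        using J_grid[OF b(1), of \<omega>] J_grid[OF b(2), of \<omega>] unfolding e ref by (simp add: atLeast0LessThan)
    qed
    finally show "sum ?f {k * p..<k * p + p} = w k \<omega> * (J m (grid n (Suc k)) \<omega> - J m (grid n k) \<omega> - \<xi> m (k * p) \<omega> * dB n k \<omega>)" .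
  qed
  finally show ?thesis .
qed

text \<open>The second moment of one remainder has order \<open>mesh n powr (3/2)\<close>, which
  bounds its mean only by order \<open>mesh n powr (3/4)\<close>; over about
  \<open>1 / mesh n\<close> steps such bounds add up to infinity in the limit. Orthogonality on the
  fine grid lets the second moments add up instead. The individual bounds \<open>W k\<close> also
  cover weights concentrated on one step, while \<open>Wm\<close> supplies the uniform bound that
  the isometry asks for.\<close>

lemma remainder_bound:
  obtains C where "C \<ge> 0"
    "\<And>n j w W Wm. \<lbrakk>grid n j \<le> T; \<And>k. w k \<in> borel_measurable (F (grid n k));
        \<And>k \<omega>. \<omega> \<in> space M \<Longrightarrow> \<bar>w k \<omega>\<bar> \<le> W k; \<And>k. W k \<le> Wm\<rbrakk> \<Longrightarrow>
      integrable M (\<lambda>\<omega>. (\<Sum>k<j. w k \<omega> * R n k \<omega>)\<^sup>2)"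
    "\<And>n j w W Wm. \<lbrakk>grid n j \<le> T; \<And>k. w k \<in> borel_measurable (F (grid n k));
        \<And>k \<omega>. \<omega> \<in> space M \<Longrightarrow> \<bar>w k \<omega>\<bar> \<le> W k; \<And>k. W k \<le> Wm\<rbrakk> \<Longrightarrow>
      expectation (\<lambda>\<omega>. (\<Sum>k<j. w k \<omega> * R n k \<omega>)\<^sup>2) \<le> (\<Sum>k<j. (W k)\<^sup>2) * (C * sqrt (mesh n) * mesh n)"
proof -
  obtain C where C: "C \<ge> 0"
    "\<And>m k l n. k \<le> l \<Longrightarrow> grid m l \<le> T \<Longrightarrow> grid m l - grid m k \<le> mesh n \<Longrightarrow>
      integrable M (\<lambda>\<omega>. \<bar>X (grid m l) \<omega> - X (grid m k) \<omega>\<bar>)"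
    "\<And>m k l n. k \<le> l \<Longrightarrow> grid m l \<le> T \<Longrightarrow> grid m l - grid m k \<le> mesh n \<Longrightarrow>
      expectation (\<lambda>\<omega>. \<bar>X (grid m l) \<omega> - X (grid m k) \<omega>\<bar>) \<le> C * sqrt (mesh n)"
    using X_increment_bound[of T] by blast
  have *: "integrable M (\<lambda>\<omega>. (\<Sum>k<j. w k \<omega> * R n k \<omega>)\<^sup>2) \<and>
    expectation (\<lambda>\<omega>. (\<Sum>k<j. w k \<omega> * R n k \<omega>)\<^sup>2) \<le> (\<Sum>k<j. (W k)\<^sup>2) * (C * sqrt (mesh n) * mesh n)"
    if jT: "grid n j \<le> T" and wm: "\<And>k. w k \<in> borel_measurable (F (grid n k))"
      and wb: "\<And>k \<omega>. \<omega> \<in> space M \<Longrightarrow> \<bar>w k \<omega>\<bar> \<le> W k" and Wm: "\<And>k. W k \<le> Wm"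
    for n j :: nat and w :: "nat \<Rightarrow> 'a \<Rightarrow> real" and W :: "nat \<Rightarrow> real" and Wm :: real
  proof -
    have T: "T \<ge> 0" using jT grid_nonneg[of j n] by linarith
    obtain \<omega>0 where w0: "\<omega>0 \<in> space M" using not_empty by blast
    have W0: "W k \<ge> 0" for k using wb[OF w0, of k] by linarith
    have Wm0: "Wm \<ge> 0" using W0[of 0] Wm[of 0] by linarith
    obtain r where r: "strict_mono r"
      "AE \<omega> in M. \<forall>e>0. \<forall>\<^sub>F n in sequentially. \<forall>t\<in>{0..T}. \<bar>J (r n) t \<omega> - I t \<omega>\<bar> \<le> e"
      using J_subseq_uniform[OF T] by blast
    let ?p = "\<lambda>m. 2 ^ (m - n) :: nat"
    let ?f = "\<lambda>m \<omega>. \<Sum>l<j * ?p m. w (l div ?p m) \<omega> * (\<xi> m l \<omega> - \<xi> m (l div ?p m * ?p m) \<omega>) * dB m l \<omega>"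
    have b: "integrable M (\<lambda>\<omega>. (?f m \<omega>)\<^sup>2) \<and>
      expectation (\<lambda>\<omega>. (?f m \<omega>)\<^sup>2) \<le> (\<Sum>k<j. (W k)\<^sup>2) * (C * sqrt (mesh n) * mesh n)" if m: "n + j \<le> m" for m
    proof -
      let ?q = "?p m"
      have p: "?q > 0" by simp
      have ref: "grid m (l * ?q) = grid n l" for l using grid_refine[of n m l] m by simp
      define a where "a l \<omega> = w (l div ?q) \<omega> * (\<xi> m l \<omega> - \<xi> m (l div ?q * ?q) \<omega>)" for l \<omega>
      have le: "l div ?q * ?q \<le> l" for l by simp
      \<comment> \<open>Weight and reference value belong to the start of the coarse cell, hence to
        the past of the fine step.\<close>
      have am: "a l \<in> borel_measurable (F (grid m l))" for l
      proof -
        have "w (l div ?q) \<in> borel_measurable (F (grid m l))"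
          using measurable_F_mono[OF wm] grid_le[OF le[of l], of m] unfolding ref by blast
        moreover have "\<xi> m (l div ?q * ?q) \<in> borel_measurable (F (grid m l))"
          by (rule measurable_F_mono[OF \<xi>_adapted grid_le[OF le]])
        ultimately show ?thesis unfolding a_def using \<xi>_adapted[of m l] by measurable
      qed
      have ab: "\<bar>a l \<omega>\<bar> \<le> Wm * real m" if w: "\<omega> \<in> space M" for l \<omega>
        unfolding a_def abs_mult
      proof (rule mult_mono)
        show "\<bar>w (l div ?q) \<omega>\<bar> \<le> Wm" using order_trans[OF wb[OF w] Wm] .
        show "\<bar>\<xi> m l \<omega> - \<xi> m (l div ?q * ?q) \<omega>\<bar> \<le> real m"
          using \<xi>_bounds[OF w, of m l] \<xi>_bounds[OF w, of m "l div ?q * ?q"] by linarith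
      qed (use Wm0 in auto)
      have X1: "expectation (\<lambda>\<omega>. (a l \<omega>)\<^sup>2) \<le> (W (l div ?q))\<^sup>2 * (C * sqrt (mesh n))" if l: "l < j * ?q" for l
      proof -
        have lT: "grid m l \<le> T" using grid_le[of l "j * ?q" m] l ref[of j] jT by linarith
        have gap: "grid m l - grid m (l div ?q * ?q) \<le> mesh n"
        proof -
          have "l \<le> l div ?q * ?q + ?q" using p by (metis add_left_mono div_mult_mod_eq less_imp_le mod_less_divisor)
          then have "grid m l \<le> grid m (Suc (l div ?q) * ?q)" by (intro grid_le) simp
          then show ?thesis unfolding ref by (simp add: algebra_simps)
        qed
        have i1: "integrable M (\<lambda>\<omega>. (a l \<omega>)\<^sup>2)"
        proof (rule integrable_const_bound[of _ "(Wm * real m)\<^sup>2"])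
          show "AE \<omega> in M. norm ((a l \<omega>)\<^sup>2) \<le> (Wm * real m)\<^sup>2"
          proof (rule AE_I2)
            fix \<omega> assume "\<omega> \<in> space M"
            then have "\<bar>a l \<omega>\<bar>\<^sup>2 \<le> (Wm * real m)\<^sup>2" by (intro power_mono ab) auto
            then show "norm ((a l \<omega>)\<^sup>2) \<le> (Wm * real m)\<^sup>2" by simp
          qed
        qed (use measurable_F_M[OF am[of l]] in measurable)
        have i2: "integrable M (\<lambda>\<omega>. (W (l div ?q))\<^sup>2 * \<bar>X (grid m l) \<omega> - X (grid m (l div ?q * ?q)) \<omega>\<bar>)"
          using C(2)[OF le lT gap] by simp
        have "expectation (\<lambda>\<omega>. (a l \<omega>)\<^sup>2) \<le> expectation (\<lambda>\<omega>. (W (l div ?q))\<^sup>2 * \<bar>X (grid m l) \<omega> - X (grid m (l div ?q * ?q)) \<omega>\<bar>)"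
        proof (rule integral_mono[OF i1 i2])
          fix \<omega> assume w: "\<omega> \<in> space M"
          have "\<bar>w (l div ?q) \<omega>\<bar>\<^sup>2 \<le> (W (l div ?q))\<^sup>2" using wb[OF w] by (intro power_mono) auto
          moreover have "(\<xi> m l \<omega> - \<xi> m (l div ?q * ?q) \<omega>)\<^sup>2 \<le> \<bar>X (grid m l) \<omega> - X (grid m (l div ?q * ?q)) \<omega>\<bar>"
            unfolding \<xi>_def by (rule power2_diff_sqrt_le[OF X_nonneg[OF w grid_nonneg] X_nonneg[OF w grid_nonneg]])
          ultimately have "\<bar>w (l div ?q) \<omega>\<bar>\<^sup>2 * (\<xi> m l \<omega> - \<xi> m (l div ?q * ?q) \<omega>)\<^sup>2
            \<le> (W (l div ?q))\<^sup>2 * \<bar>X (grid m l) \<omega> - X (grid m (l div ?q * ?q)) \<omega>\<bar>"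
            by (intro mult_mono) auto
          then show "(a l \<omega>)\<^sup>2 \<le> (W (l div ?q))\<^sup>2 * \<bar>X (grid m l) \<omega> - X (grid m (l div ?q * ?q)) \<omega>\<bar>"
            unfolding a_def power_mult_distrib power2_abs .
        qed
        also have "\<dots> = (W (l div ?q))\<^sup>2 * expectation (\<lambda>\<omega>. \<bar>X (grid m l) \<omega> - X (grid m (l div ?q * ?q)) \<omega>\<bar>)"
          by (rule integral_mult_right_zero)
        also have "\<dots> \<le> (W (l div ?q))\<^sup>2 * (C * sqrt (mesh n))"
          by (intro mult_left_mono C(3)[OF le lT gap]) simp
        finally show ?thesis .
      qed
      have "(\<Sum>l<j * ?q. expectation (\<lambda>\<omega>. (a l \<omega>)\<^sup>2) * mesh m)
        \<le> (\<Sum>l<j * ?q. (W (l div ?q))\<^sup>2 * (C * sqrt (mesh n)) * mesh m)"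
        using X1 mesh_pos[of m] by (intro sum_mono mult_right_mono) auto
      also have "\<dots> = (\<Sum>k<j. \<Sum>l\<in>{k * ?q..<k * ?q + ?q}. (W (l div ?q))\<^sup>2 * (C * sqrt (mesh n)) * mesh m)"
        by (rule sum.nat_group[symmetric])
      also have "\<dots> = (\<Sum>k<j. \<Sum>l\<in>{k * ?q..<k * ?q + ?q}. (W k)\<^sup>2 * (C * sqrt (mesh n)) * mesh m)"
      proof (intro sum.cong[OF refl])
        fix k l assume "l \<in> {k * ?q..<k * ?q + ?q}"
        then have "l div ?q = k" by (intro div_nat_eqI) (auto simp: mult.commute)
        then show "(W (l div ?q))\<^sup>2 * (C * sqrt (mesh n)) * mesh m = (W k)\<^sup>2 * (C * sqrt (mesh n)) * mesh m" by simp
      qed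
      also have "\<dots> = (\<Sum>k<j. (W k)\<^sup>2 * (C * sqrt (mesh n) * mesh n))"
      proof (rule sum.cong[OF refl])
        fix k
        have "real ?q * mesh m = mesh n" using ref[of 1] by simp
        then show "(\<Sum>l\<in>{k * ?q..<k * ?q + ?q}. (W k)\<^sup>2 * (C * sqrt (mesh n)) * mesh m) = (W k)\<^sup>2 * (C * sqrt (mesh n) * mesh n)"
          by (simp add: mult_ac)
      qed
      finally show ?thesis
        using dB_sum_square[OF am ab, of "j * ?q"] unfolding a_def by (simp add: sum_distrib_right)
    qed
    have fm: "?f m \<in> borel_measurable M" for m
      using measurable_F_M[OF wm] measurable_F_M[OF \<xi>_adapted] dB_measurable
      by (intro borel_measurable_sum borel_measurable_times borel_measurable_diff) auto
    have gm: "(\<lambda>\<omega>. \<Sum>k<j. w k \<omega> * R n k \<omega>) \<in> borel_measurable M"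
      using measurable_F_M[OF wm] R_measurable by (intro borel_measurable_sum borel_measurable_times) auto
    have lim: "AE \<omega> in M. (\<lambda>i. ?f (r i) \<omega>) \<longlonglongrightarrow> (\<Sum>k<j. w k \<omega> * R n k \<omega>)"
      using r(2)
    proof eventually_elim
      case (elim \<omega>)
      have ev: "\<forall>\<^sub>F i in sequentially. n + j \<le> r i"
        using seq_suble[OF r(1)] by (intro eventually_sequentiallyI[of "n + j"]) (meson le_trans)
      have "(\<lambda>i. \<Sum>k<j. w k \<omega> * (J (r i) (grid n (Suc k)) \<omega> - J (r i) (grid n k) \<omega> - \<xi> (r i) (k * ?p (r i)) \<omega> * dB n k \<omega>))
        \<longlonglongrightarrow> (\<Sum>k<j. w k \<omega> * R n k \<omega>)"
        unfolding R_def
      proof (intro tendsto_sum tendsto_mult tendsto_const tendsto_diff)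
        fix k assume k: "k \<in> {..<j}"
        have kT: "grid n (Suc k) \<le> T" "grid n k \<le> T"
          using grid_le[of "Suc k" j n] grid_le[of k j n] k jT by auto
        show "(\<lambda>i. J (r i) (grid n (Suc k)) \<omega>) \<longlonglongrightarrow> I (grid n (Suc k)) \<omega>" "(\<lambda>i. J (r i) (grid n k) \<omega>) \<longlonglongrightarrow> I (grid n k) \<omega>"
          by (rule subseq_grid[OF r(1) kT(1) elim], rule subseq_grid[OF r(1) kT(2) elim])
        have "\<forall>\<^sub>F i in sequentially. nat \<lceil>sqrt (X (grid n k) \<omega>)\<rceil> \<le> r i"
          using seq_suble[OF r(1)] by (intro eventually_sequentiallyI[of "nat \<lceil>sqrt (X (grid n k) \<omega>)\<rceil>"]) (meson le_trans)
        then have "\<forall>\<^sub>F i in sequentially. \<xi> (r i) (k * ?p (r i)) \<omega> = sqrt (X (grid n k) \<omega>)"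
          using ev
        proof eventually_elim
          case (elim i)
          have "grid (r i) (k * ?p (r i)) = grid n k" using grid_refine[of n "r i" k] elim(2) by simp
          moreover have "sqrt (X (grid n k) \<omega>) \<le> real (r i)" using elim(1) by linarith
          ultimately show ?case unfolding \<xi>_def by (simp only: min_absorb2)
        qed
        then show "(\<lambda>i. \<xi> (r i) (k * ?p (r i)) \<omega>) \<longlonglongrightarrow> sqrt (X (grid n k) \<omega>)" by (rule tendsto_eventually)
      qed
      moreover have "\<forall>\<^sub>F i in sequentially. (\<Sum>k<j. w k \<omega> * (J (r i) (grid n (Suc k)) \<omega> - J (r i) (grid n k) \<omega> - \<xi> (r i) (k * ?p (r i)) \<omega> * dB n k \<omega>)) = ?f (r i) \<omega>"
        using ev by eventually_elim (rule refined_sum[symmetric])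
      ultimately show ?case by (rule Lim_transform_eventually)
    qed
    have "\<forall>\<^sub>F i in sequentially. integrable M (\<lambda>\<omega>. (?f (r i) \<omega>)\<^sup>2) \<and>
      expectation (\<lambda>\<omega>. (?f (r i) \<omega>)\<^sup>2) \<le> (\<Sum>k<j. (W k)\<^sup>2) * (C * sqrt (mesh n) * mesh n)"
      using seq_suble[OF r(1)] by (intro eventually_sequentiallyI[of "n + j"] b) (meson le_trans)
    then show ?thesis using square_fatou[OF lim gm fm] by blast
  qed
  show thesis
  proof (rule that[OF C(1)])
    fix n j :: nat and w :: "nat \<Rightarrow> 'a \<Rightarrow> real" and W :: "nat \<Rightarrow> real" and Wm :: real
    assume "grid n j \<le> T" "\<And>k. w k \<in> borel_measurable (F (grid n k))"
      "\<And>k \<omega>. \<omega> \<in> space M \<Longrightarrow> \<bar>w k \<omega>\<bar> \<le> W k" "\<And>k. W k \<le> Wm"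
    from *[OF this] show "integrable M (\<lambda>\<omega>. (\<Sum>k<j. w k \<omega> * R n k \<omega>)\<^sup>2)"
      "expectation (\<lambda>\<omega>. (\<Sum>k<j. w k \<omega> * R n k \<omega>)\<^sup>2) \<le> (\<Sum>k<j. (W k)\<^sup>2) * (C * sqrt (mesh n) * mesh n)" by auto
  qed
qed

lemma R_second_moment:
  obtains C where "C \<ge> 0" "\<And>n k. grid n (Suc k) \<le> T \<Longrightarrow> integrable M (\<lambda>\<omega>. (R n k \<omega>)\<^sup>2)"
    "\<And>n k. grid n (Suc k) \<le> T \<Longrightarrow> expectation (\<lambda>\<omega>. (R n k \<omega>)\<^sup>2) \<le> C * sqrt (mesh n) * mesh n"
proof (rule remainder_bound[of T])
  fix C :: real
  assume C: "C \<ge> 0"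
    "\<And>n j w W Wm. \<lbrakk>grid n j \<le> T; \<And>k. w k \<in> borel_measurable (F (grid n k));
        \<And>k \<omega>. \<omega> \<in> space M \<Longrightarrow> \<bar>w k \<omega>\<bar> \<le> W k; \<And>k. W k \<le> Wm\<rbrakk> \<Longrightarrow>
      integrable M (\<lambda>\<omega>. (\<Sum>k<j. w k \<omega> * R n k \<omega>)\<^sup>2)"
    "\<And>n j w W Wm. \<lbrakk>grid n j \<le> T; \<And>k. w k \<in> borel_measurable (F (grid n k));
        \<And>k \<omega>. \<omega> \<in> space M \<Longrightarrow> \<bar>w k \<omega>\<bar> \<le> W k; \<And>k. W k \<le> Wm\<rbrakk> \<Longrightarrow>
      expectation (\<lambda>\<omega>. (\<Sum>k<j. w k \<omega> * R n k \<omega>)\<^sup>2) \<le> (\<Sum>k<j. (W k)\<^sup>2) * (C * sqrt (mesh n) * mesh n)"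
  show thesis
  proof (rule that[OF C(1)])
    fix n k assume kT: "grid n (Suc k) \<le> T"
    \<comment> \<open>A weight supported on step k alone singles out one remainder.\<close>
    define w where "w l \<omega> = (if l = k then 1 else 0 :: real)" for l and \<omega> :: 'a
    have s: "(\<Sum>l<Suc k. w l \<omega> * R n l \<omega>) = R n k \<omega>" for \<omega> by (simp add: w_def)
    have s2: "(\<Sum>l<Suc k. (if l = k then 1 else 0 :: real)\<^sup>2) = 1" by simp
    have a: "w l \<in> borel_measurable (F (grid n l))" "\<bar>w l \<omega>\<bar> \<le> (if l = k then 1 else 0)"
      "(if l = k then 1 else 0) \<le> (1::real)" for l \<omega>
      by (auto simp: w_def[abs_def])
    show "integrable M (\<lambda>\<omega>. (R n k \<omega>)\<^sup>2)" using C(2)[OF kT a] unfolding s .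
    show "expectation (\<lambda>\<omega>. (R n k \<omega>)\<^sup>2) \<le> C * sqrt (mesh n) * mesh n"
      using C(3)[OF kT a] unfolding s s2 by simp
  qed
qed

text \<open>The bracket multiplied by K in \<open>sqrt_step\<close>, for the step k and with q =
  \<open>fourth_root_mesh n\<close>.\<close>

definition S :: "nat \<Rightarrow> nat \<Rightarrow> 'a \<Rightarrow> real" where
  "S n k \<omega> = fourth_root_mesh n * (X (grid n k) \<omega> * (dB n k \<omega>)\<^sup>2)
    + (fourth_root_mesh n ^ 8 + (R n k \<omega>)\<^sup>2) / fourth_root_mesh n
    + (1 + (X (grid n k) \<omega>)\<^sup>2) * ((fourth_root_mesh n)\<^sup>2 * (dB n k \<omega>)\<^sup>2 + dB n k \<omega> ^ 4 / (fourth_root_mesh n)\<^sup>2)"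

text \<open>The left end value of X is independent of the increment, so the moments factor. With q
  the fourth root of the step, q X dB^2 has mean order q^5, R^2 / q has order q^6 / q, and the
  remaining terms have order q^6 or q^7.\<close>

lemma S_bound:
  obtains C where "C \<ge> 0" "\<And>n k. grid n (Suc k) \<le> T \<Longrightarrow> integrable M (S n k)"
    "\<And>n k. grid n (Suc k) \<le> T \<Longrightarrow> expectation (S n k) \<le> C * (fourth_root_mesh n * mesh n)"
proof -
  obtain C1 where C1: "C1 \<ge> 0" "\<And>N k. grid N k \<le> T \<Longrightarrow> integrable M (\<lambda>\<omega>. (X (grid N k) \<omega>)\<^sup>2)"
    "\<And>N k. grid N k \<le> T \<Longrightarrow> expectation (\<lambda>\<omega>. (X (grid N k) \<omega>)\<^sup>2) \<le> C1"
    using X_second_moment[of T] by blast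
  obtain C2 where C2: "C2 \<ge> 0" "\<And>n k. grid n (Suc k) \<le> T \<Longrightarrow> integrable M (\<lambda>\<omega>. (R n k \<omega>)\<^sup>2)"
    "\<And>n k. grid n (Suc k) \<le> T \<Longrightarrow> expectation (\<lambda>\<omega>. (R n k \<omega>)\<^sup>2) \<le> C2 * sqrt (mesh n) * mesh n"
    using R_second_moment[of T] by blast
  have *: "integrable M (S n k) \<and> expectation (S n k) \<le> (6 + 5 * C1 + C2) * (fourth_root_mesh n * mesh n)"
    if kT: "grid n (Suc k) \<le> T" for n k
  proof -
    let ?q = "fourth_root_mesh n" and ?h = "mesh n" and ?X = "X (grid n k)"
    note q = fourth_root_mesh[of n]
    have kT': "grid n k \<le> T" using grid_Suc_less[of k n] kT by linarith
    have Xm: "?X \<in> borel_measurable (F (grid n k))" by (rule X_adapted[OF grid_nonneg])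
    have X2: "integrable M (\<lambda>\<omega>. (?X \<omega>)\<^sup>2)" "expectation (\<lambda>\<omega>. (?X \<omega>)\<^sup>2) \<le> C1"
      using C1(2,3)[OF kT'] by auto
    have Xi: "integrable M ?X"
      by (rule square_integrable_imp_integrable[OF measurable_F_M[OF Xm] X2(1)])
    have EX: "expectation ?X \<le> 1 + C1"
    proof -
      have "expectation ?X \<le> expectation (\<lambda>\<omega>. 1 + (?X \<omega>)\<^sup>2)"
      proof (rule integral_mono[OF Xi])
        show "integrable M (\<lambda>\<omega>. 1 + (?X \<omega>)\<^sup>2)" using X2(1) by simp
        fix \<omega>
        have "?X \<omega> \<le> \<bar>?X \<omega>\<bar>" by simp
        also have "\<dots> \<le> (1 + (?X \<omega>)\<^sup>2) / 2" using abs_le_young[of 1 "?X \<omega>"] by simp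
        also have "\<dots> \<le> 1 + (?X \<omega>)\<^sup>2" by simp
        finally show "?X \<omega> \<le> 1 + (?X \<omega>)\<^sup>2" .
      qed
      also have "\<dots> = 1 + expectation (\<lambda>\<omega>. (?X \<omega>)\<^sup>2)" using X2(1) by (simp add: prob_space)
      finally show ?thesis using X2(2) by linarith
    qed
    have X2i: "integrable M (\<lambda>\<omega>. 1 + (?X \<omega>)\<^sup>2)" using X2(1) by simp
    have X2m: "(\<lambda>\<omega>. 1 + (?X \<omega>)\<^sup>2) \<in> borel_measurable (F (grid n k))" using Xm by measurable
    have EX2: "expectation (\<lambda>\<omega>. 1 + (?X \<omega>)\<^sup>2) \<le> 1 + C1" using X2 by (simp add: prob_space)
    have i: "integrable M (\<lambda>\<omega>. Z \<omega> * dB n k \<omega> ^ l)"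
      "expectation (\<lambda>\<omega>. Z \<omega> * dB n k \<omega> ^ l) = expectation Z * expectation (\<lambda>\<omega>. dB n k \<omega> ^ l)"
      if "Z \<in> borel_measurable (F (grid n k))" "integrable M Z" for Z l
    proof -
      have p: "(\<lambda>y::real. y ^ l) \<in> borel_measurable borel" by measurable
      from indep_mult[OF grid_nonneg grid_Suc_less that p increment_power_integrable[OF grid_nonneg grid_Suc_less]]
      show "integrable M (\<lambda>\<omega>. Z \<omega> * dB n k \<omega> ^ l)"
        "expectation (\<lambda>\<omega>. Z \<omega> * dB n k \<omega> ^ l) = expectation Z * expectation (\<lambda>\<omega>. dB n k \<omega> ^ l)"
        unfolding dB_def by auto
    qed
    note i1 = i[OF Xm Xi, of 2, unfolded dB_moments(4)]
    note i2 = i[OF X2m X2i, of 2, unfolded dB_moments(4)]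
    note i3 = i[OF X2m X2i, of 4, unfolded dB_moments(5)]
    note i4 = C2(2,3)[OF kT, folded q(4)]
    have eq: "S n k = (\<lambda>\<omega>. ?q * (?X \<omega> * (dB n k \<omega>)\<^sup>2) + (?q ^ 8 / ?q + (R n k \<omega>)\<^sup>2 / ?q)
      + (?q\<^sup>2 * ((1 + (?X \<omega>)\<^sup>2) * (dB n k \<omega>)\<^sup>2) + ((1 + (?X \<omega>)\<^sup>2) * dB n k \<omega> ^ 4) / ?q\<^sup>2))"
      unfolding S_def by (intro ext) (simp only: add_divide_distrib distrib_left times_divide_eq_right mult.left_commute)
    have int: "integrable M (S n k)"
      unfolding eq using i1(1) i2(1) i3(1) i4(1)
      by (intro Bochner_Integration.integrable_add integrable_mult_right integrable_divide integrable_const) auto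
    have "expectation (S n k) = ?q * (expectation ?X * ?h) + (?q ^ 8 / ?q + expectation (\<lambda>\<omega>. (R n k \<omega>)\<^sup>2) / ?q)
      + (?q\<^sup>2 * (expectation (\<lambda>\<omega>. 1 + (?X \<omega>)\<^sup>2) * ?h) + expectation (\<lambda>\<omega>. 1 + (?X \<omega>)\<^sup>2) * (3 * ?h\<^sup>2) / ?q\<^sup>2)"
    proof -
      have "expectation (S n k) = expectation (\<lambda>\<omega>. ?q * (?X \<omega> * (dB n k \<omega>)\<^sup>2)) + (expectation (\<lambda>\<omega>. ?q ^ 8 / ?q) + expectation (\<lambda>\<omega>. (R n k \<omega>)\<^sup>2 / ?q))
      + (expectation (\<lambda>\<omega>. ?q\<^sup>2 * ((1 + (?X \<omega>)\<^sup>2) * (dB n k \<omega>)\<^sup>2)) + expectation (\<lambda>\<omega>. ((1 + (?X \<omega>)\<^sup>2) * dB n k \<omega> ^ 4) / ?q\<^sup>2))"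
        unfolding eq using i1(1) i2(1) i3(1) i4(1)
        by (intro Bochner_Integration.integral_add[THEN trans] arg_cong2[where f="(+)"]
            Bochner_Integration.integrable_add integrable_mult_right integrable_divide integrable_const refl) auto
      then show ?thesis
        unfolding integral_mult_right_zero integral_divide_zero i1(2) i2(2) i3(2) by (simp add: prob_space)
    qed
    also have "\<dots> \<le> ?q * ((1 + C1) * ?h) + (?q * ?h + C2 * ?q * ?h) + (?q * ((1 + C1) * ?h) + (1 + C1) * 3 * (?q * ?h))"
    proof (intro add_mono)
      show "?q * (expectation ?X * ?h) \<le> ?q * ((1 + C1) * ?h)"
        using EX q(1) mesh_pos[of n] by (intro mult_left_mono mult_right_mono) auto
      have q2: "?q\<^sup>2 \<le> ?q" using q(1,2) by (simp add: power2_eq_square mult_left_le)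
      have "?q ^ 8 / ?q = ?q ^ 3 * ?h" unfolding q(3)[symmetric] using q(1) by (simp add: field_simps flip: power_Suc power_add)
      also have "?q ^ 3 \<le> ?q" using q(1,2) power_decreasing[of 1 3 ?q] by simp
      finally show "?q ^ 8 / ?q \<le> ?q * ?h" using mesh_pos[of n] by (simp add: mult_right_mono)
      have "expectation (\<lambda>\<omega>. (R n k \<omega>)\<^sup>2) / ?q \<le> C2 * ?q\<^sup>2 * ?h / ?q"
        using i4(2) q(1) by (intro divide_right_mono) auto
      then show "expectation (\<lambda>\<omega>. (R n k \<omega>)\<^sup>2) / ?q \<le> C2 * ?q * ?h"
        using q(1) by (simp add: power2_eq_square)
      show "?q\<^sup>2 * (expectation (\<lambda>\<omega>. 1 + (?X \<omega>)\<^sup>2) * ?h) \<le> ?q * ((1 + C1) * ?h)"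
        using EX2 q2 q(1) mesh_pos[of n] C1(1) by (intro mult_mono mult_right_mono mult_nonneg_nonneg) auto
      have h2: "?h\<^sup>2 / ?q\<^sup>2 \<le> ?q * ?h"
      proof -
        have "?h\<^sup>2 / ?q\<^sup>2 = ?q\<^sup>2 * ?h"
        proof -
          have "?h = ?q\<^sup>2 * ?q\<^sup>2" using q(3) by (simp add: power_add[symmetric])
          then show ?thesis using q(1) by (simp add: power2_eq_square)
        qed
        then show ?thesis using mult_right_mono[OF q2, of ?h] mesh_pos[of n] by simp
      qed
      have "expectation (\<lambda>\<omega>. 1 + (?X \<omega>)\<^sup>2) * (3 * ?h\<^sup>2) / ?q\<^sup>2 = expectation (\<lambda>\<omega>. 1 + (?X \<omega>)\<^sup>2) * 3 * (?h\<^sup>2 / ?q\<^sup>2)" by simp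
      also have "\<dots> \<le> (1 + C1) * 3 * (?q * ?h)"
        using EX2 h2 C1(1) by (intro mult_mono) auto
      finally show "expectation (\<lambda>\<omega>. 1 + (?X \<omega>)\<^sup>2) * (3 * ?h\<^sup>2) / ?q\<^sup>2 \<le> (1 + C1) * 3 * (?q * ?h)" .
    qed
    also have "\<dots> = (6 + 5 * C1 + C2) * (?q * ?h)" by (simp add: algebra_simps)
    finally show ?thesis using int by simp
  qed
  show thesis by (rule that[of "6 + 5 * C1 + C2"]) (use * C1(1) C2(1) in auto)
qed

end

section \<open>Monotonicity of the difference between the square root and the Brownian motion\<close>

context squared_bessel_process begin

text \<open>The integrand of the martingale part of (B - sqrt (X + \<eta>)) / sqrt \<eta>. Its
  companions \<open>wR\<close> and \<open>wB\<close> are the weights with which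
  \<open>sqrt_step\<close> charges the Euler remainder and the fluctuation of the squared
  increment.\<close>

definition \<kappa> :: "real \<Rightarrow> nat \<Rightarrow> nat \<Rightarrow> 'a \<Rightarrow> real" where
  "\<kappa> \<eta> n k \<omega> = (1 - sqrt (X (grid n k) \<omega>) / sqrt (X (grid n k) \<omega> + \<eta>)) / sqrt \<eta>"

definition wR :: "real \<Rightarrow> nat \<Rightarrow> nat \<Rightarrow> 'a \<Rightarrow> real" where
  "wR \<eta> n k \<omega> = 1 / (sqrt \<eta> * sqrt (X (grid n k) \<omega> + \<eta>))"

definition wB :: "real \<Rightarrow> nat \<Rightarrow> nat \<Rightarrow> 'a \<Rightarrow> real" where
  "wB \<eta> n k \<omega> = X (grid n k) \<omega> / (2 * sqrt \<eta> * sqrt (X (grid n k) \<omega> + \<eta>) ^ 3)"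

lemma weights_adapted:
  "\<kappa> \<eta> n k \<in> borel_measurable (F (grid n k))"
  "wR \<eta> n k \<in> borel_measurable (F (grid n k))"
  "wB \<eta> n k \<in> borel_measurable (F (grid n k))"
  unfolding \<kappa>_def wR_def wB_def using X_adapted[OF grid_nonneg, of k n] by measurable

text \<open>Smoothing pays off here, since sqrt (X + \<eta>) stays above sqrt \<eta>. That the bound
  explodes as \<eta> tends to 0 is harmless, because the mesh is refined first, with \<eta>
  fixed.\<close>

lemma weights_bounded:
  assumes w: "\<omega> \<in> space M" and \<eta>: "\<eta> > 0"
  shows "\<bar>wR \<eta> n k \<omega>\<bar> \<le> 1 / \<eta>" "\<bar>wB \<eta> n k \<omega>\<bar> \<le> 1 / \<eta>"
proof -
  let ?a = "X (grid n k) \<omega>" and ?e = "sqrt \<eta>"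
  define s where "s = sqrt (?a + \<eta>)"
  have a: "?a \<ge> 0" by (rule X_nonneg[OF w grid_nonneg])
  have e: "?e > 0" "?e * ?e = \<eta>" using \<eta> by auto
  have s: "?e \<le> s" "s > 0" "s\<^sup>2 = ?a + \<eta>" using a \<eta> by (auto simp: s_def add_nonneg_pos)
  have p: "\<eta> \<le> ?e * s" using mult_left_mono[OF s(1), of ?e] e by simp
  have "1 / (?e * s) \<le> 1 / \<eta>" using p \<eta> e s by (intro divide_left_mono) auto
  then show 1: "\<bar>wR \<eta> n k \<omega>\<bar> \<le> 1 / \<eta>" using e s unfolding wR_def s_def[symmetric] by simp
  have "?a / (2 * ?e * s ^ 3) \<le> s\<^sup>2 / (2 * ?e * s ^ 3)"
    using s(2,3) e(1) \<eta> by (intro divide_right_mono mult_nonneg_nonneg zero_le_power) auto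
  also have "\<dots> = 1 / (?e * s) / 2" using s(2) by (simp add: power2_eq_square power3_eq_cube)
  also have "\<dots> \<le> 1 / \<eta>" using \<open>1 / (?e * s) \<le> 1 / \<eta>\<close> e s by (simp add: divide_le_eq)
  finally have "?a / (2 * ?e * s ^ 3) \<le> 1 / \<eta>" .
  moreover have "0 \<le> ?a / (2 * ?e * s ^ 3)"
    using a e(1) s(2) by (intro divide_nonneg_nonneg mult_nonneg_nonneg zero_le_power) auto
  ultimately show "\<bar>wB \<eta> n k \<omega>\<bar> \<le> 1 / \<eta>" unfolding wB_def s_def[symmetric] by simp
qed

text \<open>Absolute values surround whole sums and not summands, so that orthogonality stays
  available for the first two. Coefficients before i are zero in order that these sums start at
  index 0.\<close>

definition err :: "real \<Rightarrow> real \<Rightarrow> nat \<Rightarrow> nat \<Rightarrow> nat \<Rightarrow> 'a \<Rightarrow> real" where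
  "err K \<eta> n i j \<omega> = \<bar>\<Sum>k<j. (if i \<le> k then - wR \<eta> n k \<omega> else 0) * R n k \<omega>\<bar>
    + \<bar>\<Sum>k<j. (if i \<le> k then wB \<eta> n k \<omega> else 0) * ((dB n k \<omega>)\<^sup>2 - mesh n)\<bar> + K * (\<Sum>k\<in>{i..<j}. S n k \<omega>)"

text \<open>Both martingale sums have second moment of order
  \<open>(fourth_root_mesh n)\<^sup>2\<close>, so weight \<open>fourth_root_mesh n\<close> in
  \<open>expectation_abs_le\<close> gives that order in mean. The terms \<open>S\<close> have the
  order of the step times \<open>fourth_root_mesh n\<close>, and the steps add up to a bounded
  time.\<close>

lemma err_bound:
  assumes K: "K \<ge> 0" and \<eta>: "\<eta> > 0"
  obtains C where "C \<ge> 0" "\<And>n i j. i \<le> j \<Longrightarrow> grid n j \<le> T \<Longrightarrow> integrable M (err K \<eta> n i j)"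
    "\<And>n i j. i \<le> j \<Longrightarrow> grid n j \<le> T \<Longrightarrow> expectation (err K \<eta> n i j) \<le> C * fourth_root_mesh n"
proof (rule remainder_bound[of T])
  fix C1 :: real
  assume C1: "C1 \<ge> 0"
    "\<And>n j w W Wm. \<lbrakk>grid n j \<le> T; \<And>k. w k \<in> borel_measurable (F (grid n k));
        \<And>k \<omega>. \<omega> \<in> space M \<Longrightarrow> \<bar>w k \<omega>\<bar> \<le> W k; \<And>k. W k \<le> Wm\<rbrakk> \<Longrightarrow>
      integrable M (\<lambda>\<omega>. (\<Sum>k<j. w k \<omega> * R n k \<omega>)\<^sup>2)"
    "\<And>n j w W Wm. \<lbrakk>grid n j \<le> T; \<And>k. w k \<in> borel_measurable (F (grid n k));
        \<And>k \<omega>. \<omega> \<in> space M \<Longrightarrow> \<bar>w k \<omega>\<bar> \<le> W k; \<And>k. W k \<le> Wm\<rbrakk> \<Longrightarrow>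
      expectation (\<lambda>\<omega>. (\<Sum>k<j. w k \<omega> * R n k \<omega>)\<^sup>2) \<le> (\<Sum>k<j. (W k)\<^sup>2) * (C1 * sqrt (mesh n) * mesh n)"
  obtain C2 where C2: "C2 \<ge> 0" "\<And>n k. grid n (Suc k) \<le> T \<Longrightarrow> integrable M (S n k)"
    "\<And>n k. grid n (Suc k) \<le> T \<Longrightarrow> expectation (S n k) \<le> C2 * (fourth_root_mesh n * mesh n)"
    using S_bound[of T] by blast
  define T' where "T' = max T 0"
  define c where "c = (1 / \<eta>)\<^sup>2"
  have c: "c \<ge> 0" by (simp add: c_def)
  define C where "C = (1 + c * C1 * T') / 2 + (1 + 2 * c * T') / 2 + K * (C2 * T')"
  have T'0: "T' \<ge> 0" by (simp add: T'_def)
  have C0: "C \<ge> 0" using C1(1) C2(1) K c T'0 by (simp add: C_def)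
  have *: "integrable M (err K \<eta> n i j) \<and> expectation (err K \<eta> n i j) \<le> C * fourth_root_mesh n"
    if ij: "i \<le> j" and jT: "grid n j \<le> T" for n i j
  proof -
    let ?q = "fourth_root_mesh n"
    note q = fourth_root_mesh[of n]
    have jT': "grid n j \<le> T'" using jT by (simp add: T'_def)
    let ?w = "\<lambda>k \<omega>. if i \<le> k then - wR \<eta> n k \<omega> else 0"
    let ?v = "\<lambda>k \<omega>. if i \<le> k then wB \<eta> n k \<omega> else 0"
    have wm: "?w k \<in> borel_measurable (F (grid n k))" for k
      using weights_adapted(2)[of \<eta> n k] by (cases "i \<le> k") simp_all
    have vm: "?v k \<in> borel_measurable (F (grid n k))" for k
      using weights_adapted(3)[of \<eta> n k] by (cases "i \<le> k") simp_all
    have wb: "\<bar>?w k \<omega>\<bar> \<le> 1 / \<eta>" "\<bar>?v k \<omega>\<bar> \<le> 1 / \<eta>" if "\<omega> \<in> space M" for k \<omega>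
      using weights_bounded[OF that \<eta>] \<eta> by auto
    let ?f1 = "\<lambda>\<omega>. \<Sum>k<j. ?w k \<omega> * R n k \<omega>"
    let ?f2 = "\<lambda>\<omega>. \<Sum>k<j. ?v k \<omega> * ((dB n k \<omega>)\<^sup>2 - mesh n)"
    have f1m: "?f1 \<in> borel_measurable M"
      using measurable_F_M[OF wm] R_measurable by (intro borel_measurable_sum borel_measurable_times) auto
    have f2m: "?f2 \<in> borel_measurable M"
      using measurable_F_M[OF vm] dB_measurable
      by (intro borel_measurable_sum borel_measurable_times borel_measurable_diff borel_measurable_power) auto
    have f1: "integrable M (\<lambda>\<omega>. (?f1 \<omega>)\<^sup>2)" "expectation (\<lambda>\<omega>. (?f1 \<omega>)\<^sup>2) \<le> c * C1 * T' * ?q\<^sup>2"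
    proof -
      show "integrable M (\<lambda>\<omega>. (?f1 \<omega>)\<^sup>2)" by (rule C1(2)[OF jT wm wb(1) order_refl])
      have "expectation (\<lambda>\<omega>. (?f1 \<omega>)\<^sup>2) \<le> (\<Sum>k<j. (1 / \<eta>)\<^sup>2) * (C1 * sqrt (mesh n) * mesh n)"
        by (rule C1(3)[OF jT wm wb(1) order_refl])
      also have "\<dots> = c * C1 * ?q\<^sup>2 * grid n j" by (simp add: c_def q(4))
      also have "\<dots> \<le> c * C1 * ?q\<^sup>2 * T'" using jT' c C1(1) by (intro mult_left_mono) auto
      finally show "expectation (\<lambda>\<omega>. (?f1 \<omega>)\<^sup>2) \<le> c * C1 * T' * ?q\<^sup>2" by (simp add: mult_ac)
    qed
    have f2: "integrable M (\<lambda>\<omega>. (?f2 \<omega>)\<^sup>2)" "expectation (\<lambda>\<omega>. (?f2 \<omega>)\<^sup>2) \<le> 2 * c * T' * ?q\<^sup>2"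
    proof -
      show "integrable M (\<lambda>\<omega>. (?f2 \<omega>)\<^sup>2)" by (rule dB_sum_square_centered(1)[OF vm wb(2)])
      have v2: "expectation (\<lambda>\<omega>. (?v k \<omega>)\<^sup>2) \<le> c" for k
      proof -
        have b: "(?v k \<omega>)\<^sup>2 \<le> c" if "\<omega> \<in> space M" for \<omega>
          using power_mono[OF wb(2)[OF that] abs_ge_zero, of k 2] by (simp add: c_def)
        have "integrable M (\<lambda>\<omega>. (?v k \<omega>)\<^sup>2)"
          using b measurable_F_M[OF vm[of k]] by (intro integrable_const_bound[of _ c]) auto
        then have "expectation (\<lambda>\<omega>. (?v k \<omega>)\<^sup>2) \<le> expectation (\<lambda>\<omega>. c)"
          using b by (intro integral_mono) auto
        then show ?thesis by (simp add: prob_space)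
      qed
      have "expectation (\<lambda>\<omega>. (?f2 \<omega>)\<^sup>2) = (\<Sum>k<j. expectation (\<lambda>\<omega>. (?v k \<omega>)\<^sup>2) * (2 * (mesh n)\<^sup>2))"
        by (rule dB_sum_square_centered(2)[OF vm wb(2)])
      also have "\<dots> \<le> (\<Sum>k<j. c * (2 * (mesh n)\<^sup>2))" using v2 by (intro sum_mono mult_right_mono) auto
      also have "\<dots> = 2 * c * mesh n * grid n j" by (simp add: power2_eq_square)
      also have "\<dots> \<le> 2 * c * ?q\<^sup>2 * T'"
      proof (intro mult_mono)
        show "mesh n \<le> ?q\<^sup>2" unfolding q(3)[symmetric] using q(1,2) by (intro power_decreasing) auto
      qed (use jT' c grid_nonneg[of j n] mesh_pos[of n] in auto)
      finally show "expectation (\<lambda>\<omega>. (?f2 \<omega>)\<^sup>2) \<le> 2 * c * T' * ?q\<^sup>2" by (simp add: mult_ac)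
    qed
    have div: "a * ?q\<^sup>2 / ?q = a * ?q" for a using q(1) by (simp add: power2_eq_square)
    note g1 = expectation_abs_le[OF f1m f1 q(1), unfolded div]
    note g2 = expectation_abs_le[OF f2m f2 q(1), unfolded div]
    have kT: "grid n (Suc k) \<le> T" if "k \<in> {i..<j}" for k
      using grid_le[of "Suc k" j n] that jT by (simp del: of_nat_Suc)
    have S: "integrable M (\<lambda>\<omega>. \<Sum>k\<in>{i..<j}. S n k \<omega>)"
      using C2(2)[OF kT] by (intro Bochner_Integration.integrable_sum) auto
    have "expectation (\<lambda>\<omega>. \<Sum>k\<in>{i..<j}. S n k \<omega>) = (\<Sum>k\<in>{i..<j}. expectation (S n k))"
      using C2(2)[OF kT] by (intro Bochner_Integration.integral_sum) auto
    also have "\<dots> \<le> (\<Sum>k\<in>{i..<j}. C2 * (?q * mesh n))" using C2(3)[OF kT] by (intro sum_mono) auto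
    also have "\<dots> = (C2 * ?q) * (real (j - i) * mesh n)" by simp
    also have "\<dots> \<le> (C2 * ?q) * T'"
    proof (rule mult_left_mono)
      have "real (j - i) * mesh n \<le> grid n j" by (rule grid_le) simp
      then show "real (j - i) * mesh n \<le> T'" using jT' by linarith
    qed (use C2(1) q(1) in auto)
    finally have ES: "expectation (\<lambda>\<omega>. \<Sum>k\<in>{i..<j}. S n k \<omega>) \<le> C2 * T' * ?q" by (simp add: mult_ac)
    have int: "integrable M (err K \<eta> n i j)"
      unfolding err_def using g1(1) g2(1) S by (intro Bochner_Integration.integrable_add integrable_mult_right) auto
    have "expectation (err K \<eta> n i j) = expectation (\<lambda>\<omega>. \<bar>?f1 \<omega>\<bar>) + expectation (\<lambda>\<omega>. \<bar>?f2 \<omega>\<bar>) + K * expectation (\<lambda>\<omega>. \<Sum>k\<in>{i..<j}. S n k \<omega>)"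
    proof -
      have "expectation (err K \<eta> n i j) = expectation (\<lambda>\<omega>. \<bar>?f1 \<omega>\<bar> + \<bar>?f2 \<omega>\<bar>) + expectation (\<lambda>\<omega>. K * (\<Sum>k\<in>{i..<j}. S n k \<omega>))"
        unfolding err_def using g1(1) g2(1) S
        by (intro Bochner_Integration.integral_add Bochner_Integration.integrable_add integrable_mult_right) auto
      also have "expectation (\<lambda>\<omega>. \<bar>?f1 \<omega>\<bar> + \<bar>?f2 \<omega>\<bar>) = expectation (\<lambda>\<omega>. \<bar>?f1 \<omega>\<bar>) + expectation (\<lambda>\<omega>. \<bar>?f2 \<omega>\<bar>)"
        using g1(1) g2(1) by (rule Bochner_Integration.integral_add)
      finally show ?thesis unfolding integral_mult_right_zero .
    qed
    also have "\<dots> \<le> (?q + c * C1 * T' * ?q) / 2 + (?q + 2 * c * T' * ?q) / 2 + K * (C2 * T' * ?q)"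
      using g1(2) g2(2) mult_left_mono[OF ES K] by (rule add_mono[OF add_mono])
    also have "\<dots> = C * ?q" by (simp add: C_def field_simps)
    finally show ?thesis using int by simp
  qed
  show thesis by (rule that[OF C0]) (use * in auto)
qed

text \<open>By \<open>sqrt_step\<close> the difference divided by \<open>sqrt \<eta>\<close> is at
  most an exponent Q for which \<open>exp (Q \<omega>)\<close> has mean 1, plus \<open>err\<close>.
  Each receives half of \<open>\<theta> / sqrt \<eta>\<close>: Markov's inequality for the
  exponential yields the claimed bound, and for \<open>err\<close> a bound that vanishes with the
  mesh, on which the event itself does not depend.\<close>

lemma sqrt_increment_prob:
  assumes ij: "i \<le> j" and \<eta>: "\<eta> > 0" and \<theta>: "\<theta> > 0"
  shows "prob {\<omega> \<in> space M. \<theta> \<le> (B (grid N j) \<omega> - B (grid N i) \<omega>)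
      - (sqrt (X (grid N j) \<omega> + \<eta>) - sqrt (X (grid N i) \<omega> + \<eta>))} \<le> exp (- (\<theta> / (2 * sqrt \<eta>)))"
    (is "prob {\<omega> \<in> space M. \<theta> \<le> ?D \<omega>} \<le> _")
proof (rule sqrt_step[OF \<eta> \<delta>_ge])
  fix K :: real
  assume K: "K \<ge> 0"
    "\<And>a b z R q. \<lbrakk>a \<ge> 0; b \<ge> 0; 0 < q; q \<le> 1; b = a + 2 * sqrt a * z + \<delta> * q ^ 4 + 2 * R\<rbrakk> \<Longrightarrow>
      (z - (sqrt (b + \<eta>) - sqrt (a + \<eta>))) / sqrt \<eta>
      \<le> (1 - sqrt a / sqrt (a + \<eta>)) / sqrt \<eta> * z - ((1 - sqrt a / sqrt (a + \<eta>)) / sqrt \<eta>)\<^sup>2 * q ^ 4 / 2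
        - 1 / (sqrt \<eta> * sqrt (a + \<eta>)) * R + a / (2 * sqrt \<eta> * sqrt (a + \<eta>) ^ 3) * (z\<^sup>2 - q ^ 4)
        + K * (q * (a * z\<^sup>2) + (q ^ 8 + R\<^sup>2) / q + (1 + a\<^sup>2) * (q\<^sup>2 * z\<^sup>2 + z ^ 4 / q\<^sup>2))"
  obtain C where C: "C \<ge> 0" "\<And>n i' j'. i' \<le> j' \<Longrightarrow> grid n j' \<le> grid N j \<Longrightarrow> integrable M (err K \<eta> n i' j')"
    "\<And>n i' j'. i' \<le> j' \<Longrightarrow> grid n j' \<le> grid N j \<Longrightarrow> expectation (err K \<eta> n i' j') \<le> C * fourth_root_mesh n"
    using err_bound[OF K(1) \<eta>, of "grid N j"] by blast
  define u where "u = \<theta> / (2 * sqrt \<eta>)"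
  have u: "u > 0" using \<theta> \<eta> by (simp add: u_def)
  have step: "(dB n k \<omega> - (sqrt (X (grid n (Suc k)) \<omega> + \<eta>) - sqrt (X (grid n k) \<omega> + \<eta>))) / sqrt \<eta>
    \<le> \<kappa> \<eta> n k \<omega> * dB n k \<omega> - (\<kappa> \<eta> n k \<omega>)\<^sup>2 * mesh n / 2
      - wR \<eta> n k \<omega> * R n k \<omega> + wB \<eta> n k \<omega> * ((dB n k \<omega>)\<^sup>2 - mesh n) + K * S n k \<omega>"
    if w: "\<omega> \<in> space M" and eq: "\<forall>t\<ge>0. X t \<omega> = x + 2 * I t \<omega> + \<delta> * t" for n k \<omega>
  proof -
    note q = fourth_root_mesh[of n]
    have "X (grid n (Suc k)) \<omega> = X (grid n k) \<omega> + 2 * sqrt (X (grid n k) \<omega>) * dB n k \<omega> + \<delta> * fourth_root_mesh n ^ 4 + 2 * R n k \<omega>"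
    proof -
      have "X (grid n (Suc k)) \<omega> - X (grid n k) \<omega> = 2 * (I (grid n (Suc k)) \<omega> - I (grid n k) \<omega>) + \<delta> * (grid n (Suc k) - grid n k)"
        using eq grid_nonneg[of k n] grid_nonneg[of "Suc k" n] by (simp add: algebra_simps del: of_nat_Suc)
      then show ?thesis unfolding grid_Suc_diff R_def q(3) by (simp add: algebra_simps)
    qed
    from K(2)[OF X_nonneg[OF w grid_nonneg] X_nonneg[OF w grid_nonneg] q(1,2) this]
    show ?thesis unfolding q(3) \<kappa>_def wR_def wB_def S_def .
  qed
  have Dm: "?D \<in> borel_measurable M"
    using B_measurable[OF grid_nonneg] X_measurable[OF grid_nonneg]
    by (intro borel_measurable_diff borel_measurable_sqrt borel_measurable_add) auto
  have bound: "prob {\<omega> \<in> space M. \<theta> \<le> ?D \<omega>} \<le> exp (- u) + C * fourth_root_mesh n / u" if n: "n \<ge> N" for n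
  proof -
    let ?p = "2 ^ (n - N) :: nat"
    define i' where "i' = i * ?p"
    define j' where "j' = j * ?p"
    have ij': "i' \<le> j'" using ij by (simp add: i'_def j'_def)
    have ref: "grid n i' = grid N i" "grid n j' = grid N j" using grid_refine[OF n] by (simp_all add: i'_def j'_def)
    define Q where "Q \<omega> = (\<Sum>k\<in>{i'..<j'}. \<kappa> \<eta> n k \<omega> * dB n k \<omega> - (\<kappa> \<eta> n k \<omega>)\<^sup>2 * mesh n / 2)" for \<omega>
    let ?E = "err K \<eta> n i' j'"
    have Ei: "integrable M ?E" "expectation ?E \<le> C * fourth_root_mesh n"
      by (rule C(2)[OF ij' eq_refl[OF ref(2)]], rule C(3)[OF ij' eq_refl[OF ref(2)]])
    have Em: "?E \<in> borel_measurable M" using Ei(1) by auto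
    have Qm: "Q \<in> borel_measurable M"
      unfolding Q_def using measurable_F_M[OF weights_adapted(1)] dB_measurable
      by (intro borel_measurable_sum borel_measurable_diff borel_measurable_times borel_measurable_divide borel_measurable_power) auto
    have split: "(\<Sum>k<j'. (if i' \<le> k then f k else 0) * g k) = (\<Sum>k\<in>{i'..<j'}. f k * g k)" for f g :: "nat \<Rightarrow> real"
    proof -
      have "{..<j'} \<inter> {k. i' \<le> k} = {i'..<j'}" by auto
      then have "(\<Sum>k\<in>{i'..<j'}. f k * g k) = (\<Sum>k<j'. if i' \<le> k then f k * g k else 0)"
        using sum.inter_restrict[of "{..<j'}" "\<lambda>k. f k * g k" "{k. i' \<le> k}"] by simp
      also have "\<dots> = (\<Sum>k<j'. (if i' \<le> k then f k else 0) * g k)" by (rule sum.cong) simp_all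
      finally show ?thesis by simp
    qed
    have AE: "AE \<omega> in M. ?D \<omega> / sqrt \<eta> \<le> Q \<omega> + ?E \<omega>"
      using X_eq AE_space
    proof eventually_elim
      case (elim \<omega>)
      let ?g = "\<lambda>k. B (grid n k) \<omega> - sqrt (X (grid n k) \<omega> + \<eta>)"
      have "?D \<omega> = ?g j' - ?g i'" unfolding ref by simp
      also have "\<dots> = (\<Sum>k\<in>{i'..<j'}. ?g (Suc k) - ?g k)" by (rule sum_Suc_diff'[OF ij', symmetric])
      finally have D: "?D \<omega> = (\<Sum>k\<in>{i'..<j'}. ?g (Suc k) - ?g k)" .
      have "?D \<omega> / sqrt \<eta> = (\<Sum>k\<in>{i'..<j'}. (dB n k \<omega> - (sqrt (X (grid n (Suc k)) \<omega> + \<eta>) - sqrt (X (grid n k) \<omega> + \<eta>))) / sqrt \<eta>)"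
        unfolding D sum_divide_distrib
      proof (rule sum.cong[OF refl])
        fix k
        have "?g (Suc k) - ?g k = dB n k \<omega> - (sqrt (X (grid n (Suc k)) \<omega> + \<eta>) - sqrt (X (grid n k) \<omega> + \<eta>))"
          unfolding dB_def by linarith
        then show "(?g (Suc k) - ?g k) / sqrt \<eta> = (dB n k \<omega> - (sqrt (X (grid n (Suc k)) \<omega> + \<eta>) - sqrt (X (grid n k) \<omega> + \<eta>))) / sqrt \<eta>"
          by (rule arg_cong)
      qed
      also have "\<dots> \<le> (\<Sum>k\<in>{i'..<j'}. \<kappa> \<eta> n k \<omega> * dB n k \<omega> - (\<kappa> \<eta> n k \<omega>)\<^sup>2 * mesh n / 2
          - wR \<eta> n k \<omega> * R n k \<omega> + wB \<eta> n k \<omega> * ((dB n k \<omega>)\<^sup>2 - mesh n) + K * S n k \<omega>)"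
        by (intro sum_mono step elim)
      also have "\<dots> = Q \<omega> + (\<Sum>k\<in>{i'..<j'}. - wR \<eta> n k \<omega> * R n k \<omega>) + (\<Sum>k\<in>{i'..<j'}. wB \<eta> n k \<omega> * ((dB n k \<omega>)\<^sup>2 - mesh n))
          + K * (\<Sum>k\<in>{i'..<j'}. S n k \<omega>)"
        unfolding Q_def sum_distrib_left sum.distrib[symmetric] by (intro sum.cong refl) simp
      also have "\<dots> \<le> Q \<omega> + ?E \<omega>"
        unfolding err_def split[of "\<lambda>k. - wR \<eta> n k \<omega>" "\<lambda>k. R n k \<omega>"] split[of "\<lambda>k. wB \<eta> n k \<omega>" "\<lambda>k. (dB n k \<omega>)\<^sup>2 - mesh n"]
        by linarith
      finally show ?case .
    qed
    have "(\<integral>\<^sup>+\<omega>. 1 * ennreal (exp (\<Sum>k\<in>{i'..<j'}. \<kappa> \<eta> n k \<omega> * (B (real (Suc k) * mesh n) \<omega> - B (real k * mesh n) \<omega>)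
        - (\<kappa> \<eta> n k \<omega>)\<^sup>2 * mesh n / 2)) \<partial>M) = (\<integral>\<^sup>+\<omega>. 1 \<partial>M)"
      by (rule exponential_sum[OF mesh_pos weights_adapted(1) _ ij']) simp
    then have expQ: "(\<integral>\<^sup>+\<omega>. ennreal (exp (Q \<omega>)) \<partial>M) = 1"
      by (simp add: Q_def dB_def emeasure_space_1)
    have PQ: "prob {\<omega> \<in> space M. u \<le> Q \<omega>} \<le> exp (- u)"
    proof -
      have A: "{\<omega> \<in> space M. u \<le> Q \<omega>} \<in> events" using Qm by measurable
      have "emeasure M {\<omega> \<in> space M. u \<le> Q \<omega>} = (\<integral>\<^sup>+\<omega>. indicator {\<omega> \<in> space M. u \<le> Q \<omega>} \<omega> \<partial>M)"
        by (rule nn_integral_indicator[OF A, symmetric])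
      also have "\<dots> \<le> (\<integral>\<^sup>+\<omega>. ennreal (exp (- u)) * ennreal (exp (Q \<omega>)) \<partial>M)"
      proof (rule nn_integral_mono)
        fix \<omega>
        show "indicator {\<omega> \<in> space M. u \<le> Q \<omega>} \<omega> \<le> ennreal (exp (- u)) * ennreal (exp (Q \<omega>))"
        proof (cases "\<omega> \<in> {\<omega> \<in> space M. u \<le> Q \<omega>}")
          case True
          then have "1 \<le> exp (- u) * exp (Q \<omega>)" by (simp add: mult_exp_exp)
          then have "ennreal 1 \<le> ennreal (exp (- u) * exp (Q \<omega>))" by (rule ennreal_leI)
          then show ?thesis using True by (simp add: ennreal_mult')
        qed simp
      qed
      also have "\<dots> = ennreal (exp (- u)) * (\<integral>\<^sup>+\<omega>. ennreal (exp (Q \<omega>)) \<partial>M)"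
        using Qm by (intro nn_integral_cmult) measurable
      finally show ?thesis unfolding expQ by (simp add: emeasure_eq_measure)
    qed
    have PE: "prob {\<omega> \<in> space M. u \<le> ?E \<omega>} \<le> C * fourth_root_mesh n / u"
    proof -
      have S0: "S n k \<omega> \<ge> 0" if "\<omega> \<in> space M" for k \<omega>
        using X_nonneg[OF that grid_nonneg[of k n]] fourth_root_mesh(1)[of n] by (auto simp: S_def)
      have "AE \<omega> in M. 0 \<le> ?E \<omega>"
        unfolding err_def using K(1) S0 by (intro AE_I2 add_nonneg_nonneg mult_nonneg_nonneg sum_nonneg) auto
      from integral_Markov_inequality_measure[OF Ei(1) sets.empty_sets this u]
      have "prob {\<omega> \<in> space M. u \<le> ?E \<omega>} \<le> expectation ?E / u" by simp
      also have "\<dots> \<le> C * fourth_root_mesh n / u" using Ei(2) u by (intro divide_right_mono) auto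
      finally show ?thesis .
    qed
    have "prob {\<omega> \<in> space M. \<theta> \<le> ?D \<omega>} \<le> prob ({\<omega> \<in> space M. u \<le> Q \<omega>} \<union> {\<omega> \<in> space M. u \<le> ?E \<omega>})"
    proof (rule finite_measure_mono_AE)
      show "AE \<omega> in M. \<omega> \<in> {\<omega> \<in> space M. \<theta> \<le> ?D \<omega>} \<longrightarrow> \<omega> \<in> {\<omega> \<in> space M. u \<le> Q \<omega>} \<union> {\<omega> \<in> space M. u \<le> ?E \<omega>}"
        using AE
      proof eventually_elim
        case (elim \<omega>)
        show ?case
        proof
          assume "\<omega> \<in> {\<omega> \<in> space M. \<theta> \<le> ?D \<omega>}"
          then have w: "\<omega> \<in> space M" and "\<theta> / sqrt \<eta> \<le> ?D \<omega> / sqrt \<eta>"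
            using \<eta> by (auto intro: divide_right_mono)
          moreover have "\<theta> / sqrt \<eta> = u + u" by (simp add: u_def)
          ultimately have "u + u \<le> Q \<omega> + ?E \<omega>" using elim by linarith
          then have "u \<le> Q \<omega> \<or> u \<le> ?E \<omega>" by linarith
          then show "\<omega> \<in> {\<omega> \<in> space M. u \<le> Q \<omega>} \<union> {\<omega> \<in> space M. u \<le> ?E \<omega>}" using w by blast
        qed
      qed
    qed (use Qm Em in measurable)
    also have "\<dots> \<le> prob {\<omega> \<in> space M. u \<le> Q \<omega>} + prob {\<omega> \<in> space M. u \<le> ?E \<omega>}"
      by (rule measure_Un_le) (use Qm Em in measurable)
    finally show ?thesis using PQ PE by linarith
  qed
  have "(\<lambda>n. exp (- u) + C * fourth_root_mesh n / u) \<longlonglongrightarrow> exp (- u) + C * 0 / u"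
    using u by (intro tendsto_intros fourth_root_mesh_tendsto_0) auto
  then have "prob {\<omega> \<in> space M. \<theta> \<le> ?D \<omega>} \<le> exp (- u) + C * 0 / u"
    by (rule LIMSEQ_le_const) (use bound in blast)
  then show ?thesis by (simp add: u_def)
qed

text \<open>The bound of the preceding lemma tends to \<open>0\<close> with \<open>\<eta>\<close>.\<close>

lemma sqrt_increment_grid:
  assumes ij: "i \<le> j"
  shows "AE \<omega> in M. B (grid N j) \<omega> - B (grid N i) \<omega> \<le> sqrt (X (grid N j) \<omega>) - sqrt (X (grid N i) \<omega>)"
proof -
  let ?D = "\<lambda>\<omega>. (B (grid N j) \<omega> - B (grid N i) \<omega>) - (sqrt (X (grid N j) \<omega>) - sqrt (X (grid N i) \<omega>))"
  have Dm: "?D \<in> borel_measurable M"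
    using B_measurable[OF grid_nonneg] X_measurable[OF grid_nonneg]
    by (intro borel_measurable_diff borel_measurable_sqrt) auto
  have z: "prob {\<omega> \<in> space M. 2 * \<theta> \<le> ?D \<omega>} = 0" if \<theta>: "\<theta> > 0" for \<theta>
  proof -
    have b: "prob {\<omega> \<in> space M. 2 * \<theta> \<le> ?D \<omega>} \<le> exp (- (\<theta> / 2 * real n))" if n: "n \<ge> nat \<lceil>1 / \<theta>\<rceil> + 1" for n
    proof -
      \<comment> \<open>The choice \<open>\<eta> = e\<^sup>2\<close> gives
        \<open>sqrt \<eta> = e\<close>. Removing \<eta> from the roots costs at most
        \<open>e \<le> \<theta>\<close>, which is the reason for the threshold
        \<open>2 * \<theta>\<close>.\<close>
      define e where "e = 1 / real n"
      have n0: "real n > 0" using n by simp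
      have "1 / \<theta> \<le> real n" using n by linarith
      then have e: "e > 0" "e \<le> \<theta>" using \<theta> n0 by (auto simp: e_def field_simps)
      have se: "sqrt (e\<^sup>2) = e" using e by simp
      have "{\<omega> \<in> space M. 2 * \<theta> \<le> ?D \<omega>} \<subseteq> {\<omega> \<in> space M. \<theta> \<le> (B (grid N j) \<omega> - B (grid N i) \<omega>)
        - (sqrt (X (grid N j) \<omega> + e\<^sup>2) - sqrt (X (grid N i) \<omega> + e\<^sup>2))}"
      proof safe
        fix \<omega> assume w: "\<omega> \<in> space M" and d: "2 * \<theta> \<le> ?D \<omega>"
        have "sqrt (X (grid N j) \<omega> + e\<^sup>2) \<le> sqrt (X (grid N j) \<omega>) + e"
          using sqrt_add_le_add_sqrt[OF X_nonneg[OF w grid_nonneg[of j N]], of "e\<^sup>2"] se by simp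
        moreover have "sqrt (X (grid N i) \<omega>) \<le> sqrt (X (grid N i) \<omega> + e\<^sup>2)" by simp
        ultimately show "\<theta> \<le> (B (grid N j) \<omega> - B (grid N i) \<omega>)
          - (sqrt (X (grid N j) \<omega> + e\<^sup>2) - sqrt (X (grid N i) \<omega> + e\<^sup>2))"
          using d e by linarith
      qed
      then have "prob {\<omega> \<in> space M. 2 * \<theta> \<le> ?D \<omega>} \<le> prob {\<omega> \<in> space M. \<theta> \<le> (B (grid N j) \<omega> - B (grid N i) \<omega>)
        - (sqrt (X (grid N j) \<omega> + e\<^sup>2) - sqrt (X (grid N i) \<omega> + e\<^sup>2))}"
      proof (rule finite_measure_mono)
        have "(\<lambda>\<omega>. (B (grid N j) \<omega> - B (grid N i) \<omega>) - (sqrt (X (grid N j) \<omega> + e\<^sup>2) - sqrt (X (grid N i) \<omega> + e\<^sup>2))) \<in> borel_measurable M"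
          using B_measurable[OF grid_nonneg] X_measurable[OF grid_nonneg]
          by (intro borel_measurable_diff borel_measurable_sqrt borel_measurable_add) auto
        then show "{\<omega> \<in> space M. \<theta> \<le> (B (grid N j) \<omega> - B (grid N i) \<omega>)
          - (sqrt (X (grid N j) \<omega> + e\<^sup>2) - sqrt (X (grid N i) \<omega> + e\<^sup>2))} \<in> events" by measurable
      qed
      also have "\<dots> \<le> exp (- (\<theta> / (2 * sqrt (e\<^sup>2))))"
        using e by (intro sqrt_increment_prob[OF ij _ \<theta>]) simp
      also have "\<theta> / (2 * sqrt (e\<^sup>2)) = \<theta> / 2 * real n" unfolding se by (simp add: e_def)
      finally show ?thesis .
    qed
    have "filterlim (\<lambda>n. \<theta> / 2 * real n) at_top sequentially"
      using \<theta> by (intro filterlim_tendsto_pos_mult_at_top[OF tendsto_const _ filterlim_real_sequentially]) auto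
    then have "(\<lambda>n. exp (- (\<theta> / 2 * real n))) \<longlonglongrightarrow> 0"
      by (intro filterlim_compose[OF exp_at_bot] filterlim_compose[OF filterlim_uminus_at_bot_at_top])
    then have "prob {\<omega> \<in> space M. 2 * \<theta> \<le> ?D \<omega>} \<le> 0"
      by (rule LIMSEQ_le_const) (use b in blast)
    then show ?thesis by (simp add: measure_le_0_iff)
  qed
  have "AE \<omega> in M. \<forall>n. \<not> 2 * (1 / real (Suc n)) \<le> ?D \<omega>"
  proof (subst AE_all_countable, intro allI)
    fix n
    have s: "{\<omega> \<in> space M. 2 * (1 / real (Suc n)) \<le> ?D \<omega>} \<in> events" using Dm by measurable
    have "prob {\<omega> \<in> space M. 2 * (1 / real (Suc n)) \<le> ?D \<omega>} = 0" by (rule z) simp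
    then show "AE \<omega> in M. \<not> 2 * (1 / real (Suc n)) \<le> ?D \<omega>"
      using prob_Collect_eq_0[OF s] by simp
  qed
  then show ?thesis
  proof eventually_elim
    case (elim \<omega>)
    have "\<not> 0 < ?D \<omega>"
    proof
      assume "0 < ?D \<omega>"
      then obtain n where "inverse (real (Suc n)) < ?D \<omega> / 2" using reals_Archimedean[of "?D \<omega> / 2"] by auto
      then have "2 * (1 / real (Suc n)) \<le> ?D \<omega>" by (simp add: inverse_eq_divide)
      then show False using elim by blast
    qed
    then show ?case by linarith
  qed
qed

text \<open>The countably many pairs of grid points share one null set, rounding both times down to
  the grid preserves their order, and continuity of the paths of B and X does the rest.\<close>

lemma sqrt_increment:
  "AE \<omega> in M. \<forall>s t. 0 \<le> s \<and> s \<le> t \<longrightarrow> B t \<omega> - B s \<omega> \<le> sqrt (X t \<omega>) - sqrt (X s \<omega>)"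
proof -
  have "AE \<omega> in M. \<forall>N i j. i \<le> j \<longrightarrow> B (grid N j) \<omega> - B (grid N i) \<omega> \<le> sqrt (X (grid N j) \<omega>) - sqrt (X (grid N i) \<omega>)"
    unfolding AE_all_countable using sqrt_increment_grid by auto
  then show ?thesis using AE_space
  proof eventually_elim
    case (elim \<omega>)
    show ?case
    proof (intro allI impI)
      fix s t :: real assume st: "0 \<le> s \<and> s \<le> t"
      let ?s = "\<lambda>N. grid N (nat \<lfloor>s * 2 ^ N\<rfloor>)" and ?t = "\<lambda>N. grid N (nat \<lfloor>t * 2 ^ N\<rfloor>)"
      have lim: "(\<lambda>N. f (grid N (nat \<lfloor>u * 2 ^ N\<rfloor>))) \<longlonglongrightarrow> f u" if "continuous_on {0..} f" "0 \<le> u"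
        for f :: "real \<Rightarrow> real" and u
        by (rule continuous_on_tendsto_compose[OF that(1) grid_floor[OF that(2)]])
           (simp only: atLeast_iff that grid_nonneg eventually_True)+
      note B = lim[OF B_cont[OF elim(2)]] and X = lim[OF X_cont[OF elim(2)]]
      have s0: "0 \<le> s" and t0: "0 \<le> t" using st by auto
      have le: "B (?t N) \<omega> - B (?s N) \<omega> \<le> sqrt (X (?t N) \<omega>) - sqrt (X (?s N) \<omega>)" for N
      proof -
        have "nat \<lfloor>s * 2 ^ N\<rfloor> \<le> nat \<lfloor>t * 2 ^ N\<rfloor>" using st by (intro nat_mono floor_mono mult_right_mono) auto
        then show ?thesis using elim(1) by blast
      qed
      show "B t \<omega> - B s \<omega> \<le> sqrt (X t \<omega>) - sqrt (X s \<omega>)"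
        by (rule LIMSEQ_le[OF tendsto_diff[OF B[OF t0] B[OF s0]]
              tendsto_diff[OF tendsto_real_sqrt[OF X[OF t0]] tendsto_real_sqrt[OF X[OF s0]]]])
           (use le in blast)
    qed
  qed
qed

end

section \<open>The integral test along geometric sequences\<close>

lemma H_infinityE:
  assumes "h \<in> H_infinity"
  obtains \<beta> c where "\<beta> > 1" "c > 0" "\<And>t. t > 0 \<Longrightarrow> h t > 0" "\<And>s t. 0 < s \<Longrightarrow> s \<le> t \<Longrightarrow> h s \<le> h t"
    "\<And>t. t > \<beta> \<Longrightarrow> c \<le> h t / t"
proof -
  from assms obtain \<beta> where b: "\<beta> > 1" "bdd_above ((\<lambda>t. t / h t) ` {\<beta><..})" "mono_on {0<..} h" "\<And>t. t > 0 \<Longrightarrow> h t > 0"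
    by (auto simp: H_infinity_def)
  obtain K where K: "\<And>t. t > \<beta> \<Longrightarrow> t / h t \<le> K" using b(2) unfolding bdd_above_def by auto
  show thesis
  \<comment> \<open>The maximum keeps the denominator positive whatever upper bound K was
    obtained.\<close>
  proof (rule that[of \<beta> "1 / max 1 K"])
    show "h s \<le> h t" if "0 < s" "s \<le> t" for s t using that b(3) by (auto intro: mono_onD)
    fix t assume t: "t > \<beta>"
    then have pos: "t > 0" "h t > 0" using b(1) b(4)[of t] by auto
    have "t / h t \<le> max 1 K" using K[OF t] by simp
    then have "t \<le> max 1 K * h t" using pos by (simp add: divide_le_eq)
    then show "1 / max 1 K \<le> h t / t" using pos by (simp add: divide_le_eq le_divide_eq mult.commute)
  qed (use b in auto)
qed

lemma power_interval_family:
  fixes q :: real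
  assumes q: "q > 1"
  shows "disjoint_family (\<lambda>n. {q ^ (m + n)<..q ^ Suc (m + n)})" "(\<Union>n. {q ^ (m + n)<..q ^ Suc (m + n)}) = {q ^ m<..}"
proof -
  have *: "{q ^ (m + a)<..q ^ Suc (m + a)} \<inter> {q ^ (m + b)<..q ^ Suc (m + b)} = {}" if "a < b" for a b
  proof -
    have "q ^ Suc (m + a) \<le> q ^ (m + b)" using q that by (intro power_increasing) auto
    then show ?thesis by auto
  qed
  show "disjoint_family (\<lambda>n. {q ^ (m + n)<..q ^ Suc (m + n)})"
    unfolding disjoint_family_on_def
  proof (intro ballI impI)
    fix a b :: nat assume "a \<noteq> b"
    then consider "a < b" | "b < a" by linarith
    then show "{q ^ (m + a)<..q ^ Suc (m + a)} \<inter> {q ^ (m + b)<..q ^ Suc (m + b)} = {}"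
      using *[of a b] *[of b a] by cases blast+
  qed
  show "(\<Union>n. {q ^ (m + n)<..q ^ Suc (m + n)}) = {q ^ m<..}"
  proof (intro equalityI subsetI)
    fix t assume "t \<in> (\<Union>n. {q ^ (m + n)<..q ^ Suc (m + n)})"
    then obtain n where "t \<in> {q ^ (m + n)<..q ^ Suc (m + n)}" by (rule UN_E)
    then have "q ^ (m + n) < t" by (simp only: greaterThanAtMost_iff)
    moreover have "q ^ m \<le> q ^ (m + n)" using q by (intro power_increasing) auto
    ultimately show "t \<in> {q ^ m<..}" by simp
  next
    fix t assume t: "t \<in> {q ^ m<..}"
    obtain n0 where "t < q ^ n0" using real_arch_pow[OF q] by blast
    also have "q ^ n0 \<le> q ^ (m + n0)" using q by (intro power_increasing) auto
    finally have ex: "t \<le> q ^ (m + n0)" by simp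
    define n where "n = (LEAST n. t \<le> q ^ (m + n))"
    have n: "t \<le> q ^ (m + n)" unfolding n_def by (rule LeastI[of "\<lambda>n. t \<le> q ^ (m + n)", OF ex])
    have "n \<noteq> 0"
    proof
      assume "n = 0"
      with n t show False by simp
    qed
    then obtain k where k: "n = Suc k" by (cases n) auto
    have "\<not> t \<le> q ^ (m + k)" using not_less_Least[of k "\<lambda>n. t \<le> q ^ (m + n)"] k n_def by auto
    then have "t \<in> {q ^ (m + k)<..q ^ Suc (m + k)}" using n k by simp
    then show "t \<in> (\<Union>n. {q ^ (m + n)<..q ^ Suc (m + n)})" by blast
  qed
qed

definition test_integrand :: "real \<Rightarrow> (real \<Rightarrow> real) \<Rightarrow> real \<Rightarrow> real" where
  "test_integrand \<delta> h t = (h t / t) powr ((\<delta> - 2) / 2) * exp (- (h t / (2 * t))) / t"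

lemma test_integral_blocks:
  assumes h: "h \<in> H_infinity" and q: "q > 1"
  shows "test_integral \<delta> h (q ^ m)
    = (\<Sum>n. \<integral>\<^sup>+t\<in>{q ^ (m + n)<..q ^ Suc (m + n)}. ennreal (test_integrand \<delta> h t) \<partial>lborel)"
proof -
  obtain \<beta> c where H: "\<And>t. t > 0 \<Longrightarrow> h t > 0" "\<And>s t. 0 < s \<Longrightarrow> s \<le> t \<Longrightarrow> h s \<le> h t"
    using H_infinityE[OF h] by metis
  \<comment> \<open>h is monotone only on positive times; the value 0 elsewhere makes it monotone on
    the whole line, hence Borel.\<close>
  define g where "g t = (if t > 0 then h t else 0)" for t
  have "mono g" unfolding mono_def g_def using H by (auto intro: less_imp_le)
  then have g: "g \<in> borel_measurable borel" by (rule borel_measurable_mono)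
  have fm: "test_integrand \<delta> g \<in> borel_measurable lborel"
    unfolding test_integrand_def using g by measurable
  have q0: "q ^ m > 0" for m using q by simp
  have eq: "test_integrand \<delta> g t = test_integrand \<delta> h t" if "q ^ k < t" for t k
    using that q0[of k] by (simp add: test_integrand_def g_def)
  have "test_integral \<delta> h (q ^ m) = (\<integral>\<^sup>+t\<in>{q ^ m<..}. ennreal (test_integrand \<delta> g t) \<partial>lborel)"
    unfolding test_integral_def
    by (intro nn_integral_cong) (auto simp: indicator_def eq[of m] simp flip: test_integrand_def)
  also have "\<dots> = (\<integral>\<^sup>+t\<in>(\<Union>n. {q ^ (m + n)<..q ^ Suc (m + n)}). ennreal (test_integrand \<delta> g t) \<partial>lborel)"
    by (simp only: power_interval_family(2)[OF q])
  also have "\<dots> = (\<Sum>n. \<integral>\<^sup>+t\<in>{q ^ (m + n)<..q ^ Suc (m + n)}. ennreal (test_integrand \<delta> g t) \<partial>lborel)"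
    by (rule nn_integral_disjoint_family[OF _ _ power_interval_family(1)[OF q]]) (use fm in auto)
  also have "\<dots> = (\<Sum>n. \<integral>\<^sup>+t\<in>{q ^ (m + n)<..q ^ Suc (m + n)}. ennreal (test_integrand \<delta> h t) \<partial>lborel)"
    by (intro suminf_cong nn_integral_cong) (auto simp: indicator_def eq)
  finally show ?thesis .
qed

lemma eventually_test_integral_power:
  fixes q :: real
  assumes q: "q > 1" and ev: "\<forall>\<^sub>F l in at_top. P l"
  obtains m where "P (q ^ m)" "q ^ m > \<beta>"
proof -
  have lim: "filterlim (\<lambda>n. q ^ n) at_top sequentially"
    unfolding filterlim_at_top
  proof
    fix Z :: real
    obtain n0 where n0: "Z < q ^ n0" using real_arch_pow[OF q] by blast
    show "\<forall>\<^sub>F n in sequentially. Z \<le> q ^ n"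
    proof (rule eventually_sequentiallyI)
      fix n assume "n0 \<le> n"
      then have "q ^ n0 \<le> q ^ n" using q by (intro power_increasing) auto
      then show "Z \<le> q ^ n" using n0 by linarith
    qed
  qed
  have "\<forall>\<^sub>F l in at_top. P l \<and> l > \<beta>" using ev eventually_gt_at_top by (rule eventually_conj)
  from eventually_compose_filterlim[OF this lim] obtain m where "P (q ^ m) \<and> q ^ m > \<beta>"
    unfolding eventually_sequentially by blast
  then show thesis using that by blast
qed

lemma nn_integral_interval_const:
  fixes a b :: real
  assumes "a \<le> b"
  shows "(\<integral>\<^sup>+t\<in>{a<..b}. ennreal c \<partial>lborel) = ennreal c * ennreal (b - a)"
  using assms by (simp add: nn_integral_cmult_indicator)

text \<open>Each block is compared with its right end: monotonicity of h costs exactly the factor q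
  in the exponent. The power of h t / t is bounded below because h t / t stays away from 0, and the
  remaining factor has at least the mass \<open>1 - 1 / q\<close> on every block.\<close>

lemma summable_of_test_integral_finite:
  assumes h: "h \<in> H_infinity" and \<delta>: "\<delta> \<ge> 2" and q: "q > 1"
    and fin: "\<forall>\<^sub>F l in at_top. test_integral \<delta> h l < \<infinity>"
  shows "summable (\<lambda>n. exp (- (q * (h (q ^ n) / (2 * q ^ n)))))"
proof -
  obtain \<beta> c where H: "\<beta> > 1" "c > 0" "\<And>t. t > 0 \<Longrightarrow> h t > 0" "\<And>s t. 0 < s \<Longrightarrow> s \<le> t \<Longrightarrow> h s \<le> h t"
    "\<And>t. t > \<beta> \<Longrightarrow> c \<le> h t / t"
    using H_infinityE[OF h] by metis
  obtain m where m: "test_integral \<delta> h (q ^ m) < \<infinity>" "q ^ m > \<beta>"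
    using eventually_test_integral_power[OF q fin] by blast
  define k where "k = (\<delta> - 2) / 2"
  have k: "k \<ge> 0" using \<delta> by (simp add: k_def)
  define b where "b n = exp (- (q * (h (q ^ n) / (2 * q ^ n))))" for n
  define d where "d = c powr k * (1 - 1 / q)"
  have d: "d > 0" using H(2) q by (simp add: d_def)
  have le: "ennreal (d * b (Suc (m + n))) \<le> (\<integral>\<^sup>+t\<in>{q ^ (m + n)<..q ^ Suc (m + n)}. ennreal (test_integrand \<delta> h t) \<partial>lborel)" for n
  proof -
    define s where "s = q ^ (m + n)"
    have s: "s > 0" using q by (simp add: s_def)
    have sb: "s > \<beta>"
    proof -
      have "q ^ m \<le> q ^ (m + n)" using q by (intro power_increasing) auto
      then show ?thesis using m(2) by (simp add: s_def)
    qed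
    have qs: "q ^ Suc (m + n) = q * s" by (simp add: s_def)
    have sqs: "s \<le> q * s" using q s by simp
    have bb: "b (Suc (m + n)) = exp (- (h (q * s) / (2 * s)))" using q s unfolding b_def qs by simp
    have pt: "c powr k * exp (- (h (q * s) / (2 * s))) / (q * s) \<le> test_integrand \<delta> h t" if t: "s < t" "t \<le> q * s" for t
    proof -
      have t0: "t > 0" using t s by linarith
      have "c powr k \<le> (h t / t) powr k" using H(2) H(5)[of t] sb t k by (intro powr_mono2) auto
      moreover have "exp (- (h (q * s) / (2 * s))) \<le> exp (- (h t / (2 * t)))"
      proof -
        have "h t / (2 * t) \<le> h (q * s) / (2 * s)"
          using H(4)[OF t0 t(2)] H(3)[OF t0] t s by (intro frac_le) auto
        then show ?thesis by simp
      qed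
      ultimately have "c powr k * exp (- (h (q * s) / (2 * s))) \<le> (h t / t) powr k * exp (- (h t / (2 * t)))"
        by (intro mult_mono) auto
      then show ?thesis unfolding test_integrand_def k_def using t t0 by (intro frac_le) auto
    qed
    have "ennreal (d * b (Suc (m + n))) = ennreal (c powr k * exp (- (h (q * s) / (2 * s))) / (q * s)) * ennreal (q * s - s)"
    proof -
      have r: "(q * s - s) / (q * s) = 1 - 1 / q" using q s by (simp add: diff_divide_distrib)
      have "c powr k * exp (- (h (q * s) / (2 * s))) / (q * s) * (q * s - s)
        = c powr k * exp (- (h (q * s) / (2 * s))) * ((q * s - s) / (q * s))" by simp
      also have "\<dots> = d * b (Suc (m + n))" unfolding r bb d_def by simp
      finally show ?thesis using sqs by (subst ennreal_mult''[symmetric]) auto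
    qed
    also have "\<dots> = (\<integral>\<^sup>+t\<in>{s<..q * s}. ennreal (c powr k * exp (- (h (q * s) / (2 * s))) / (q * s)) \<partial>lborel)"
      by (rule nn_integral_interval_const[OF sqs, symmetric])
    also have "\<dots> \<le> (\<integral>\<^sup>+t\<in>{s<..q * s}. ennreal (test_integrand \<delta> h t) \<partial>lborel)"
      by (intro nn_integral_mono) (auto simp: indicator_def intro!: ennreal_leI pt)
    finally show ?thesis unfolding qs s_def[symmetric] .
  qed
  have "(\<Sum>n. ennreal (d * b (Suc (m + n)))) \<le> test_integral \<delta> h (q ^ m)"
    unfolding test_integral_blocks[OF h q] by (intro suminf_le le) auto
  then have "(\<Sum>n. ennreal (d * b (Suc (m + n)))) \<noteq> top" using m(1) by (auto simp: top_unique)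
  then have "summable (\<lambda>n. d * b (Suc (m + n)))"
    using d by (intro summable_suminf_not_top) (auto simp: b_def)
  then have "summable (\<lambda>n. b (n + Suc m))" using d by (simp add: add.commute)
  then have "summable b" by (subst (asm) summable_iff_shift)
  then show ?thesis by (simp add: b_def[abs_def])
qed

lemma powr_le_exp:
  fixes k \<gamma> :: real
  assumes k: "k \<ge> 0" and g: "\<gamma> > 0"
  obtains C where "C > 0" "\<And>y. y > 0 \<Longrightarrow> y powr k \<le> C * exp (\<gamma> * y)"
proof (cases "k = 0")
  case True
  show thesis by (rule that[of 1]) (use True g in auto)
next
  case False
  with k have k: "k > 0" by simp
  show thesis
  \<comment> \<open>The constant is \<open>(k / \<gamma>) powr k\<close>, from
    \<open>ln z \<le> z - 1\<close> at \<open>z = \<gamma> * y / k\<close> with the - 1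
    dropped.\<close>
  proof (rule that[of "exp (k * ln (k / \<gamma>))"])
    fix y :: real assume y: "y > 0"
    have "ln (\<gamma> * y / k) \<le> \<gamma> * y / k - 1" using k g y by (intro ln_le_minus_one) auto
    then have "ln y \<le> \<gamma> * y / k + ln (k / \<gamma>)" using k g y by (simp add: ln_div ln_mult)
    then have "k * ln y \<le> k * (\<gamma> * y / k + ln (k / \<gamma>))" using k by (intro mult_left_mono) auto
    also have "\<dots> = k * ln (k / \<gamma>) + \<gamma> * y" using k by (simp add: distrib_left)
    finally have "exp (k * ln y) \<le> exp (k * ln (k / \<gamma>) + \<gamma> * y)" by simp
    then show "y powr k \<le> exp (k * ln (k / \<gamma>)) * exp (\<gamma> * y)" using y by (simp add: powr_def exp_add)
  qed simp
qed

text \<open>The mirror comparison, now with the left end of each block, which costs the factor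
  \<open>1 / q\<close>. The power of h t / t is absorbed by giving up the share
  \<open>1 - \<alpha>\<close> of the exponent.\<close>

lemma not_summable_of_test_integral_infinite:
  assumes h: "h \<in> H_infinity" and \<delta>: "\<delta> \<ge> 2" and q: "q > 1" and \<alpha>: "0 < \<alpha>" "\<alpha> < 1"
    and inf: "\<forall>\<^sub>F l in at_top. test_integral \<delta> h l = \<infinity>"
  shows "\<not> summable (\<lambda>n. exp (- (\<alpha> / q * (h (q ^ n) / (2 * q ^ n)))))"
proof
  define b where "b n = exp (- (\<alpha> / q * (h (q ^ n) / (2 * q ^ n))))" for n
  assume "summable (\<lambda>n. exp (- (\<alpha> / q * (h (q ^ n) / (2 * q ^ n)))))"
  then have sb: "summable b" by (simp add: b_def[abs_def])
  obtain \<beta> c where H: "\<beta> > 1" "c > 0" "\<And>t. t > 0 \<Longrightarrow> h t > 0" "\<And>s t. 0 < s \<Longrightarrow> s \<le> t \<Longrightarrow> h s \<le> h t"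
    "\<And>t. t > \<beta> \<Longrightarrow> c \<le> h t / t"
    using H_infinityE[OF h] by metis
  obtain m where m: "test_integral \<delta> h (q ^ m) = \<infinity>"
    using eventually_test_integral_power[OF q inf] by blast
  define k where "k = (\<delta> - 2) / 2"
  have k: "k \<ge> 0" using \<delta> by (simp add: k_def)
  obtain C where C: "C > 0" "\<And>y. y > 0 \<Longrightarrow> y powr k \<le> C * exp ((1 - \<alpha>) / 2 * y)"
    using powr_le_exp[OF k, of "(1 - \<alpha>) / 2"] \<alpha> by auto
  have le: "(\<integral>\<^sup>+t\<in>{q ^ (m + n)<..q ^ Suc (m + n)}. ennreal (test_integrand \<delta> h t) \<partial>lborel) \<le> ennreal (C * (q - 1) * b (m + n))" for n
  proof -
    define s where "s = q ^ (m + n)"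
    have s: "s > 0" using q by (simp add: s_def)
    have qs: "q ^ Suc (m + n) = q * s" by (simp add: s_def)
    have sqs: "s \<le> q * s" using q s by simp
    have pt: "test_integrand \<delta> h t \<le> C * b (m + n) / s" if t: "s < t" "t \<le> q * s" for t
    proof -
      define y where "y = h t / t"
      have t0: "t > 0" using t s by linarith
      have y: "y > 0" using H(3)[OF t0] t0 by (simp add: y_def)
      have hs: "h s > 0" using H(3) s by blast
      have "(h t / t) powr k * exp (- (h t / (2 * t))) \<le> C * exp ((1 - \<alpha>) / 2 * y) * exp (- (y / 2))"
      proof -
        have e: "h t / (2 * t) = y / 2" by (simp add: y_def)
        show ?thesis unfolding e y_def[symmetric] by (rule mult_right_mono[OF C(2)[OF y]]) simp
      qed
      also have "\<dots> = C * exp (- (\<alpha> / 2 * y))" by (simp add: mult.assoc exp_add[symmetric] field_simps)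
      also have "\<dots> \<le> C * b (m + n)"
      proof -
        have "h s / (q * s) \<le> y"
          unfolding y_def using H(4)[OF s, of t] hs t s by (intro frac_le) auto
        then have "\<alpha> / 2 * (h s / (q * s)) \<le> \<alpha> / 2 * y" using \<alpha> by (intro mult_left_mono) auto
        moreover have "\<alpha> / 2 * (h s / (q * s)) = \<alpha> / q * (h s / (2 * s))" by simp
        ultimately show ?thesis using C(1) unfolding b_def s_def[symmetric] by (intro mult_left_mono) auto
      qed
      finally have "(h t / t) powr k * exp (- (h t / (2 * t))) \<le> C * b (m + n)" .
      then show ?thesis unfolding test_integrand_def k_def using t s C(1) by (intro frac_le) (auto simp: b_def)
    qed
    have "(\<integral>\<^sup>+t\<in>{s<..q * s}. ennreal (test_integrand \<delta> h t) \<partial>lborel) \<le> (\<integral>\<^sup>+t\<in>{s<..q * s}. ennreal (C * b (m + n) / s) \<partial>lborel)"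
      by (intro nn_integral_mono) (auto simp: indicator_def intro!: ennreal_leI pt)
    also have "\<dots> = ennreal (C * b (m + n) / s) * ennreal (q * s - s)"
      by (rule nn_integral_interval_const[OF sqs])
    also have "\<dots> = ennreal (C * (q - 1) * b (m + n))"
      using q s C(1) by (subst ennreal_mult'[symmetric]) (auto simp: b_def field_simps)
    finally show ?thesis unfolding qs s_def[symmetric] .
  qed
  have sm: "summable (\<lambda>n. C * (q - 1) * b (m + n))"
    using sb by (intro summable_mult) (simp add: add.commute[of m] summable_iff_shift)
  have "\<infinity> \<le> (\<Sum>n. ennreal (C * (q - 1) * b (m + n)))"
    unfolding m[symmetric] test_integral_blocks[OF h q] by (intro suminf_le le) auto
  moreover have "(\<Sum>n. ennreal (C * (q - 1) * b (m + n))) = ennreal (\<Sum>n. C * (q - 1) * b (m + n))"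
    using C(1) q by (intro suminf_ennreal2 sm) (auto simp: b_def)
  ultimately show False by (simp add: top_unique)
qed

text \<open>
  Comparing integral and sum requires a ratio \<open>q\<close> close to \<open>1\<close>, whereas an increment of \<open>B\<close> has almost
  the full variance only over steps of large ratio; passing to a residue class modulo \<open>m\<close> replaces
  \<open>q\<close> by \<open>q ^ m\<close>.
\<close>

lemma not_summable_residue_class:
  fixes b :: "nat \<Rightarrow> real"
  assumes b: "\<And>n. b n \<ge> 0" "\<not> summable b" and m: "m > 0"
  obtains r where "r < m" "\<not> summable (\<lambda>j. b (j * m + r))"
proof -
  have "\<exists>r<m. \<not> summable (\<lambda>j. b (j * m + r))"
  proof (rule ccontr)
    assume "\<not> ?thesis"
    then have s: "summable (\<lambda>j. \<Sum>r<m. b (j * m + r))" by (intro summable_sum) auto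
    have "summable b"
    proof (rule summableI_nonneg_bounded[OF b(1)])
      fix n
      have "sum b {..<n} \<le> sum b {..<n * m}" using m b(1) by (intro sum_mono2) auto
      also have "\<dots> = (\<Sum>j<n. sum b {j * m..<j * m + m})" by (rule sum.nat_group[symmetric])
      also have "\<dots> = (\<Sum>j<n. \<Sum>r<m. b (j * m + r))"
      proof (rule sum.cong[OF refl])
        fix j
        show "sum b {j * m..<j * m + m} = (\<Sum>r<m. b (j * m + r))"
          by (rule sum.reindex_bij_witness[of _ "\<lambda>r. j * m + r" "\<lambda>l. l - j * m"]) auto
      qed
      also have "\<dots> \<le> (\<Sum>j. \<Sum>r<m. b (j * m + r))"
        using s b(1) by (intro sum_le_suminf) (auto intro: sum_nonneg)
      finally show "sum b {..<n} \<le> (\<Sum>j. \<Sum>r<m. b (j * m + r))" .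
    qed
    with b(2) show False by blast
  qed
  then show thesis using that by blast
qed

section \<open>Tails and recurrence of Brownian increments\<close>

context brownian begin

text \<open>The density is bounded below on an interval of one standard deviation to the right of y.
  Young's inequality splits the square of its far end, so that the loss k > 1 in the exponent buys a
  prefactor independent of y.\<close>

lemma increment_tail:
  assumes uv: "0 \<le> u" "u < v" and y: "y \<ge> 0" and k: "k > 1"
  shows "exp (- (k / (k - 1)) / 2) / sqrt (2 * pi) * exp (- (k * y\<^sup>2 / (2 * (v - u))))
    \<le> prob {\<omega> \<in> space M. y < B v \<omega> - B u \<omega>}"
proof -
  define \<sigma> where "\<sigma> = sqrt (v - u)"
  have s: "\<sigma> > 0" "\<sigma>\<^sup>2 = v - u" using uv by (auto simp: \<sigma>_def)
  define c where "c = exp (- (k / (k - 1)) / 2) / sqrt (2 * pi) * exp (- (k * y\<^sup>2 / (2 * (v - u))))"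
  have c: "c \<ge> 0" by (simp add: c_def)
  have pt: "c / \<sigma> \<le> normal_density 0 \<sigma> z" if z: "y < z" "z \<le> y + \<sigma>" for z
  proof -
    have "z\<^sup>2 \<le> (y + \<sigma>)\<^sup>2" using z y by (intro power_mono) auto
    also have "\<dots> \<le> k * y\<^sup>2 + k / (k - 1) * \<sigma>\<^sup>2"
    proof -
      have "0 \<le> ((k - 1) * y - \<sigma>)\<^sup>2 / (k - 1)" using k by simp
      also have "\<dots> = k * y\<^sup>2 + k / (k - 1) * \<sigma>\<^sup>2 - (y + \<sigma>)\<^sup>2"
        using k by (simp add: power2_eq_square field_simps)
      finally show ?thesis by simp
    qed
    finally have "z\<^sup>2 / (2 * \<sigma>\<^sup>2) \<le> (k * y\<^sup>2 + k / (k - 1) * \<sigma>\<^sup>2) / (2 * \<sigma>\<^sup>2)"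
      by (intro divide_right_mono) auto
    also have "\<dots> = k * y\<^sup>2 / (2 * (v - u)) + k / (k - 1) / 2"
    proof -
      have "(a + r * \<sigma>\<^sup>2) / (2 * \<sigma>\<^sup>2) = a / (2 * \<sigma>\<^sup>2) + r / 2" for a r :: real
        using s(1) by (simp add: add_divide_distrib)
      then show ?thesis unfolding s(2)[symmetric] .
    qed
    finally have "exp (- (k / (k - 1)) / 2) * exp (- (k * y\<^sup>2 / (2 * (v - u)))) \<le> exp (- z\<^sup>2 / (2 * \<sigma>\<^sup>2))"
      by (simp add: mult_exp_exp)
    then have "exp (- (k / (k - 1)) / 2) * exp (- (k * y\<^sup>2 / (2 * (v - u)))) / (sqrt (2 * pi) * \<sigma>) \<le> exp (- z\<^sup>2 / (2 * \<sigma>\<^sup>2)) / (sqrt (2 * pi) * \<sigma>)"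
      using s by (intro divide_right_mono) auto
    moreover have "sqrt (2 * pi * \<sigma>\<^sup>2) = sqrt (2 * pi) * \<sigma>" using s(1) by (simp add: real_sqrt_mult)
    ultimately show ?thesis by (simp add: normal_density_def c_def)
  qed
  have "ennreal c = ennreal (c / \<sigma>) * ennreal (y + \<sigma> - y)"
    using s c by (subst ennreal_mult'[symmetric]) auto
  also have "\<dots> = (\<integral>\<^sup>+z\<in>{y<..y + \<sigma>}. ennreal (c / \<sigma>) \<partial>lborel)"
    using s by (intro nn_integral_interval_const[symmetric]) auto
  also have "\<dots> \<le> (\<integral>\<^sup>+z. ennreal (normal_density 0 \<sigma> z) * indicator {y<..} z \<partial>lborel)"
    by (intro nn_integral_mono) (auto simp: indicator_def intro!: ennreal_leI pt)
  also have "\<dots> = emeasure M ((\<lambda>\<omega>. B v \<omega> - B u \<omega>) -` {y<..} \<inter> space M)"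
    using distributed_emeasure[OF increment_distributed[OF uv], of "{y<..}"] by (simp add: \<sigma>_def)
  also have "(\<lambda>\<omega>. B v \<omega> - B u \<omega>) -` {y<..} \<inter> space M = {\<omega> \<in> space M. y < B v \<omega> - B u \<omega>}" by auto
  finally show ?thesis unfolding c_def[symmetric] by (simp add: emeasure_eq_measure)
qed

text \<open>The second Borel-Cantelli lemma, one increment at a time: avoidance up to index
  \<open>i + N\<close> is an event of \<open>F (\<tau> (i + N))\<close>, hence independent of the
  next increment, and \<open>1 - p \<le> exp (- p)\<close> turns divergence of the sum into
  probability 0.\<close>

lemma increments_infinitely_often:
  fixes \<tau> :: "nat \<Rightarrow> real" and y :: "nat \<Rightarrow> real"
  defines "D \<equiv> \<lambda>j \<omega>. B (\<tau> (Suc j)) \<omega> - B (\<tau> j) \<omega>"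
  assumes \<tau>: "strict_mono \<tau>" "\<tau> 0 \<ge> 0"
    and ns: "\<not> summable (\<lambda>j. prob {\<omega> \<in> space M. y j < D j \<omega>})"
  shows "AE \<omega> in M. \<forall>i. \<exists>j\<ge>i. y j < D j \<omega>"
proof (subst AE_all_countable, intro allI)
  fix i
  let ?p = "\<lambda>j. prob {\<omega> \<in> space M. y j < D j \<omega>}"
  have t0: "\<tau> j \<ge> 0" for j using \<tau> by (metis le0 order_trans strict_mono_less_eq)
  have tl: "\<tau> j < \<tau> (Suc j)" for j using \<tau>(1) by (simp add: strict_mono_Suc_iff)
  have Dm: "D j \<in> borel_measurable M" for j unfolding D_def by (rule increment_measurable[OF t0 tl])
  define A where "A N = {\<omega> \<in> space M. \<forall>j\<in>{i..<i + N}. D j \<omega> \<le> y j}" for N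
  have AF: "A N \<in> sets (F (\<tau> (i + N)))" for N
  proof -
    have "{\<omega> \<in> space (F (\<tau> (i + N))). \<forall>j\<in>{i..<i + N}. D j \<omega> \<le> y j} \<in> sets (F (\<tau> (i + N)))"
    proof (rule sets.sets_Collect_finite_All)
      fix j assume "j \<in> {i..<i + N}"
      then have "\<tau> (Suc j) \<le> \<tau> (i + N)" using \<tau>(1) by (simp add: strict_mono_less_eq)
      moreover from this have "\<tau> j \<le> \<tau> (i + N)" using tl[of j] by linarith
      ultimately have "D j \<in> borel_measurable (F (\<tau> (i + N)))"
        unfolding D_def using B_adapted_le[OF t0] by (intro borel_measurable_diff) auto
      then show "{\<omega> \<in> space (F (\<tau> (i + N))). D j \<omega> \<le> y j} \<in> sets (F (\<tau> (i + N)))" by measurable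
    qed simp
    then show ?thesis unfolding A_def space_F .
  qed
  have AM: "A N \<in> events" for N using AF sets_F_M by blast
  have ind: "prob (A N) \<le> exp (- (\<Sum>j\<in>{i..<i + N}. ?p j))" for N
  proof (induction N)
    case 0
    then show ?case by simp
  next
    case (Suc N)
    let ?j = "i + N"
    have eq: "A (Suc N) = A N \<inter> (D ?j -` {..y ?j} \<inter> space M)"
      by (auto simp: A_def less_Suc_eq)
    have "D ?j -` {..y ?j} \<inter> space M \<in> {(\<lambda>\<omega>. B (\<tau> (Suc ?j)) \<omega> - B (\<tau> ?j) \<omega>) -` A \<inter> space M |A. A \<in> sets borel}"
      unfolding D_def by (intro CollectI exI[of _ "{..y ?j}"] conjI refl) simp
    from indep_setD[OF increment_indep[OF t0 tl] AF[of N] this]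
    have "prob (A (Suc N)) = prob (A N) * prob (D ?j -` {..y ?j} \<inter> space M)"
      unfolding eq .
    also have "prob (D ?j -` {..y ?j} \<inter> space M) = 1 - ?p ?j"
    proof -
      have "D ?j -` {..y ?j} \<inter> space M = space M - {\<omega> \<in> space M. y ?j < D ?j \<omega>}" by auto
      moreover have "{\<omega> \<in> space M. y ?j < D ?j \<omega>} \<in> events" using Dm[of ?j] by measurable
      ultimately show ?thesis by (simp add: prob_compl)
    qed
    also have "prob (A N) * (1 - ?p ?j) \<le> exp (- (\<Sum>j\<in>{i..<i + N}. ?p j)) * exp (- ?p ?j)"
      using Suc exp_ge_add_one_self[of "- ?p ?j"] by (intro mult_mono) auto
    also have "\<dots> = exp (- (\<Sum>j\<in>{i..<i + Suc N}. ?p j))" by (simp add: mult_exp_exp)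
    finally show ?case .
  qed
  define S where "S N = (\<Sum>j<N. ?p (j + i))" for N
  have S: "S N = (\<Sum>j\<in>{i..<i + N}. ?p j)" for N
    unfolding S_def using sum.atLeastLessThan_shift_bounds[of ?p 0 i N] by (simp add: atLeast0LessThan comp_def add.commute)
  have nsi: "\<not> summable (\<lambda>j. ?p (j + i))" using ns summable_iff_shift[of ?p i] by blast
  have z: "prob (space M - {\<omega> \<in> space M. \<exists>j\<ge>i. y j < D j \<omega>}) = 0"
  proof (rule ccontr)
    let ?N = "space M - {\<omega> \<in> space M. \<exists>j\<ge>i. y j < D j \<omega>}"
    assume "prob ?N \<noteq> 0"
    then have p: "prob ?N > 0" by (simp add: zero_less_measure_iff)
    have bd: "S N \<le> - ln (prob ?N)" for N
    proof -
      have "prob ?N \<le> prob (A N)" by (rule finite_measure_mono[OF _ AM]) (auto simp: A_def not_less)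
      also have "\<dots> \<le> exp (- S N)" using ind[of N] S by simp
      finally have "ln (prob ?N) \<le> ln (exp (- S N))" using p by (intro ln_le_cancel_iff[THEN iffD2]) auto
      then show ?thesis by simp
    qed
    have "summable (\<lambda>j. ?p (j + i))"
      by (rule summableI_nonneg_bounded[OF measure_nonneg bd[unfolded S_def]])
    with nsi show False by blast
  qed
  have ev: "{\<omega> \<in> space M. \<exists>j\<ge>i. y j < D j \<omega>} \<in> events"
    using Dm by measurable
  have "prob {\<omega> \<in> space M. \<exists>j\<ge>i. y j < D j \<omega>} = 1"
    using z prob_compl[OF ev] by simp
  then show "AE \<omega> in M. \<exists>j\<ge>i. y j < D j \<omega>"
    using prob_Collect_eq_1[OF ev] by blast
qed

end

section \<open>Exceedances\<close>

context squared_bessel_process begin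

lemma exceed_finitely_often:
  assumes h: "h \<in> H_infinity" and \<epsilon>: "\<epsilon> > 0"
    and fin: "\<forall>\<^sub>F l in at_top. test_integral \<delta> h l < \<infinity>"
  shows "AE \<omega> in M. \<not> (\<forall>s>0. \<exists>t>s. (1 + \<epsilon>) * h t < X t \<omega>)"
proof -
  obtain \<beta> c where H: "\<And>t. t > 0 \<Longrightarrow> h t > 0" "\<And>s t. 0 < s \<Longrightarrow> s \<le> t \<Longrightarrow> h s \<le> h t"
    using H_infinityE[OF h] by metis
  \<comment> \<open>Three factors q are available: two pay for
    \<open>c n + t \<le> q ^ Suc (Suc n)\<close> against \<open>q ^ n\<close>, the third is the one
    lost in the summability criterion.\<close>
  define q where "q = root 3 (1 + \<epsilon>)"
  have q: "q > 1" "q ^ 3 = 1 + \<epsilon>" using \<epsilon> by (auto simp: q_def)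
  have q0: "q ^ n > 0" for n using q by simp
  define b where "b n = exp (- (q * (h (q ^ n) / (2 * q ^ n))))" for n
  have sb: "summable b"
    unfolding b_def by (rule summable_of_test_integral_finite[OF h \<delta>_ge q(1) fin])
  \<comment> \<open>An offset proportional to the block: it is small enough that
    \<open>c n + t\<close> stays below \<open>q ^ Suc (Suc n)\<close> on the block, and large enough
    that the ratio \<open>q ^ Suc (Suc n) / c n\<close> is the same for all n. Hence the constant
    D.\<close>
  define c where "c n = (q - 1) * q ^ Suc n" for n
  have c: "c n > 0" for n using q by (simp add: c_def)
  have cq: "c n + q ^ Suc n = q ^ Suc (Suc n)" for n by (simp add: c_def algebra_simps)
  \<comment> \<open>The level that \<open>exp (Y (c n) t \<omega>)\<close> exceeds whenever X
    exceeds \<open>(1 + \<epsilon>) * h t\<close> at a time t of block n.\<close>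
  define K where "K n = exp (q * (h (q ^ n) / (2 * q ^ n)) - \<delta> / 2 * ln (q ^ Suc (Suc n)))" for n
  define D where "D = exp (\<bar>x\<bar> / (2 * (q - 1)) + \<delta> / 2 * ln (q / (q - 1)))"
  have "\<exists>U. U \<in> events \<and> prob U \<le> exp (x / (2 * c n) - \<delta> / 2 * ln (c n)) / K n \<and>
    (\<forall>\<omega> t. \<omega> \<in> space M \<and> t \<ge> 0 \<and> K n < exp (Y (c n) t \<omega>) \<longrightarrow> \<omega> \<in> U)" for n
    using maximal_inequality[OF c, of "K n" n] unfolding K_def by (metis exp_gt_zero)
  then obtain U where U: "\<And>n. U n \<in> events" "\<And>n. prob (U n) \<le> exp (x / (2 * c n) - \<delta> / 2 * ln (c n)) / K n"
    "\<And>n \<omega> t. \<omega> \<in> space M \<Longrightarrow> t \<ge> 0 \<Longrightarrow> K n < exp (Y (c n) t \<omega>) \<Longrightarrow> \<omega> \<in> U n"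
    by metis
  have PU: "prob (U n) \<le> D * b n" for n
  proof -
    have "x / (2 * c n) \<le> \<bar>x\<bar> / (2 * (q - 1))"
    proof -
      have "(q - 1) * 1 \<le> (q - 1) * q ^ Suc n" using q by (intro mult_left_mono one_le_power) auto
      then have "q - 1 \<le> c n" by (simp add: c_def)
      then show ?thesis using q by (intro frac_le) auto
    qed
    moreover have "\<delta> / 2 * ln (q ^ Suc (Suc n)) - \<delta> / 2 * ln (c n) = \<delta> / 2 * ln (q / (q - 1))"
    proof -
      have "ln (q ^ Suc (Suc n)) - ln (c n) = ln (q ^ Suc (Suc n) / c n)"
        using less_imp_neq[OF c[of n]] less_imp_neq[OF q0[of "Suc (Suc n)"]]
        by (simp add: ln_div[of "q ^ Suc (Suc n)"] del: power_Suc)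
      also have "q ^ Suc (Suc n) / c n = q / (q - 1)" using q by (simp add: c_def)
      finally show ?thesis by (simp add: right_diff_distrib[symmetric])
    qed
    ultimately have "x / (2 * c n) - \<delta> / 2 * ln (c n) - (q * (h (q ^ n) / (2 * q ^ n)) - \<delta> / 2 * ln (q ^ Suc (Suc n)))
      \<le> \<bar>x\<bar> / (2 * (q - 1)) + \<delta> / 2 * ln (q / (q - 1)) + - (q * (h (q ^ n) / (2 * q ^ n)))" by linarith
    then have "exp (x / (2 * c n) - \<delta> / 2 * ln (c n)) / K n \<le> D * b n"
      unfolding K_def D_def b_def by (simp only: exp_diff[symmetric] exp_add[symmetric] exp_le_cancel_iff)
    then show ?thesis using U(2)[of n] by linarith
  qed
  have "AE \<omega> in M. \<forall>\<^sub>F n in sequentially. \<omega> \<in> space M - U n"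
  proof (rule borel_cantelli_AE1[OF U(1)])
    show "emeasure M (U n) < \<infinity>" for n by (simp add: emeasure_eq_measure)
    show "summable (\<lambda>n. prob (U n))"
    proof (rule summable_comparison_test'[of "\<lambda>n. D * b n" 0])
      show "summable (\<lambda>n. D * b n)" by (rule summable_mult[OF sb])
      show "norm (prob (U n)) \<le> D * b n" for n using PU[of n] by simp
    qed
  qed
  then show ?thesis
  proof eventually_elim
    case (elim \<omega>)
    then obtain N where N: "\<And>n. n \<ge> N \<Longrightarrow> \<omega> \<in> space M - U n" by (auto simp: eventually_sequentially)
    have w: "\<omega> \<in> space M" using N[of N] by simp
    have "\<not> (1 + \<epsilon>) * h t < X t \<omega>" if t: "t > q ^ N" for t
    proof
      assume ex: "(1 + \<epsilon>) * h t < X t \<omega>"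
      have "t \<in> (\<Union>n. {q ^ (N + n)<..q ^ Suc (N + n)})"
        unfolding power_interval_family(2)[OF q(1)] using t by simp
      then obtain k where "t \<in> {q ^ (N + k)<..q ^ Suc (N + k)}" by (rule UN_E)
      then obtain n where n: "n \<ge> N" and tn: "q ^ n < t" "t \<le> q ^ Suc n"
        by (metis greaterThanAtMost_iff le_add1)
      have t0: "t > 0" using tn q0[of n] by linarith
      have ct: "c n + t > 0" "c n + t \<le> q ^ Suc (Suc n)" using c[of n] t0 tn cq[of n] by auto
      have hn: "h (q ^ n) \<le> h t" using H(2)[OF q0[of n]] tn by simp
      have "q * (h (q ^ n) / (2 * q ^ n)) = (1 + \<epsilon>) * h (q ^ n) / (2 * q ^ Suc (Suc n))"
        using q(1) unfolding q(2)[symmetric] by (simp add: power3_eq_cube)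
      also have "\<dots> \<le> (1 + \<epsilon>) * h t / (2 * (c n + t))"
        using hn H(1)[OF t0] ct \<epsilon> by (intro frac_le mult_left_mono) auto
      also have "\<dots> < X t \<omega> / (2 * (c n + t))"
        using ex ct by (intro divide_strict_right_mono) auto
      finally have 1: "q * (h (q ^ n) / (2 * q ^ n)) < X t \<omega> / (2 * (c n + t))" .
      have "\<delta> / 2 * ln (c n + t) \<le> \<delta> / 2 * ln (q ^ Suc (Suc n))"
        using ct \<delta>_ge by (intro mult_left_mono) auto
      with 1 have "K n < exp (Y (c n) t \<omega>)" unfolding K_def Y_def exp_less_cancel_iff by linarith
      from U(3)[OF w less_imp_le[OF t0] this] have "\<omega> \<in> U n" .
      then show False using N[OF n] by blast
    qed
    then show ?case using q0[of N] by blast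
  qed
qed

lemma exceed_infinitely_often:
  assumes h: "h \<in> H_infinity" and \<epsilon>: "0 < \<epsilon>" "\<epsilon> < 1"
    and inf: "\<forall>\<^sub>F l in at_top. test_integral \<delta> h l = \<infinity>"
  shows "AE \<omega> in M. \<forall>s>0. \<exists>t>s. (1 - \<epsilon>) * h t < X t \<omega>"
proof -
  obtain \<beta> c where H: "\<And>t. t > 0 \<Longrightarrow> h t > 0" "\<And>s t. 0 < s \<Longrightarrow> s \<le> t \<Longrightarrow> h s \<le> h t"
    using H_infinityE[OF h] by metis
  define a where "a = 1 - \<epsilon>"
  have a: "0 < a" "a < 1" using \<epsilon> by (auto simp: a_def)
  \<comment> \<open>Four factors q separate a from 1. Two are spent on the tail bound, taken with k
    = q, and on the variance, which is only \<open>\<tau> (Suc j) / q\<close>; the other two are the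
    \<alpha> = 1 / q and the 1 / q of the divergence criterion.\<close>
  define q where "q = root 4 (1 / a)"
  have q: "q > 1" "q ^ 4 = 1 / a" using a by (auto simp: q_def)
  have q0: "q ^ n > 0" for n using q by simp
  define b where "b n = exp (- (1 / q / q * (h (q ^ n) / (2 * q ^ n))))" for n
  have nsb: "\<not> summable b"
    unfolding b_def using q by (intro not_summable_of_test_integral_infinite[OF h \<delta>_ge q(1) _ _ inf]) auto
  have "1 - 1 / q > 0" using q by simp
  \<comment> \<open>With ratio \<open>q ^ m\<close> between consecutive times, the increment covers
    at least the share \<open>1 / q\<close> of the final time.\<close>
  then obtain m where m: "(1 / q) ^ m < 1 - 1 / q" using real_arch_pow_inv[of "1 - 1 / q" "1 / q"] q by auto
  have m0: "m > 0"
  proof (rule ccontr)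
    assume "\<not> m > 0"
    with m q show False by simp
  qed
  obtain r where r: "\<not> summable (\<lambda>j. b (j * m + r))"
  proof -
    have "b n \<ge> 0" for n by (simp add: b_def)
    then show thesis using not_summable_residue_class[OF _ nsb m0] that by blast
  qed
  define \<tau> where "\<tau> j = q ^ (j * m + r)" for j
  have \<tau>0: "\<tau> j > 0" for j using q0 by (simp add: \<tau>_def)
  have \<tau>q: "\<tau> j = \<tau> (Suc j) * (1 / q) ^ m" for j
    using q(1) by (simp add: \<tau>_def power_add power_one_over)
  have \<tau>m: "strict_mono \<tau>"
    unfolding \<tau>_def using q m0 by (intro strict_monoI power_strict_increasing) auto
  have \<tau>l: "\<tau> j < \<tau> (Suc j)" for j using \<tau>m by (simp add: strict_mono_Suc_iff)
  have gap: "\<tau> (Suc j) / q \<le> \<tau> (Suc j) - \<tau> j" for j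
  proof -
    have "\<tau> (Suc j) * (1 / q) ^ m \<le> \<tau> (Suc j) * (1 - 1 / q)" using m \<tau>0[of "Suc j"] by (intro mult_left_mono) auto
    then show ?thesis unfolding \<tau>q[of j] by (simp add: algebra_simps)
  qed
  \<comment> \<open>sqrt X is nonnegative at the start of the step and gains at least as much as B,
    so a gain above \<open>y j\<close> forces X above \<open>a * h (\<tau> (Suc j))\<close> at its
    end.\<close>
  define y where "y j = sqrt (a * h (\<tau> (Suc j)))" for j
  define d where "d = exp (- (q / (q - 1)) / 2) / sqrt (2 * pi)"
  have d: "d > 0" by (simp add: d_def)
  have p: "d * b (Suc j * m + r) \<le> prob {\<omega> \<in> space M. y j < B (\<tau> (Suc j)) \<omega> - B (\<tau> j) \<omega>}" for j
  proof -
    let ?t = "\<tau> (Suc j)"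
    have hp: "h ?t > 0" using H(1) \<tau>0 by blast
    have "q * (y j)\<^sup>2 / (2 * (?t - \<tau> j)) \<le> q * (a * h ?t) / (2 * (?t / q))"
    proof (rule frac_le)
      show "q * (y j)\<^sup>2 \<le> q * (a * h ?t)" using a hp by (simp add: y_def)
      show "0 < 2 * (?t / q)" using \<tau>0 q by simp
      show "2 * (?t / q) \<le> 2 * (?t - \<tau> j)" using gap[of j] by simp
    qed (use q a hp in auto)
    also have "\<dots> = 1 / q / q * (h ?t / (2 * ?t))"
    proof -
      have "a = 1 / q ^ 4" using q a by simp
      then show ?thesis using q(1) by (simp add: power4_eq_xxxx)
    qed
    finally have "d * b (Suc j * m + r) \<le> d * exp (- (q * (y j)\<^sup>2 / (2 * (?t - \<tau> j))))"
      using d unfolding b_def \<tau>_def[of "Suc j", symmetric] by (intro mult_left_mono) auto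
    also have "\<dots> \<le> prob {\<omega> \<in> space M. y j < B ?t \<omega> - B (\<tau> j) \<omega>}"
      unfolding d_def using \<tau>0[of j] \<tau>l[of j] a hp q(1) by (intro increment_tail) (auto simp: y_def)
    finally show ?thesis .
  qed
  have ns: "\<not> summable (\<lambda>j. prob {\<omega> \<in> space M. y j < B (\<tau> (Suc j)) \<omega> - B (\<tau> j) \<omega>})"
  proof
    assume s: "summable (\<lambda>j. prob {\<omega> \<in> space M. y j < B (\<tau> (Suc j)) \<omega> - B (\<tau> j) \<omega>})"
    have "summable (\<lambda>j. d * b (Suc j * m + r))"
      by (rule summable_comparison_test'[OF s, of 0]) (use p d in \<open>simp add: b_def\<close>)
    then have "summable (\<lambda>j. b (Suc j * m + r))" using d by simp
    then have "summable (\<lambda>j. b (j * m + r))" using summable_Suc_iff[of "\<lambda>j. b (j * m + r)"] by blast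
    with r show False by blast
  qed
  show ?thesis
    using increments_infinitely_often[OF \<tau>m less_imp_le[OF \<tau>0] ns] sqrt_increment AE_space
  proof eventually_elim
    case (elim \<omega>)
    show ?case
    proof (intro allI impI)
      fix s :: real assume "s > 0"
      obtain n where n: "s < q ^ n" using real_arch_pow[OF q(1)] by blast
      obtain j where j: "j \<ge> n" "y j < B (\<tau> (Suc j)) \<omega> - B (\<tau> j) \<omega>" using elim(1) by blast
      have "j * 1 \<le> Suc j * m" using m0 by (intro mult_le_mono) auto
      then have "n \<le> Suc j * m + r" using j(1) by linarith
      then have "q ^ n \<le> \<tau> (Suc j)" unfolding \<tau>_def using q by (intro power_increasing) auto
      then have ts: "\<tau> (Suc j) > s" using n by linarith
      have "B (\<tau> (Suc j)) \<omega> - B (\<tau> j) \<omega> \<le> sqrt (X (\<tau> (Suc j)) \<omega>) - sqrt (X (\<tau> j) \<omega>)"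
        using elim(2) \<tau>0[of j] \<tau>l[of j] by (simp add: less_imp_le)
      moreover have "sqrt (X (\<tau> j) \<omega>) \<ge> 0" using X_nonneg[OF elim(3)] \<tau>0[of j] by simp
      ultimately have "y j < sqrt (X (\<tau> (Suc j)) \<omega>)" using j(2) by linarith
      then have "a * h (\<tau> (Suc j)) < X (\<tau> (Suc j)) \<omega>" unfolding y_def by simp
      then show "\<exists>t>s. (1 - \<epsilon>) * h t < X t \<omega>" using ts unfolding a_def by blast
    qed
  qed
qed

end

section \<open>Both halves of the integral test\<close>

lemma squared_bessel_imp_process:
  assumes "squared_bessel M \<delta> x X" "\<delta> \<ge> 2"
  obtains F B I where "squared_bessel_process M F B X I x \<delta>"
proof -
  from assms(1) obtain F B I where *: "filtered_prob_space M F" "brownian_motion M F B"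
    "adapted F X" "continuous_paths M X" "\<And>\<omega> t. \<omega> \<in> space M \<Longrightarrow> 0 \<le> t \<Longrightarrow> 0 \<le> X t \<omega>"
    "ito_integral M F B (\<lambda>s \<omega>. sqrt (X s \<omega>)) I" "AE \<omega> in M. \<forall>t\<ge>0. X t \<omega> = x + 2 * I t \<omega> + \<delta> * t"
    unfolding squared_bessel_def by blast
  have "brownian M F B"
    using * by (auto simp: brownian_def brownian_axioms_def filtered_prob_space_def)
  then have "squared_bessel_process M F B X I x \<delta>"
    using * assms(2) by (auto simp: squared_bessel_process_def squared_bessel_process_axioms_def)
  then show thesis by (rule that)
qed

theorem theorem12:
  fixes \<delta> :: real and h :: "real \<Rightarrow> real"
  assumes "\<delta> \<ge> 2" and "h \<in> H_infinity"
  shows "((\<forall>\<^sub>F l in at_top. test_integral \<delta> h l < \<infinity>) \<longrightarrow>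
           (\<forall>\<epsilon>>0. \<forall>x\<ge>0. \<forall>(M :: 'a measure) X. squared_bessel M \<delta> x X \<longrightarrow>
              measure M {\<omega>\<in>space M. \<forall>s>0. \<exists>t>s. X t \<omega> > (1 + \<epsilon>) * h t} = 0)) \<and>
         ((\<forall>\<^sub>F l in at_top. test_integral \<delta> h l = \<infinity>) \<longrightarrow>
           (\<forall>\<epsilon>>0. \<forall>x\<ge>0. \<forall>(M :: 'a measure) X. squared_bessel M \<delta> x X \<longrightarrow>
              measure M {\<omega>\<in>space M. \<forall>s>0. \<exists>t>s. X t \<omega> > (1 - \<epsilon>) * h t} = 1))"
proof (intro conjI impI allI)
  fix \<epsilon> x :: real and M :: "'a measure" and X
  assume fin: "\<forall>\<^sub>F l in at_top. test_integral \<delta> h l < \<infinity>" and \<epsilon>: "\<epsilon> > 0" and X: "squared_bessel M \<delta> x X"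
  obtain F B I where "squared_bessel_process M F B X I x \<delta>"
    using squared_bessel_imp_process[OF X assms(1)] by blast
  then interpret squared_bessel_process M F B X I x \<delta> .
  show "prob {\<omega>\<in>space M. \<forall>s>0. \<exists>t>s. X t \<omega> > (1 + \<epsilon>) * h t} = 0"
    using prob_Collect_eq_0[OF exceed_infinitely_often_measurable[OF X assms(2)]]
      exceed_finitely_often[OF assms(2) \<epsilon> fin] by blast
next
  fix \<epsilon> x :: real and M :: "'a measure" and X
  assume inf: "\<forall>\<^sub>F l in at_top. test_integral \<delta> h l = \<infinity>" and \<epsilon>: "\<epsilon> > 0" and X: "squared_bessel M \<delta> x X"
  obtain F B I where "squared_bessel_process M F B X I x \<delta>"
    using squared_bessel_imp_process[OF X assms(1)] by blast
  then interpret squared_bessel_process M F B X I x \<delta> .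
  \<comment> \<open>The lower bound is available for parameters below 1; decreasing the parameter
    raises the threshold, so the result for \<epsilon>' implies the one for \<epsilon>.\<close>
  define \<epsilon>' where "\<epsilon>' = min \<epsilon> (1 / 2)"
  have e: "0 < \<epsilon>'" "\<epsilon>' < 1" "\<epsilon>' \<le> \<epsilon>" using \<epsilon> by (auto simp: \<epsilon>'_def)
  have "AE \<omega> in M. \<forall>s>0. \<exists>t>s. X t \<omega> > (1 - \<epsilon>) * h t"
    using exceed_infinitely_often[OF assms(2) e(1,2) inf]
  proof eventually_elim
    case (elim \<omega>)
    show ?case
    proof (intro allI impI)
      fix s :: real assume s: "s > 0"
      then obtain t where t: "t > s" "(1 - \<epsilon>') * h t < X t \<omega>" using elim by blast
      have "h t > 0" using assms(2) t s by (auto simp: H_infinity_def)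
      then have "(1 - \<epsilon>) * h t \<le> (1 - \<epsilon>') * h t" using e by (intro mult_right_mono) auto
      with t show "\<exists>t>s. X t \<omega> > (1 - \<epsilon>) * h t" by (intro exI[of _ t]) auto
    qed
  qed
  then show "prob {\<omega>\<in>space M. \<forall>s>0. \<exists>t>s. X t \<omega> > (1 - \<epsilon>) * h t} = 1"
    using prob_Collect_eq_1[OF exceed_infinitely_often_measurable[OF X assms(2)]] by blast
qed

end
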